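(* Let $\alpha\in\mathfrak S_a$ be a permutation, let $b\ge 1$ be an integer, let $\iota_b=12\cdots b$ be the identity of $\mathfrak S_b$, and let $\pi=21[\alpha,\iota_b]$. Then (i) $\operatorname{diam}(G_{\alpha})+\ell(\alpha)b(a-1)+\binom{a}{2}\binom{b}{2}\le \operatorname{diam}(G_{\pi})\le \operatorname{diam}(G_{\alpha})+\ell(\alpha)b(a-1)+2\binom{a}{2}\binom{b}{2}$; (ii) $\operatorname{diam}(C_{\pi})=\operatorname{diam}(C_{\alpha})+\ell(\alpha)b$; (iii) $\operatorname{diam}(B_{\alpha})+\ell(\alpha)b(a-2)+\binom{a}{2}\binom{b}{2}\le \operatorname{diam}(B_{\pi})\le \operatorname{diam}(B_{\alpha})+\ell(\alpha)b(a-2)+2\binom{a}{2}\binom{b}{2}$.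
   Context: For $\pi\in\mathfrak S_n$, $s_i=(i,i+1)$ denotes the adjacent transposition, $\ell(\pi)$ is the length of $\pi$ (its number of inversions), and $R(\pi)$ is the set of reduced words of $\pi$, i.e. words $r_1r_2\cdots r_{\ell(\pi)}$ with letters in $[n-1]$ such that $\pi=s_{r_1}s_{r_2}\cdots s_{r_{\ell(\pi)}}$. A commutation move exchanges two adjacent letters $jk$ with $|j-k|>1$; a long braid move replaces three consecutive letters $j(j+1)j$ by $(j+1)j(j+1)$ or vice versa. $G_\pi$ is the graph on vertex set $R(\pi)$ whose edges join words related by a single commutation move or a single long braid move. $C_\pi$ is obtained from $G_\pi$ by contracting all commutation edges (vertices are commutation classes; adjacency via a long braid move), and $B_\pi$ is obtained from $G_\pi$ by contracting all long braid edges (vertices are braid classes; adjacency via a commutation move). The diameter of a connected graph is the maximum distance between two of its vertices (a one-vertex graph has diameter $0$). For $\alpha\in\mathfrak S_a$ and $\beta\in\mathfrak S_b$, the inflation $21[\alpha,\beta]$ is the permutation $(\alpha_1+b)\cdots(\alpha_a+b)\beta_1\cdots\beta_b\in\mathfrak S_{a+b}$ in one-line notation. *)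

theory Defs
  imports
    "HOL-Combinatorics.Permutations"
    "HOL-Library.Extended_Real"
    "Graph_Theory.Pair_Digraph"
    "Graph_Theory.Shortest_Path"
begin

section \<open>Permutations and reduced words\<close>

text \<open>
  A permutation in the symmetric group on \<open>n\<close> letters is a function \<open>p\<close> with
  \<open>p permutes {1..n}\<close>; its one-line notation is \<open>p 1, ..., p n\<close>.
\<close>

definition inversions :: "nat \<Rightarrow> (nat \<Rightarrow> nat) \<Rightarrow> (nat \<times> nat) set" where
  "inversions n p = {(i, j). 1 \<le> i \<and> i < j \<and> j \<le> n \<and> p i > p j}"

definition perm_length :: "nat \<Rightarrow> (nat \<Rightarrow> nat) \<Rightarrow> nat" where
  "perm_length n p = card (inversions n p)"

definition adj_transp :: "nat \<Rightarrow> nat \<Rightarrow> nat" where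
  "adj_transp i = transpose i (i + 1)"

text \<open>
  Products are compositions of functions, the rightmost factor acting first. With the opposite
  convention every word is reversed and the permutation is replaced by its inverse.
\<close>

definition word_prod :: "nat list \<Rightarrow> nat \<Rightarrow> nat" where
  "word_prod w = foldr (\<lambda>i p. adj_transp i \<circ> p) w id"

definition reduced_words :: "nat \<Rightarrow> (nat \<Rightarrow> nat) \<Rightarrow> nat list set" where
  "reduced_words n p =
    {w. set w \<subseteq> {1..<n} \<and> length w = perm_length n p \<and> p = word_prod w}"

definition inflation21 ::
  "nat \<Rightarrow> nat \<Rightarrow> (nat \<Rightarrow> nat) \<Rightarrow> (nat \<Rightarrow> nat) \<Rightarrow> nat \<Rightarrow> nat" where
  "inflation21 a b \<alpha> \<beta> i =
    (if i \<in> {1..a} then \<alpha> i + b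
     else if i \<in> {a + 1..a + b} then \<beta> (i - a)
     else i)"


section \<open>Distance, diameter and contraction\<close>

text \<open>
  An undirected simple graph is represented by its symmetric, irreflexive arc relation.
  Every arc has length 1, and the distance is infinite between vertices that no walk joins. On a
  finite nonempty graph the supremum in \<open>diam\<close> is a maximum.
\<close>

definition graph_dist :: "'a pair_pre_digraph \<Rightarrow> 'a \<Rightarrow> 'a \<Rightarrow> ereal" where
  "graph_dist G u v = wf_digraph.\<mu> (with_proj G) (\<lambda>_. 1) u v"

definition diam :: "'a pair_pre_digraph \<Rightarrow> ereal" where
  "diam G = (SUP (u, v) \<in> pverts G \<times> pverts G. graph_dist G u v)"

text \<open>
  Contraction of a symmetric set \<open>K\<close> of edges of \<open>G\<close>: the vertices are the connected components
  of \<open>(pverts G, K)\<close>, and loops and multiple edges are discarded.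
\<close>

definition contract :: "'a pair_pre_digraph \<Rightarrow> 'a rel \<Rightarrow> 'a set pair_pre_digraph" where
  "contract G K =
    (let V = pverts G // rtrancl_on (pverts G) K in
     \<lparr> pverts = V,
       parcs = {(X, Y). X \<in> V \<and> Y \<in> V \<and> X \<noteq> Y \<and> (\<exists>u \<in> X. \<exists>v \<in> Y. (u, v) \<in> parcs G)} \<rparr>)"


section \<open>The graphs of a permutation\<close>

definition comm_move :: "nat list rel" where
  "comm_move = {(x @ [j, k] @ y, x @ [k, j] @ y) | x y j k. \<bar>int j - int k\<bar> > 1}"

definition braid_move :: "nat list rel" where
  "braid_move =
    {(x @ [j, j + 1, j] @ y, x @ [j + 1, j, j + 1] @ y) | x y j. True} \<union>
    {(x @ [j + 1, j, j + 1] @ y, x @ [j, j + 1, j] @ y) | x y j. True}"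

definition comm_edges :: "nat \<Rightarrow> (nat \<Rightarrow> nat) \<Rightarrow> nat list rel" where
  "comm_edges n p = comm_move \<inter> (reduced_words n p \<times> reduced_words n p)"

definition braid_edges :: "nat \<Rightarrow> (nat \<Rightarrow> nat) \<Rightarrow> nat list rel" where
  "braid_edges n p = braid_move \<inter> (reduced_words n p \<times> reduced_words n p)"

definition G_graph :: "nat \<Rightarrow> (nat \<Rightarrow> nat) \<Rightarrow> nat list pair_pre_digraph" where
  "G_graph n p = \<lparr> pverts = reduced_words n p, parcs = comm_edges n p \<union> braid_edges n p \<rparr>"

definition C_graph :: "nat \<Rightarrow> (nat \<Rightarrow> nat) \<Rightarrow> nat list set pair_pre_digraph" where
  "C_graph n p = contract (G_graph n p) (comm_edges n p)"

definition B_graph :: "nat \<Rightarrow> (nat \<Rightarrow> nat) \<Rightarrow> nat list set pair_pre_digraph" where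
  "B_graph n p = contract (G_graph n p) (braid_edges n p)"

text \<open>
  The library's distance is only characterised for well-formed digraphs, so we record
  well-formedness here.
\<close>

lemma sym_comm_move: "sym comm_move"
proof (rule symI)
  fix v w assume "(v, w) \<in> comm_move"
  then obtain x y j k where vw: "v = x @ [j, k] @ y" "w = x @ [k, j] @ y"
    and jk: "\<bar>int j - int k\<bar> > 1"
    unfolding comm_move_def by blast
  have "\<bar>int k - int j\<bar> > 1" using jk by linarith
  with vw show "(w, v) \<in> comm_move" unfolding comm_move_def by blast
qed

lemma sym_braid_move: "sym braid_move"
proof (rule symI)
  fix v w assume "(v, w) \<in> braid_move"
  then consider
      (1) x y j where "v = x @ [j, j + 1, j] @ y" "w = x @ [j + 1, j, j + 1] @ y"
    | (2) x y j where "v = x @ [j + 1, j, j + 1] @ y" "w = x @ [j, j + 1, j] @ y"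
    unfolding braid_move_def by blast
  then show "(w, v) \<in> braid_move"
    unfolding braid_move_def by cases blast+
qed

lemma sym_G_arcs: "sym (parcs (G_graph n p))"
proof (rule symI)
  fix v w assume "(v, w) \<in> parcs (G_graph n p)"
  then show "(w, v) \<in> parcs (G_graph n p)"
    using symD[OF sym_comm_move, of v w] symD[OF sym_braid_move, of v w]
    unfolding G_graph_def comm_edges_def braid_edges_def by simp blast
qed

lemma irrefl_comm_move: "(w, w) \<notin> comm_move"
  unfolding comm_move_def by auto

lemma irrefl_braid_move: "(w, w) \<notin> braid_move"
  unfolding braid_move_def by auto

lemma pair_bidirected_G_graph: "pair_bidirected_digraph (G_graph n p)"
proof unfold_locales
  fix e assume e: "e \<in> parcs (G_graph n p)"
  show "fst e \<in> pverts (G_graph n p)" "snd e \<in> pverts (G_graph n p)"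
    using e by (auto simp: G_graph_def comm_edges_def braid_edges_def)
  have "(fst e, snd e) \<in> comm_move \<union> braid_move"
    using e by (auto simp: G_graph_def comm_edges_def braid_edges_def)
  then show "fst e \<noteq> snd e"
    using irrefl_comm_move irrefl_braid_move by (metis UnE)
next
  show "symmetric (with_proj (G_graph n p))"
    using sym_G_arcs by (simp add: symmetric_def)
qed

lemma pair_bidirected_contract:
  assumes "sym (parcs G)"
  shows "pair_bidirected_digraph (contract G K)"
proof unfold_locales
  fix e assume e: "e \<in> parcs (contract G K)"
  show "fst e \<in> pverts (contract G K)" "snd e \<in> pverts (contract G K)" "fst e \<noteq> snd e"
    using e by (auto simp: contract_def Let_def)
next
  have "sym (parcs (contract G K))"
  proof (rule symI)
    fix X Y assume "(X, Y) \<in> parcs (contract G K)"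
    then show "(Y, X) \<in> parcs (contract G K)"
      using symD[OF assms] unfolding contract_def Let_def by simp blast
  qed
  then show "symmetric (with_proj (contract G K))"
    by (simp add: symmetric_def)
qed

lemma pair_bidirected_C_graph: "pair_bidirected_digraph (C_graph n p)"
  unfolding C_graph_def by (intro pair_bidirected_contract sym_G_arcs)

lemma pair_bidirected_B_graph: "pair_bidirected_digraph (B_graph n p)"
  unfolding B_graph_def by (intro pair_bidirected_contract sym_G_arcs)

end

(*
  Record a reduced word by the sequence of pairs of values that its letters exchange. A commutation
  move swaps two adjacent disjoint pairs; a long braid move reverses (x,y)(x,z)(y,z). Call a pair
  high if both of its values exceed b. Keeping only the high pairs projects the reduced words of pi
  onto those of alpha, and a move that the projection does not see changes the relative order of only
  one couple consisting of a pair (m,x), m <= b, and a high pair, or of two pairs (m,x), (m',y) with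
  m < m' <= b and x, y distinct. Counting these couples between a word whose high pairs all come
  first and a word whose high pairs all come last gives the lower bounds. Conversely, every word can
  be straightened, without a wasted move, both to a word with its high pairs first and to one with
  its high pairs last. A couple of the first kind is reversed in exactly one of the two
  straightenings, and for given x, y, m, m' at most one couple of the second kind has to be reversed
  in each of them. So of the two routes between two words, through either kind of normal form, the
  cheaper one is within the upper bound.
*)
theory Submission
  imports Defs
begin

text \<open>The three diameters are one computation: a walk is charged i per commutation and j per
  braid move, and (i, j) = (1, 1), (0, 1), (1, 0) give G, C and B. So walks are bounded for each
  kind of move separately. Write l for the length of \<alpha>, D = l b (a - 2) for the number of
  disjoint couples of a pair (m,x) and a high pair, and E for the product of the two binomials. The
  lower bound collects D + E commutations and l b braids, the upper one D + 2E and l b; E is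
  weighted by i only, hence the equality in (ii). The 2E arises because both normal forms list the
  pairs (m,x) by decreasing m: couples of the second kind may need reversal at both ends of either
  route, whereas the first kind costs 2D for the two routes together. The obstacle to straightening
  is a high pair (x,y) sharing a value with its neighbour (m,k): it passes only by a braid move, for
  which (m,x) and (m,y) must be adjacent. This is why a block of consecutive non-high pairs is
  sorted by m before a high pair is moved past it.\<close>

section \<open>Weighted walks\<close>

inductive gwalk :: "'a rel \<Rightarrow> 'a rel \<Rightarrow> nat \<Rightarrow> nat \<Rightarrow> 'a \<Rightarrow> 'a \<Rightarrow> bool" for K J where
  gwalk_refl: "gwalk K J 0 0 u u"
| gwalk_left: "(u, v) \<in> K \<Longrightarrow> gwalk K J c t v w \<Longrightarrow> gwalk K J (Suc c) t u w"
| gwalk_right: "(u, v) \<in> J \<Longrightarrow> gwalk K J c t v w \<Longrightarrow> gwalk K J c (Suc t) u w"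

lemma gwalk_trans:
  "gwalk K J c t u v \<Longrightarrow> gwalk K J c' t' v w \<Longrightarrow> gwalk K J (c + c') (t + t') u w"
  by (induction rule: gwalk.induct) (auto intro: gwalk.intros)

lemma gwalk_sym:
  assumes "gwalk K J c t u v" "sym K" "sym J"
  shows "gwalk K J c t v u"
  using assms(1)
proof induction
  case (gwalk_refl u)
  show ?case by (rule gwalk.gwalk_refl)
next
  case (gwalk_left u v c t w)
  have "gwalk K J (Suc 0) 0 v u"
    using gwalk_left.hyps(1) assms(2) by (meson gwalk.intros symD)
  from gwalk_trans[OF gwalk_left.IH this] show ?case by simp
next
  case (gwalk_right u v c t w)
  have "gwalk K J 0 (Suc 0) v u"
    using gwalk_right.hyps(1) assms(3) by (meson gwalk.intros symD)
  from gwalk_trans[OF gwalk_right.IH this] show ?case by simp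
qed

lemma gwalk_swap: "gwalk K J c t u v \<longleftrightarrow> gwalk J K t c u v"
proof -
  have "gwalk J K t c u v" if "gwalk K J c t u v" for K J :: "'a rel" and c t u v
    using that by induction (auto intro: gwalk.intros)
  then show ?thesis by blast
qed

lemma gwalk_relpow: "gwalk K J c t u v \<Longrightarrow> (u, v) \<in> (K \<union> J) ^^ (c + t)"
  by (induction rule: gwalk.induct) (auto simp del: relpow.simps(2) intro: relpow_Suc_I2)

lemma relpow_gwalk: "(u, v) \<in> (K \<union> J) ^^ k \<Longrightarrow> \<exists>c t. c + t = k \<and> gwalk K J c t u v"
proof (induction k arbitrary: u)
  case 0
  then show ?case by (auto intro: gwalk.intros)
next
  case (Suc k)
  then obtain z where z: "(u, z) \<in> K \<union> J" "(z, v) \<in> (K \<union> J) ^^ k"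
    by (meson relpow_Suc_E2)
  from Suc.IH[OF z(2)] obtain c t where ct: "c + t = k" "gwalk K J c t z v" by blast
  have "gwalk K J (Suc c) t u v \<or> gwalk K J c (Suc t) u v"
    using z(1) ct(2) by (auto intro: gwalk.intros)
  then show ?case using ct(1) by (metis add_Suc add_Suc_right)
qed

text \<open>Weight 0 models contraction. Without a walk the infimum runs over the empty set and is
  infinite.\<close>

definition walk_dist :: "nat \<Rightarrow> nat \<Rightarrow> 'a rel \<Rightarrow> 'a rel \<Rightarrow> 'a \<Rightarrow> 'a \<Rightarrow> ereal" where
  "walk_dist i j K J u v =
    (INF (c, t) \<in> {(c, t). gwalk K J c t u v}. ereal (real (i * c + j * t)))"

lemma walk_dist_le: "gwalk K J c t u v \<Longrightarrow> walk_dist i j K J u v \<le> ereal (real (i * c + j * t))"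
  unfolding walk_dist_def by (rule INF_lower2[of "(c, t)"]) auto

lemma le_walk_dist:
  assumes "\<And>c t. gwalk K J c t u v \<Longrightarrow> x \<le> ereal (real (i * c + j * t))"
  shows "x \<le> walk_dist i j K J u v"
  unfolding walk_dist_def by (rule INF_greatest) (auto dest: assms)

lemma walk_dist_swap: "walk_dist i j K J = walk_dist j i J K"
  by (intro ext antisym le_walk_dist)
    (metis walk_dist_le gwalk_swap add.commute)+

text \<open>The weights of walks are natural numbers, so a finite infimum is a minimum. This turns a
  finite distance into an actual walk that can be lifted.\<close>

lemma walk_dist_attained:
  assumes "walk_dist i j K J u v \<noteq> \<infinity>"
  obtains c t where "gwalk K J c t u v" "walk_dist i j K J u v = ereal (real (i * c + j * t))"
proof -
  let ?S = "{n. \<exists>c t. gwalk K J c t u v \<and> n = i * c + j * t}"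
  have "?S \<noteq> {}"
  proof
    assume "?S = {}"
    then have "\<not> gwalk K J c t u v" for c t by blast
    then show False using assms by (simp add: walk_dist_def top_ereal_def)
  qed
  then have L: "(LEAST n. n \<in> ?S) \<in> ?S"
    by (metis (mono_tags, lifting) LeastI_ex equals0I)
  then obtain c t where ct: "gwalk K J c t u v" "(LEAST n. n \<in> ?S) = i * c + j * t" by blast
  have "ereal (real (i * c + j * t)) \<le> walk_dist i j K J u v"
  proof (rule le_walk_dist)
    fix c' t' assume "gwalk K J c' t' u v"
    then have "(LEAST n. n \<in> ?S) \<le> i * c' + j * t'" by (intro Least_le) blast
    then show "ereal (real (i * c + j * t)) \<le> ereal (real (i * c' + j * t'))"
      unfolding ct(2) by (simp only: ereal_less_eq of_nat_le_iff)
  qed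
  with walk_dist_le[OF ct(1), of i j] ct(1) show ?thesis by (intro that) auto
qed

section \<open>Graph distances as weighted walk distances\<close>

lemma graph_dist_eq_INF:
  assumes "pair_wf_digraph G" "u \<in> pverts G"
  shows "graph_dist G u v = (INF k \<in> {k. (u, v) \<in> parcs G ^^ k}. ereal (real k))"
proof -
  interpret pair_wf_digraph G by fact
  have cost: "awalk_cost (\<lambda>_. 1) p = real (length p)" for p :: "('a \<times> 'a) list"
    by (induction p) auto
  \<comment> \<open>With unit costs only the length of an arc walk matters, and the lengths that
    occur are the exponents \<open>k\<close> for which \<open>(u, v)\<close> lies in the
    \<open>k\<close>-th power of the arc relation.\<close>
  have 1: "(u, v) \<in> parcs G ^^ length p" if "awalk u p v" for p u v
    using that
  proof (induction p arbitrary: u)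
    case Nil
    then show ?case by (simp add: awalk_Nil_iff)
  next
    case (Cons e p)
    then show ?case by (auto simp: awalk_Cons_iff simp del: relpow.simps(2) intro!: relpow_Suc_I2)
  qed
  have 2: "\<exists>p. awalk u p v \<and> length p = k" if "(u, v) \<in> parcs G ^^ k" "u \<in> pverts G" for k u v
    using that
  proof (induction k arbitrary: u)
    case 0
    then show ?case by (auto simp: awalk_Nil_iff)
  next
    case (Suc k)
    then obtain z where z: "(u, z) \<in> parcs G" "(z, v) \<in> parcs G ^^ k"
      by (meson relpow_Suc_E2)
    with Suc.IH obtain p where "awalk z p v" "length p = k"
      using in_arcsD2 by blast
    with z(1) show ?case by (intro exI[of _ "(u, z) # p"]) (auto simp: awalk_Cons_iff)
  qed
  show ?thesis
    unfolding graph_dist_def \<mu>_def cost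
  proof (rule antisym)
    show "(INF p\<in>{p. awalk u p v}. ereal (real (length p)))
      \<le> (INF k\<in>{k. (u, v) \<in> parcs G ^^ k}. ereal (real k))"
      using 2[OF _ assms(2)] by (intro INF_mono) fastforce
    show "(INF k\<in>{k. (u, v) \<in> parcs G ^^ k}. ereal (real k))
      \<le> (INF p\<in>{p. awalk u p v}. ereal (real (length p)))"
      using 1 by (intro INF_mono) fastforce
  qed
qed

lemma graph_dist_union:
  assumes "pair_wf_digraph G" "parcs G = K \<union> J" "u \<in> pverts G"
  shows "graph_dist G u v = walk_dist 1 1 K J u v"
proof (rule antisym)
  show "graph_dist G u v \<le> walk_dist 1 1 K J u v"
  proof (rule le_walk_dist)
    fix c t assume "gwalk K J c t u v"
    then have "(u, v) \<in> parcs G ^^ (c + t)" using gwalk_relpow assms(2) by metis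
    then show "graph_dist G u v \<le> ereal (real (1 * c + 1 * t))"
      unfolding graph_dist_eq_INF[OF assms(1,3)] by (intro INF_lower2[of "c + t"]) auto
  qed
  show "walk_dist 1 1 K J u v \<le> graph_dist G u v"
    unfolding graph_dist_eq_INF[OF assms(1,3)]
  proof (rule INF_greatest)
    fix k assume "k \<in> {k. (u, v) \<in> parcs G ^^ k}"
    then obtain c t where "c + t = k" "gwalk K J c t u v"
      using relpow_gwalk assms(2) by (metis mem_Collect_eq)
    then show "walk_dist 1 1 K J u v \<le> ereal (real k)"
      using walk_dist_le[of K J c t u v 1 1] by simp
  qed
qed

lemma rtrancl_on_gwalk: "(u, v) \<in> rtrancl_on F K \<Longrightarrow> \<exists>c. gwalk K J c 0 u v"
  by (induction rule: converse_rtrancl_on_induct) (auto intro: gwalk.intros)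

text \<open>Contraction makes \<open>K\<close>-steps free. A walk in \<open>G\<close> maps to its
  classes, where \<open>K\<close>-steps and the \<open>J\<close>-steps inside a class disappear.
  Conversely each arc between classes comes from an edge, and \<open>K\<close>-steps inside the
  classes join consecutive edges.\<close>

lemma graph_dist_contract:
  assumes wf: "pair_wf_digraph (contract G K)" and arcs: "parcs G = K \<union> J"
    and sub: "K \<union> J \<subseteq> pverts G \<times> pverts G" and "sym K"
    and u: "u \<in> pverts G" and v: "v \<in> pverts G"
  shows "graph_dist (contract G K)
      (rtrancl_on (pverts G) K `` {u}) (rtrancl_on (pverts G) K `` {v})
    = walk_dist 0 1 K J u v"
proof -
  let ?r = "rtrancl_on (pverts G) K" and ?A = "parcs (contract G K)"
  have symr: "sym ?r" by (rule rtrancl_on_sym) fact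
  have cl_eq: "?r `` {x} = ?r `` {y}" if "(x, y) \<in> ?r" for x y
    using that symr by (auto intro: rtrancl_on_trans dest: symD)
  have V: "pverts (contract G K) = pverts G // ?r"
    by (simp add: contract_def Let_def)
  have A: "(X, Y) \<in> ?A \<longleftrightarrow> X \<in> pverts G // ?r \<and> Y \<in> pverts G // ?r \<and> X \<noteq> Y
      \<and> (\<exists>u \<in> X. \<exists>v \<in> Y. (u, v) \<in> K \<union> J)" for X Y
    by (simp add: contract_def Let_def arcs)
  have le: "\<exists>k\<le>t. (?r `` {x}, ?r `` {y}) \<in> ?A ^^ k" if "gwalk K J c t x y" for c t x y
    using that
  proof induction
    case (gwalk_refl u)
    show ?case by auto
  next
    case (gwalk_left u v c t w)
    then have "(u, v) \<in> ?r"
      using sub by (intro rtrancl_on_into_rtrancl_on[OF rtrancl_on_refl]) auto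
    from cl_eq[OF this] gwalk_left.IH show ?case by simp
  next
    case (gwalk_right u v c t w)
    then obtain k where k: "k \<le> t" "(?r `` {v}, ?r `` {w}) \<in> ?A ^^ k" by blast
    show ?case
    proof (cases "?r `` {u} = ?r `` {v}")
      case True
      then show ?thesis using k by (auto intro: le_SucI)
    next
      case False
      have "u \<in> pverts G" "v \<in> pverts G" using gwalk_right.hyps(1) sub by auto
      then have "(?r `` {u}, ?r `` {v}) \<in> ?A"
        using False gwalk_right.hyps(1) unfolding A by (auto intro!: quotientI)
      from relpow_Suc_I2[OF this k(2)] k(1) show ?thesis by blast
    qed
  qed
  have ge: "\<exists>c. gwalk K J c k x y"
    if "(X, Y) \<in> ?A ^^ k" "X \<in> pverts G // ?r" "x \<in> X" "y \<in> Y" for X Y k x y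
    using that
  proof (induction k arbitrary: X x)
    case 0
    then obtain z where "(z, x) \<in> ?r" "(z, y) \<in> ?r" by (auto elim!: quotientE)
    then have "(x, y) \<in> ?r" using symr by (meson rtrancl_on_trans symD)
    then show ?case by (rule rtrancl_on_gwalk)
  next
    case (Suc k)
    then obtain Z where Z: "(X, Z) \<in> ?A" "(Z, Y) \<in> ?A ^^ k" by (meson relpow_Suc_E2)
    then obtain x' z where xz: "x' \<in> X" "z \<in> Z" "(x', z) \<in> K \<union> J" unfolding A by blast
    have ZV: "Z \<in> pverts G // ?r" "X \<noteq> Z" using Z(1) unfolding A by auto
    obtain p where p: "X = ?r `` {p}" using Suc.prems(2) by (auto elim!: quotientE)
    obtain q where q: "Z = ?r `` {q}" using ZV(1) by (auto elim!: quotientE)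
    have "X = ?r `` {x'}" "Z = ?r `` {z}"
      using cl_eq xz p q by (metis Image_singleton_iff)+
    \<comment> \<open>An edge of \<open>K\<close> has both ends in one class, so an arc between
      different classes can only come from \<open>J\<close>: the lifted walk has exactly one
      \<open>J\<close>-step per arc.\<close>
    then have "(x', z) \<notin> ?r" using cl_eq ZV(2) by metis
    then have "(x', z) \<notin> K"
      using sub rtrancl_on_into_rtrancl_on[OF rtrancl_on_refl, of x' "pverts G" z K] by auto
    then have J: "(x', z) \<in> J" using xz(3) by blast
    have "(x, x') \<in> ?r" using p xz(1) Suc.prems(3) symr
      by (metis Image_singleton_iff rtrancl_on_trans symD)
    then obtain c1 where c1: "gwalk K J c1 0 x x'" using rtrancl_on_gwalk by metis
    obtain c2 where "gwalk K J c2 k z y" using Suc.IH[OF Z(2) ZV(1) xz(2) Suc.prems(4)] by blast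
    from gwalk_trans[OF c1 gwalk_right[OF J this]] show ?case by auto
  qed
  have uV: "?r `` {u} \<in> pverts G // ?r" using u by (rule quotientI)
  have refl: "u \<in> ?r `` {u}" "v \<in> ?r `` {v}" using u v by auto
  have dist: "graph_dist (contract G K) (?r `` {u}) (?r `` {v}) =
      (INF k\<in>{k. (?r `` {u}, ?r `` {v}) \<in> ?A ^^ k}. ereal (real k))"
    by (rule graph_dist_eq_INF[OF wf]) (simp add: V uV)
  show ?thesis
  proof (rule antisym)
    show "graph_dist (contract G K) (?r `` {u}) (?r `` {v}) \<le> walk_dist 0 1 K J u v"
    proof (rule le_walk_dist)
      fix c t assume "gwalk K J c t u v"
      then obtain k where "k \<le> t" "(?r `` {u}, ?r `` {v}) \<in> ?A ^^ k" using le by blast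
      then show "graph_dist (contract G K) (?r `` {u}) (?r `` {v})
          \<le> ereal (real (0 * c + 1 * t))"
        unfolding dist by (intro INF_lower2[of k]) auto
    qed
    show "walk_dist 0 1 K J u v \<le> graph_dist (contract G K) (?r `` {u}) (?r `` {v})"
      unfolding dist
    proof (rule INF_greatest)
      fix k assume "k \<in> {k. (?r `` {u}, ?r `` {v}) \<in> ?A ^^ k}"
      then obtain c where "gwalk K J c k u v" using ge[OF _ uV refl] by auto
      from walk_dist_le[OF this, of 0 1] show "walk_dist 0 1 K J u v \<le> ereal (real k)" by simp
    qed
  qed
qed

section \<open>One weighted diameter for the three graphs\<close>

definition move_diam :: "nat \<Rightarrow> nat \<Rightarrow> nat \<Rightarrow> (nat \<Rightarrow> nat) \<Rightarrow> ereal" where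
  "move_diam i j n p = (SUP (u, v) \<in> reduced_words n p \<times> reduced_words n p.
     walk_dist i j (comm_edges n p) (braid_edges n p) u v)"

lemma sym_comm_edges: "sym (comm_edges n p)"
  using sym_comm_move unfolding comm_edges_def sym_def by blast

lemma sym_braid_edges: "sym (braid_edges n p)"
  using sym_braid_move unfolding braid_edges_def sym_def by blast

lemma diam_G_graph: "diam (G_graph n p) = move_diam 1 1 n p"
proof -
  interpret pair_bidirected_digraph "G_graph n p" by (rule pair_bidirected_G_graph)
  have wf: "pair_wf_digraph (G_graph n p)" by unfold_locales
  have "graph_dist (G_graph n p) u v = walk_dist 1 1 (comm_edges n p) (braid_edges n p) u v"
    if "u \<in> pverts (G_graph n p)" for u v
    using that by (intro graph_dist_union[OF wf]) (auto simp: G_graph_def)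
  then show ?thesis
    unfolding diam_def move_diam_def
    by (intro SUP_cong) (auto simp: G_graph_def)
qed

lemma diam_contract:
  assumes "pair_wf_digraph (contract G K)" "parcs G = K \<union> J"
    "K \<union> J \<subseteq> pverts G \<times> pverts G" "sym K"
  shows "diam (contract G K) = (SUP (u, v) \<in> pverts G \<times> pverts G. walk_dist 0 1 K J u v)"
proof -
  let ?r = "rtrancl_on (pverts G) K"
  \<comment> \<open>Every pair of classes is hit by a pair of vertices, so the supremum over classes
    becomes one over representatives.\<close>
  have "pverts (contract G K) \<times> pverts (contract G K) =
      (\<lambda>(u, v). (?r `` {u}, ?r `` {v})) ` (pverts G \<times> pverts G)"
    by (auto simp: contract_def Let_def quotient_def image_iff)
  then show ?thesis
    unfolding diam_def
    by (auto simp: image_image case_prod_unfold graph_dist_contract[OF assms] intro!: SUP_cong)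
qed

lemma diam_C_graph: "diam (C_graph n p) = move_diam 0 1 n p"
proof -
  interpret pair_bidirected_digraph "C_graph n p" by (rule pair_bidirected_C_graph)
  have "pair_wf_digraph (C_graph n p)" by unfold_locales
  then have "diam (C_graph n p) = (SUP (u, v) \<in> pverts (G_graph n p) \<times> pverts (G_graph n p).
      walk_dist 0 1 (comm_edges n p) (braid_edges n p) u v)"
    unfolding C_graph_def
    by (rule diam_contract)
      (auto simp: G_graph_def comm_edges_def braid_edges_def sym_comm_edges[unfolded comm_edges_def])
  then show ?thesis by (simp add: move_diam_def G_graph_def)
qed

lemma diam_B_graph: "diam (B_graph n p) = move_diam 1 0 n p"
proof -
  interpret pair_bidirected_digraph "B_graph n p" by (rule pair_bidirected_B_graph)
  have "pair_wf_digraph (B_graph n p)" by unfold_locales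
  then have "diam (B_graph n p) = (SUP (u, v) \<in> pverts (G_graph n p) \<times> pverts (G_graph n p).
      walk_dist 0 1 (braid_edges n p) (comm_edges n p) u v)"
    unfolding B_graph_def
    by (rule diam_contract)
      (auto simp: G_graph_def comm_edges_def braid_edges_def sym_braid_edges[unfolded braid_edges_def])
  then show ?thesis
    by (simp add: move_diam_def G_graph_def walk_dist_swap[of 0 1 "braid_edges n p"] del: One_nat_def)
qed

section \<open>Order of entries in a list\<close>

text \<open>For a distinct list this is the strict linear order of its entries; a number of
  disordered couples then becomes the cardinality of an intersection with a fixed relation.\<close>

primrec before :: "'a list \<Rightarrow> ('a \<times> 'a) set" where
  "before [] = {}"
| "before (x # xs) = {x} \<times> set xs \<union> before xs"

lemma before_append [simp]:
  "before (xs @ ys) = before xs \<union> before ys \<union> set xs \<times> set ys"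
  by (induction xs) auto

lemma before_subset: "before xs \<subseteq> set xs \<times> set xs"
  by (induction xs) auto

lemma finite_before [simp]: "finite (before xs)"
  by (rule finite_subset[OF before_subset]) simp

lemma before_in_set: "(x, y) \<in> before xs \<Longrightarrow> x \<in> set xs \<and> y \<in> set xs"
  using before_subset by blast

lemma before_total:
  "x \<in> set xs \<Longrightarrow> y \<in> set xs \<Longrightarrow> x \<noteq> y \<Longrightarrow> (x, y) \<in> before xs \<or> (y, x) \<in> before xs"
  by (induction xs) auto

lemma before_irrefl: "distinct xs \<Longrightarrow> (x, x) \<notin> before xs"
  by (induction xs) (auto dest: before_in_set)

lemma before_asym: "distinct xs \<Longrightarrow> (x, y) \<in> before xs \<Longrightarrow> (y, x) \<notin> before xs"
  by (induction xs) (auto dest: before_in_set)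

lemma before_trans:
  "distinct xs \<Longrightarrow> (x, y) \<in> before xs \<Longrightarrow> (y, z) \<in> before xs \<Longrightarrow> (x, z) \<in> before xs"
  by (induction xs) (auto dest: before_in_set)

lemma before_map: "before (map f xs) = map_prod f f ` before xs"
  by (induction xs) (auto simp: image_iff)

lemma before_swap:
  assumes "distinct (A @ x # y # B)"
  shows "before (A @ y # x # B) = insert (y, x) (before (A @ x # y # B) - {(x, y)})"
  using assms by (auto dest: before_in_set)

lemma before_rev3:
  assumes "distinct (A @ x # y # z # B)"
  shows "before (A @ z # y # x # B) =
    {(z, y), (z, x), (y, x)} \<union> (before (A @ x # y # z # B) - {(x, y), (x, z), (y, z)})"
proof -
  have ne: "x \<noteq> y" "x \<noteq> z" "y \<noteq> z" using assms by auto
  \<comment> \<open>The reversal is made of three adjacent swaps: xyz, yxz, yzx, zyx.\<close>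
  have e1: "before (A @ y # x # z # B) = insert (y, x) (before (A @ x # y # z # B) - {(x, y)})"
    using assms by (rule before_swap)
  have "distinct ((A @ [y]) @ x # z # B)" using assms by auto
  from before_swap[OF this]
  have e2: "before (A @ y # z # x # B) = insert (z, x) (before (A @ y # x # z # B) - {(x, z)})"
    by (simp only: append_assoc append_Cons append_Nil)
  have "distinct (A @ y # z # x # B)" using assms by auto
  from before_swap[OF this]
  have e3: "before (A @ z # y # x # B) = insert (z, y) (before (A @ y # z # x # B) - {(y, z)})" .
  define S where "S = before (A @ x # y # z # B)"
  show ?thesis unfolding e3 e2 e1 S_def[symmetric] using ne by auto
qed

text \<open>Of two strict linear orders on one set, neither can properly contain the other, and a
  distinct list is determined by its order. Normal forms are recognised through this.\<close>

lemma distinct_eq_before: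
  assumes "distinct xs" "distinct ys" "set xs = set ys" "before xs \<subseteq> before ys"
  shows "xs = ys"
  using assms
proof (induction xs arbitrary: ys)
  case Nil
  then show ?case by simp
next
  case (Cons x xs)
  have "set ys \<noteq> {}" unfolding Cons.prems(3)[symmetric] by simp
  then obtain z zs where ys: "ys = z # zs" by (cases ys) simp_all
  have set_eq: "insert x (set xs) = insert z (set zs)" using Cons.prems(3) ys by simp
  have sub: "{x} \<times> set xs \<union> before xs \<subseteq> {z} \<times> set zs \<union> before zs"
    using Cons.prems(4) ys by simp
  have nin: "x \<notin> set xs" "z \<notin> set zs" using Cons.prems(1,2) ys by simp_all
  \<comment> \<open>Otherwise \<open>z\<close> would stand behind \<open>x\<close> in the first
    list, while nothing stands before the head \<open>z\<close> of the second.\<close>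
  have "z = x"
  proof (rule ccontr)
    assume "z \<noteq> x"
    moreover have "z \<in> insert x (set xs)" unfolding set_eq by (rule insertI1)
    ultimately have "z \<in> set xs" by simp
    then have "(x, z) \<in> {x} \<times> set xs \<union> before xs" by simp
    then have "(x, z) \<in> {z} \<times> set zs \<union> before zs" using sub by (rule rev_subsetD)
    then show False using \<open>z \<noteq> x\<close> nin(2) before_in_set[of x z zs] by blast
  qed
  moreover have "xs = zs"
  proof (rule Cons.IH)
    show "distinct xs" "distinct zs" using Cons.prems(1,2) ys by simp_all
    show "set xs = set zs"
      using set_eq nin unfolding \<open>z = x\<close> by (metis insert_ident)
    show "before xs \<subseteq> before zs"
    proof (rule subrelI)
      fix p q assume pq: "(p, q) \<in> before xs"
      then have "p \<noteq> z" using before_in_set[OF pq] nin(1) \<open>z = x\<close> by blast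
      moreover have "(p, q) \<in> {z} \<times> set zs \<union> before zs"
        by (rule subsetD[OF sub]) (rule UnI2[OF pq])
      ultimately show "(p, q) \<in> before zs" by simp
    qed
  qed
  ultimately show ?case using ys by simp
qed

section \<open>Words as sequences of strand crossings\<close>

text \<open>
  \<open>run xs w L zs\<close>: reading the word \<open>w\<close> turns the one-line notation \<open>xs\<close> into \<open>zs\<close>, and \<open>L\<close> lists the
  pairs of values that are exchanged. The condition \<open>x < y\<close> at every step is what makes \<open>w\<close> reduced.
\<close>

inductive run :: "nat list \<Rightarrow> nat list \<Rightarrow> (nat \<times> nat) list \<Rightarrow> nat list \<Rightarrow> bool" where
  run_Nil: "run xs [] [] xs"
| run_Cons: "x < y \<Longrightarrow> run (A @ y # x # B) w L zs \<Longrightarrow>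
    run (A @ x # y # B) (Suc (length A) # w) ((x, y) # L) zs"

lemma run_Nil_iff [simp]: "run xs w [] zs \<longleftrightarrow> w = [] \<and> xs = zs"
  by (auto elim: run.cases intro: run.intros)

lemma run_Nil_word_iff [simp]: "run xs [] L zs \<longleftrightarrow> L = [] \<and> xs = zs"
  by (auto elim: run.cases intro: run.intros)

lemma run_Cons_iff:
  "run xs w (p # L) zs \<longleftrightarrow> (\<exists>A x y B w'. p = (x, y) \<and> x < y \<and> xs = A @ x # y # B \<and>
     w = Suc (length A) # w' \<and> run (A @ y # x # B) w' L zs)"
  by (subst run.simps) (simp, blast)

lemma run_ConsE:
  assumes "run xs w ((x, y) # L) zs"
  obtains A B w' where "x < y" "xs = A @ x # y # B" "w = Suc (length A) # w'"
    "run (A @ y # x # B) w' L zs"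
  using assms unfolding run_Cons_iff by blast

lemma run_Cons_word_iff:
  "run xs (j # w) L zs \<longleftrightarrow> (\<exists>A x y B L'. L = (x, y) # L' \<and> x < y \<and> xs = A @ x # y # B \<and>
     j = Suc (length A) \<and> run (A @ y # x # B) w L' zs)"
  by (subst run.simps) (simp, blast)

lemma run_Cons_wordE:
  assumes "run xs (j # w) L zs"
  obtains A x y B L' where "L = (x, y) # L'" "x < y" "xs = A @ x # y # B" "j = Suc (length A)"
    "run (A @ y # x # B) w L' zs"
  using assms unfolding run_Cons_word_iff by blast

lemma run_appendI: "run xs w1 L1 ys \<Longrightarrow> run ys w2 L2 zs \<Longrightarrow> run xs (w1 @ w2) (L1 @ L2) zs"
proof (induction rule: run.induct)
  case (run_Nil xs)
  then show ?case by simp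
next
  case (run_Cons x y A B w L ys)
  then show ?case by (simp add: run.run_Cons)
qed

lemma run_appendE:
  assumes "run xs w (L1 @ L2) zs"
  obtains w1 w2 ys where "w = w1 @ w2" "run xs w1 L1 ys" "run ys w2 L2 zs"
  using assms
proof (induction L1 arbitrary: xs w thesis)
  case Nil
  show ?case by (rule Nil.prems(1)[of "[]" w xs]) (use Nil.prems(2) in auto)
next
  case (Cons p L1)
  obtain x y where p: "p = (x, y)" by (cases p)
  have "run xs w ((x, y) # (L1 @ L2)) zs" using Cons.prems(2) p by simp
  then obtain A B w' where *: "x < y" "xs = A @ x # y # B" "w = Suc (length A) # w'"
    "run (A @ y # x # B) w' (L1 @ L2) zs"
    by (rule run_ConsE)
  from Cons.IH[OF _ *(4)] obtain w1 w2 ys where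
    w: "w' = w1 @ w2" "run (A @ y # x # B) w1 L1 ys" "run ys w2 L2 zs" .
  show ?case
  proof (rule Cons.prems(1))
    show "w = (Suc (length A) # w1) @ w2" using *(3) w(1) by simp
    show "run xs (Suc (length A) # w1) (p # L1) ys"
      unfolding p *(2) using *(1) w(2) by (rule run_Cons)
  qed (rule w(3))
qed

lemma run_append_wordE:
  assumes "run xs (w1 @ w2) L zs"
  obtains L1 L2 ys where "L = L1 @ L2" "run xs w1 L1 ys" "run ys w2 L2 zs"
  using assms
proof (induction w1 arbitrary: xs L thesis)
  case Nil
  show ?case by (rule Nil.prems(1)[of "[]" L xs]) (use Nil.prems(2) in auto)
next
  case (Cons j w1)
  have "run xs (j # (w1 @ w2)) L zs" using Cons.prems(2) by simp
  then obtain A x y B L' where *: "L = (x, y) # L'" "x < y" "xs = A @ x # y # B"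
    "j = Suc (length A)" "run (A @ y # x # B) (w1 @ w2) L' zs"
    by (rule run_Cons_wordE)
  from Cons.IH[OF _ *(5)] obtain L1 L2 ys where
    L: "L' = L1 @ L2" "run (A @ y # x # B) w1 L1 ys" "run ys w2 L2 zs" .
  show ?case
  proof (rule Cons.prems(1))
    show "L = ((x, y) # L1) @ L2" using *(1) L(1) by simp
    show "run xs (j # w1) ((x, y) # L1) ys"
      unfolding *(3,4) using *(2) L(2) by (rule run_Cons)
  qed (rule L(3))
qed

lemma run_length: "run xs w L zs \<Longrightarrow> length L = length w"
  by (induction rule: run.induct) auto

lemma run_mset: "run xs w L zs \<Longrightarrow> mset zs = mset xs"
  by (induction rule: run.induct) auto

lemma run_distinct: "run xs w L zs \<Longrightarrow> distinct zs = distinct xs"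
  by (metis run_mset mset_eq_imp_distinct_iff)

lemma run_ascending: "run xs w L zs \<Longrightarrow> p \<in> set L \<Longrightarrow> fst p < snd p"
  by (induction rule: run.induct) auto

text \<open>An exchange of x < y leaves y in front of x, and since all later labels are ascending,
  the two are never exchanged again. Hence the labels are exactly the pairs whose order differs
  between start and end.\<close>

lemma run_labels:
  assumes "run xs w L zs" "distinct xs"
  shows "distinct L \<and> set L \<subseteq> before xs \<and> before zs = (before xs - set L) \<union> (set L)\<inverse>"
  using assms
proof induction
  case (run_Nil xs)
  show ?case by simp
next
  case (run_Cons x y A B w L zs)
  have eq: "before (A @ y # x # B) = insert (y, x) (before (A @ x # y # B) - {(x, y)})"
    using run_Cons.prems by (rule before_swap)
  define S where "S = before (A @ x # y # B)"
  have "distinct (A @ y # x # B)" using run_Cons.prems by auto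
  from run_Cons.IH[OF this, unfolded eq, folded S_def]
  have IH: "distinct L" "set L \<subseteq> insert (y, x) (S - {(x, y)})"
    "before zs = (insert (y, x) (S - {(x, y)}) - set L) \<union> (set L)\<inverse>"
    by simp_all
  have yx: "(y, x) \<notin> set L"
  proof
    assume "(y, x) \<in> set L"
    from run_ascending[OF run_Cons.hyps(2) this] run_Cons.hyps(1) show False by simp
  qed
  have xy: "(x, y) \<notin> set L"
  proof
    assume "(x, y) \<in> set L"
    with IH(2) have "(x, y) \<in> insert (y, x) (S - {(x, y)})" by (rule subsetD)
    then show False using run_Cons.hyps(1) by simp
  qed
  have xyS: "(x, y) \<in> S" unfolding S_def by simp
  with run_Cons.prems have "(y, x) \<notin> S" unfolding S_def by (rule before_asym)
  note S = xyS this
  have "set ((x, y) # L) \<subseteq> S" using IH(2) yx S(1) by auto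
  moreover have "before zs = (S - set ((x, y) # L)) \<union> (set ((x, y) # L))\<inverse>"
    unfolding IH(3) using yx S by auto
  ultimately show ?case using IH(1) xy unfolding S_def by (simp del: before_append before.simps)
qed

text \<open>Deleting strands keeps neighbouring survivors adjacent, so their crossings stay legal
  and all other crossings become invisible. Positions shift, hence the existential word. Keeping the
  values above \<open>b\<close> gives the projection.\<close>

lemma run_filter:
  "run xs w L zs \<Longrightarrow>
    \<exists>w'. run (filter P xs) w' (filter (\<lambda>p. P (fst p) \<and> P (snd p)) L) (filter P zs)"
proof (induction rule: run.induct)
  case (run_Nil xs)
  show ?case by (auto intro: run.run_Nil)
next
  case (run_Cons x y A B w L zs)
  then obtain w' where w': "run (filter P (A @ y # x # B)) w'
      (filter (\<lambda>p. P (fst p) \<and> P (snd p)) L) (filter P zs)" by blast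
  show ?case
  proof (cases "P x \<and> P y")
    case True
    then have "run (filter P A @ y # x # filter P B) w'
      (filter (\<lambda>p. P (fst p) \<and> P (snd p)) L) (filter P zs)"
      using w' by simp
    from run.run_Cons[OF run_Cons.hyps(1) this] True
    show ?thesis by (intro exI[of _ "Suc (length (filter P A)) # w'"]) simp
  next
    case False
    then have 1: "filter P (A @ x # y # B) = filter P (A @ y # x # B)" by auto
    from False have 2: "filter (\<lambda>p. P (fst p) \<and> P (snd p)) ((x, y) # L) =
      filter (\<lambda>p. P (fst p) \<and> P (snd p)) L" by simp
    show ?thesis unfolding 1 2 using w' by (rule exI)
  qed
qed

text \<open>Letters are positions, so a relabelling of values that keeps their order keeps the
  word.\<close>

lemma run_map:
  assumes "run xs w L zs" "\<And>x y. x \<in> set xs \<Longrightarrow> y \<in> set xs \<Longrightarrow> x < y \<Longrightarrow> f x < f y"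
  shows "run (map f xs) w (map (map_prod f f) L) (map f zs)"
  using assms
proof induction
  case (run_Nil xs)
  show ?case by (auto intro: run.run_Nil)
next
  case (run_Cons x y A B w L zs)
  have "f x < f y" using run_Cons.hyps run_Cons.prems by simp
  have "run (map f (A @ y # x # B)) w (map (map_prod f f) L) (map f zs)"
    by (rule run_Cons.IH) (rule run_Cons.prems, auto)
  with run.run_Cons[OF \<open>f x < f y\<close>, of "map f A" "map f B" w "map (map_prod f f) L" "map f zs"]
  show ?case by simp
qed

lemma run_context: "run xs w L zs \<Longrightarrow> \<exists>w'. run (A @ xs @ B) w' L (A @ zs @ B)"
proof (induction rule: run.induct)
  case (run_Nil xs)
  show ?case by (auto intro: run.run_Nil)
next
  case (run_Cons x y A' B' w L zs)
  then obtain w' where "run ((A @ A') @ y # x # (B' @ B)) w' L (A @ zs @ B)" by auto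
  from run.run_Cons[OF run_Cons.hyps(1) this] show ?case
    by (intro exI[of _ "Suc (length (A @ A')) # w'"]) simp
qed

text \<open>A label fixes the position of its exchange because entries are distinct. Together with
  \<open>run_label_unique\<close>, words and label sequences with a common start determine each
  other.\<close>

lemma run_word_unique:
  "run xs w L zs \<Longrightarrow> run xs w' L zs' \<Longrightarrow> distinct xs \<Longrightarrow> w = w' \<and> zs = zs'"
proof (induction arbitrary: w' rule: run.induct)
  case (run_Nil xs)
  then show ?case by simp
next
  case (run_Cons x y A B w L zs)
  from run_Cons.prems(1) obtain A' B' v where v: "A @ x # y # B = A' @ x # y # B'"
    "w' = Suc (length A') # v" "run (A' @ y # x # B') v L zs'"
    by (auto simp: run_Cons_iff)
  have "x \<notin> set A" "x \<notin> set (y # B)" using run_Cons.prems(2) by auto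
  with v(1) have "A' = A" "B' = B" by (auto simp: append_Cons_eq_iff)
  then show ?case using run_Cons.IH[of v] v run_Cons.prems(2) by auto
qed

lemma run_label_unique: "run xs w L zs \<Longrightarrow> run xs w L' zs' \<Longrightarrow> L = L' \<and> zs = zs'"
proof (induction arbitrary: L' rule: run.induct)
  case (run_Nil xs)
  then show ?case by simp
next
  case (run_Cons x y A B w L zs)
  from run_Cons.prems(1) obtain A' x' y' B' L'' where v: "A @ x # y # B = A' @ x' # y' # B'"
    "length A = length A'" "L' = (x', y') # L''" "run (A' @ y' # x' # B') w L'' zs'"
    by (auto simp: run_Cons_word_iff)
  then have "A' = A" "x' = x" "y' = y" "B' = B" by auto
  then show ?case using run_Cons.IH[of L''] v by auto
qed

section \<open>Moves of words and moves of label sequences\<close>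

definition disjoint_labels :: "nat \<times> nat \<Rightarrow> nat \<times> nat \<Rightarrow> bool" where
  "disjoint_labels p q \<longleftrightarrow> {fst p, snd p} \<inter> {fst q, snd q} = {}"

definition label_comm :: "(nat \<times> nat) list rel" where
  "label_comm = {(A @ p # q # B, A @ q # p # B) | A p q B. disjoint_labels p q}"

text \<open>The order x < y < z is supplied by the run, whose labels are ascending.\<close>

inductive_set label_braid :: "(nat \<times> nat) list rel" where
  label_braid_up:
    "(A @ (x, y) # (x, z) # (y, z) # B, A @ (y, z) # (x, z) # (x, y) # B) \<in> label_braid"
| label_braid_down:
    "(A @ (y, z) # (x, z) # (x, y) # B, A @ (x, y) # (x, z) # (y, z) # B) \<in> label_braid"

lemma comm_moveI: "\<bar>int j - int k\<bar> > 1 \<Longrightarrow> (x @ j # k # y, x @ k # j # y) \<in> comm_move"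
  unfolding comm_move_def by fastforce

lemma braid_move_upI:
  "(x @ j # Suc j # j # y, x @ Suc j # j # Suc j # y) \<in> braid_move"
  unfolding braid_move_def by fastforce

lemma braid_move_downI:
  "(x @ Suc j # j # Suc j # y, x @ j # Suc j # j # y) \<in> braid_move"
  unfolding braid_move_def by fastforce

lemma label_commI: "disjoint_labels p q \<Longrightarrow> (A @ p # q # B, A @ q # p # B) \<in> label_comm"
  unfolding label_comm_def by blast

lemma disjoint_labels_sym: "disjoint_labels p q \<longleftrightarrow> disjoint_labels q p"
  unfolding disjoint_labels_def by blast

text \<open>Two windows of width two in one list coincide, overlap in one entry, or lie apart.
  Disjoint labels leave only the last possibility; overlaps produce braid triples.\<close>

lemma adjacent_pairs_cases:
  assumes "A @ x # y # B = A' @ u # v # B'"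
  obtains (same) "A' = A" "u = x" "v = y" "B' = B"
  | (right) "A' = A @ [x]" "u = y" "B = v # B'"
  | (left) "A = A' @ [u]" "v = x" "B' = y # B"
  | (far_right) M where "A' = A @ x # y # M" "B = M @ u # v # B'"
  | (far_left) M where "A = A' @ u # v # M" "B' = M @ x # y # B"
proof -
  from assms consider M where "A = A' @ M" "M @ x # y # B = u # v # B'"
    | M where "A @ M = A'" "x # y # B = M @ u # v # B'"
    unfolding append_eq_append_conv2 by blast
  then show thesis
  proof cases
    case 1
    then show ?thesis by (cases M rule: remdups_adj.cases) (auto intro: that)
  next
    case 2
    then show ?thesis by (cases M rule: remdups_adj.cases) (auto intro: that)
  qed
qed

text \<open>The first exchange leaves its two values inside their window, so an exchange of two
  other values takes place in a disjoint window: the letters differ by more than 1 and the two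
  exchanges can be made in either order.\<close>

lemma run_comm_head:
  assumes "run xs w (p # q # L) zs" "distinct xs" "disjoint_labels p q"
  shows "\<exists>j k w'. w = j # k # w' \<and> \<bar>int j - int k\<bar> > 1 \<and> run xs (k # j # w') (q # p # L) zs"
proof -
  obtain A x y B w1 where 1: "p = (x, y)" "x < y" "xs = A @ x # y # B"
    "w = Suc (length A) # w1" "run (A @ y # x # B) w1 (q # L) zs"
    using assms(1) run_Cons_iff by blast
  obtain A' u v B' w2 where 2: "q = (u, v)" "u < v" "A @ y # x # B = A' @ u # v # B'"
    "w1 = Suc (length A') # w2" "run (A' @ v # u # B') w2 L zs"
    using 1(5) run_Cons_iff by blast
  have ne: "u \<noteq> x" "u \<noteq> y" "v \<noteq> x" "v \<noteq> y"
    using assms(3) 1(1) 2(1) by (auto simp: disjoint_labels_def)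
  from 2(3) show ?thesis
  proof (cases rule: adjacent_pairs_cases)
    case (far_right M)
    have "run (A @ x # y # M @ v # u # B') (Suc (length A) # w2) (p # L) zs"
      using 2(5) far_right unfolding 1(1) by (intro run_Cons 1(2)) simp
    then have "run xs (Suc (length A') # Suc (length A) # w2) (q # p # L) zs"
      using run_Cons[OF 2(2), of "A @ x # y # M"] far_right unfolding 2(1) 1(3) by simp
    then show ?thesis using 1(4) 2(4) far_right by auto
  next
    case (far_left M)
    have "run (A' @ v # u # M @ x # y # B) (Suc (length A) # w2) (p # L) zs"
      using 2(5) far_left run_Cons[OF 1(2), of "A' @ v # u # M"] unfolding 1(1) by simp
    then have "run xs (Suc (length A') # Suc (length A) # w2) (q # p # L) zs"
      using run_Cons[OF 2(2), of A' "M @ x # y # B"] far_left unfolding 2(1) 1(3) by simp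
    then show ?thesis using 1(4) 2(4) far_left by auto
  qed (use ne in auto)
qed

lemma run_comm_word_head:
  assumes "run xs (j # k # w) L zs" "distinct xs" "\<bar>int j - int k\<bar> > 1"
  shows "\<exists>p q L'. L = p # q # L' \<and> disjoint_labels p q"
proof -
  obtain A x y B L1 where 1: "L = (x, y) # L1" "x < y" "xs = A @ x # y # B"
    "j = Suc (length A)" "run (A @ y # x # B) (k # w) L1 zs"
    using assms(1) by (rule run_Cons_wordE)
  obtain A' u v B' L2 where 2: "L1 = (u, v) # L2" "u < v" "A @ y # x # B = A' @ u # v # B'"
    "k = Suc (length A')" "run (A' @ v # u # B') w L2 zs"
    using 1(5) by (rule run_Cons_wordE)
  have d: "distinct (A @ y # x # B)" using assms(2) 1(3) by auto
  from 2(3) have "disjoint_labels (x, y) (u, v)"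
    using assms(3) 1(4) 2(4) d
    by (cases rule: adjacent_pairs_cases) (auto simp: disjoint_labels_def)
  then show ?thesis using 1(1) 2(1) by blast
qed

lemma run_braid_up_head:
  assumes "run xs w ((x, y) # (x, z) # (y, z) # L) zs" "distinct xs"
  shows "\<exists>j w'. w = j # Suc j # j # w' \<and>
    run xs (Suc j # j # Suc j # w') ((y, z) # (x, z) # (x, y) # L) zs"
proof -
  obtain A B w1 where 1: "x < y" "xs = A @ x # y # B"
    "w = Suc (length A) # w1" "run (A @ y # x # B) w1 ((x, z) # (y, z) # L) zs"
    using assms(1) by (rule run_ConsE)
  obtain A' B' w2 where 2: "x < z" "A @ y # x # B = A' @ x # z # B'"
    "w1 = Suc (length A') # w2" "run (A' @ z # x # B') w2 ((y, z) # L) zs"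
    using 1(4) by (rule run_ConsE)
  obtain A'' B'' w3 where 3: "y < z" "A' @ z # x # B' = A'' @ y # z # B''"
    "w2 = Suc (length A'') # w3" "run (A'' @ z # y # B'') w3 L zs"
    using 2(4) by (rule run_ConsE)
  have d: "distinct (A @ y # x # B)" using assms(2) 1(2) by auto
  \<comment> \<open>After the first exchange \<open>x\<close> has \<open>y\<close> on its left, so
    its next partner \<open>z\<close> stands on its right: the list contained x y z consecutively,
    and the letters are j, j + 1, j.\<close>
  have A': "A' = A @ [y]" "B = z # B'"
    using 2(2) d 1(1) by (cases rule: adjacent_pairs_cases; auto)+
  have "distinct (A @ y # z # x # B')" using d A' by auto
  then have A'': "A'' = A" "B'' = x # B'"
    using 3(2) unfolding A' by (auto simp: append_Cons_eq_iff)
  have "run (A @ z # x # y # B') (Suc (Suc (length A)) # w3) ((x, y) # L) zs"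
    using run_Cons[OF 1(1), of "A @ [z]" B'] 3(4) A'' by simp
  from run_Cons[OF 2(1) this]
  have "run (A @ x # z # y # B') (Suc (length A) # Suc (Suc (length A)) # w3)
    ((x, z) # (x, y) # L) zs" .
  then have "run xs (Suc (Suc (length A)) # Suc (length A) # Suc (Suc (length A)) # w3)
    ((y, z) # (x, z) # (x, y) # L) zs"
    using run_Cons[OF 3(1), of "A @ [x]" B'] A' 1(2) by simp
  then show ?thesis using 1(3) 2(3) 3(3) A' A'' by auto
qed

lemma run_braid_down_head:
  assumes "run xs w ((y, z) # (x, z) # (x, y) # L) zs" "distinct xs"
  shows "\<exists>j w'. w = Suc j # j # Suc j # w' \<and>
    run xs (j # Suc j # j # w') ((x, y) # (x, z) # (y, z) # L) zs"
proof -
  obtain A B w1 where 1: "y < z" "xs = A @ y # z # B"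
    "w = Suc (length A) # w1" "run (A @ z # y # B) w1 ((x, z) # (x, y) # L) zs"
    using assms(1) by (rule run_ConsE)
  obtain A' B' w2 where 2: "x < z" "A @ z # y # B = A' @ x # z # B'"
    "w1 = Suc (length A') # w2" "run (A' @ z # x # B') w2 ((x, y) # L) zs"
    using 1(4) by (rule run_ConsE)
  obtain A'' B'' w3 where 3: "x < y" "A' @ z # x # B' = A'' @ x # y # B''"
    "w2 = Suc (length A'') # w3" "run (A'' @ y # x # B'') w3 L zs"
    using 2(4) by (rule run_ConsE)
  have d: "distinct (A @ z # y # B)" using assms(2) 1(2) by auto
  \<comment> \<open>Now \<open>z\<close> has \<open>y\<close> on its right, so its next partner
    \<open>x\<close> stands on its left: again the list contained x y z consecutively, and the
    letters are j + 1, j, j + 1.\<close>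
  have A': "A = A' @ [x]" "B' = y # B"
    using 2(2) d 1(1) 2(1) by (cases rule: adjacent_pairs_cases; auto)+
  have "distinct (A' @ z # x # y # B)" using d A' by auto
  then have "x \<notin> set (A' @ [z])" "x \<notin> set (y # B)" by auto
  then have "A' @ [z] = A'' \<and> y # B = y # B''"
    using 3(2) append_Cons_eq_iff[of x "A' @ [z]" "y # B" A'' "y # B''"] unfolding A' by simp
  then have A'': "A'' = A' @ [z]" "B'' = B" by auto
  have "run (A' @ y # z # x # B) (Suc (length A') # w3) ((y, z) # L) zs"
    using run_Cons[OF 1(1), of A' "x # B"] 3(4) A'' by simp
  then have "run (A' @ y # x # z # B) (Suc (Suc (length A')) # Suc (length A') # w3)
    ((x, z) # (y, z) # L) zs"
    using run_Cons[OF 2(1), of "A' @ [y]" B] by simp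
  from run_Cons[OF 3(1) this]
  have "run xs (Suc (length A') # Suc (Suc (length A')) # Suc (length A') # w3)
    ((x, y) # (x, z) # (y, z) # L) zs"
    using A' 1(2) by simp
  then show ?thesis using 1(3) 2(3) 3(3) A' A'' by auto
qed

lemma run_braid_up_word_head:
  assumes "run xs (j # Suc j # j # w) L zs"
  shows "\<exists>x y z L'. L = (x, y) # (x, z) # (y, z) # L'"
proof -
  obtain A x y B L1 where 1: "L = (x, y) # L1" "j = Suc (length A)"
      "run (A @ y # x # B) (Suc j # j # w) L1 zs"
    using assms(1) by (rule run_Cons_wordE)
  obtain A' u v B' L2 where 2: "L1 = (u, v) # L2" "A @ y # x # B = A' @ u # v # B'"
      "Suc j = Suc (length A')" "run (A' @ v # u # B') (j # w) L2 zs"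
    using 1(3) by (rule run_Cons_wordE)
  have A': "A' = A @ [y]" "u = x" "B = v # B'"
    using 2(2,3) 1(2) by (cases rule: adjacent_pairs_cases; auto)+
  from 2(4) obtain A'' s t B'' L3 where 3: "L2 = (s, t) # L3"
      "A' @ v # u # B' = A'' @ s # t # B''" "j = Suc (length A'')"
    by (rule run_Cons_wordE)
  have "s = y" "t = v" using 3(2,3) A' 1(2) by auto
  then show ?thesis using 1(1) 2(1) 3(1) A' by auto
qed

lemma run_braid_down_word_head:
  assumes "run xs (Suc j # j # Suc j # w) L zs"
  shows "\<exists>x y z L'. L = (y, z) # (x, z) # (x, y) # L'"
proof -
  obtain A y z B L1 where 1: "L = (y, z) # L1" "Suc j = Suc (length A)"
      "run (A @ z # y # B) (j # Suc j # w) L1 zs"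
    using assms(1) by (rule run_Cons_wordE)
  obtain A' u v B' L2 where 2: "L1 = (u, v) # L2" "A @ z # y # B = A' @ u # v # B'"
      "j = Suc (length A')" "run (A' @ v # u # B') (Suc j # w) L2 zs"
    using 1(3) by (rule run_Cons_wordE)
  have A': "A = A' @ [u]" "v = z" "B' = y # B"
    using 2(2,3) 1(2) by (cases rule: adjacent_pairs_cases; auto)+
  from 2(4) obtain A'' s t B'' L3 where 3: "L2 = (s, t) # L3"
      "A' @ v # u # B' = A'' @ s # t # B''" "Suc j = Suc (length A'')"
    by (rule run_Cons_wordE)
  have "(A' @ [v]) @ u # B' = A'' @ s # t # B''" "length (A' @ [v]) = length A''"
    using 3(2,3) 2(3) by auto
  then have "u # B' = s # t # B''" by (metis append_eq_append_conv)
  then have "s = u" "t = y" using A' by auto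
  then show ?thesis using 1(1) 2(1) 3(1) A' by auto
qed

text \<open>The list reached just after the two exchanged labels is the same in either order, so the
  letters before and after them are kept.\<close>

lemma label_comm_run:
  assumes "(L, L') \<in> label_comm" "run xs w L zs" "distinct xs"
  shows "\<exists>w'. (w, w') \<in> comm_move \<and> run xs w' L' zs"
proof -
  obtain A p q B where L: "L = A @ p # q # B" "L' = A @ q # p # B" "disjoint_labels p q"
    using assms(1) by (auto simp: label_comm_def)
  obtain w1 w2 ys where w: "w = w1 @ w2" "run xs w1 A ys" "run ys w2 (p # q # B) zs"
    using assms(2) unfolding L(1) by (rule run_appendE)
  have "distinct ys" using run_distinct w(2) assms(3) by blast
  from run_comm_head[OF w(3) this L(3)] obtain j k w3 where
    v: "w2 = j # k # w3" "\<bar>int j - int k\<bar> > 1" "run ys (k # j # w3) (q # p # B) zs" by blast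
  from v(3) have "run xs (w1 @ k # j # w3) L' zs"
    unfolding L(2) by (rule run_appendI[OF w(2)])
  with v show ?thesis
    unfolding w(1) by (intro exI[of _ "w1 @ k # j # w3"]) (simp add: comm_moveI)
qed

lemma comm_move_label:
  assumes "(w, w') \<in> comm_move" "run xs w L zs" "distinct xs"
  shows "\<exists>L'. (L, L') \<in> label_comm \<and> run xs w' L' zs"
proof -
  obtain w1 j k w2 where w: "w = w1 @ j # k # w2" "w' = w1 @ k # j # w2" "\<bar>int j - int k\<bar> > 1"
    using assms(1) by (auto simp: comm_move_def)
  obtain A C ys where L: "L = A @ C" "run xs w1 A ys" "run ys (j # k # w2) C zs"
    using assms(2) unfolding w(1) by (rule run_append_wordE)
  have d: "distinct ys" using run_distinct L(2) assms(3) by blast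
  obtain p q B where C: "C = p # q # B" "disjoint_labels p q"
    using run_comm_word_head[OF L(3) d w(3)] by blast
  from run_comm_head[OF L(3)[unfolded C(1)] d C(2)]
  have "run ys (k # j # w2) (q # p # B) zs" by auto
  then have "run xs w' (A @ q # p # B) zs" unfolding w(2) by (rule run_appendI[OF L(2)])
  then show ?thesis
    unfolding L(1) C(1) by (intro exI[of _ "A @ q # p # B"] conjI label_commI C(2))
qed

lemma label_braid_run:
  assumes "(L, L') \<in> label_braid" "run xs w L zs" "distinct xs"
  shows "\<exists>w'. (w, w') \<in> braid_move \<and> run xs w' L' zs"
proof -
  from assms(1) show ?thesis
  proof cases
    case (label_braid_up A x y z B)
    note 1 = label_braid_up
    obtain w1 w2 ys where w: "w = w1 @ w2" "run xs w1 A ys"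
        "run ys w2 ((x, y) # (x, z) # (y, z) # B) zs"
      using assms(2) unfolding 1(1) by (rule run_appendE)
    have "distinct ys" using run_distinct w(2) assms(3) by blast
    from run_braid_up_head[OF w(3) this] obtain j w3 where
      v: "w2 = j # Suc j # j # w3"
      "run ys (Suc j # j # Suc j # w3) ((y, z) # (x, z) # (x, y) # B) zs" by blast
    from v(2) have "run xs (w1 @ Suc j # j # Suc j # w3) L' zs"
      unfolding 1(2) by (rule run_appendI[OF w(2)])
    with v show ?thesis
      unfolding w(1) by (intro exI[of _ "w1 @ Suc j # j # Suc j # w3"]) (simp add: braid_move_upI)
  next
    case (label_braid_down A y z x B)
    note 2 = label_braid_down
    obtain w1 w2 ys where w: "w = w1 @ w2" "run xs w1 A ys"
        "run ys w2 ((y, z) # (x, z) # (x, y) # B) zs"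
      using assms(2) unfolding 2(1) by (rule run_appendE)
    have "distinct ys" using run_distinct w(2) assms(3) by blast
    from run_braid_down_head[OF w(3) this] obtain j w3 where
      v: "w2 = Suc j # j # Suc j # w3"
      "run ys (j # Suc j # j # w3) ((x, y) # (x, z) # (y, z) # B) zs" by blast
    from v(2) have "run xs (w1 @ j # Suc j # j # w3) L' zs"
      unfolding 2(2) by (rule run_appendI[OF w(2)])
    with v show ?thesis
      unfolding w(1) by (intro exI[of _ "w1 @ j # Suc j # j # w3"]) (simp add: braid_move_downI)
  qed
qed

lemma braid_move_label:
  assumes "(w, w') \<in> braid_move" "run xs w L zs" "distinct xs"
  shows "\<exists>L'. (L, L') \<in> label_braid \<and> run xs w' L' zs"
proof -
  from assms(1) consider w1 w2 j where
      "w = w1 @ [j, j + 1, j] @ w2" "w' = w1 @ [j + 1, j, j + 1] @ w2"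
    | w1 w2 j where
      "w = w1 @ [j + 1, j, j + 1] @ w2" "w' = w1 @ [j, j + 1, j] @ w2"
    unfolding braid_move_def by blast
  then show ?thesis
  proof cases
    case prems: 1
    have 1: "w = w1 @ j # Suc j # j # w2" "w' = w1 @ Suc j # j # Suc j # w2"
      using prems by simp_all
    obtain A C ys where L: "L = A @ C" "run xs w1 A ys" "run ys (j # Suc j # j # w2) C zs"
      using assms(2) unfolding 1(1) by (rule run_append_wordE)
    have d: "distinct ys" using run_distinct L(2) assms(3) by blast
    obtain x y z B where C: "C = (x, y) # (x, z) # (y, z) # B"
      using run_braid_up_word_head[OF L(3)] by blast
    from run_braid_up_head[OF L(3)[unfolded C] d]
    have "run ys (Suc j # j # Suc j # w2) ((y, z) # (x, z) # (x, y) # B) zs" by auto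
    then have "run xs w' (A @ (y, z) # (x, z) # (x, y) # B) zs"
      unfolding 1(2) by (rule run_appendI[OF L(2)])
    then show ?thesis
      unfolding L(1) C by (intro exI[of _ "A @ (y, z) # (x, z) # (x, y) # B"] conjI label_braid_up)
  next
    case prems: 2
    have 2: "w = w1 @ Suc j # j # Suc j # w2" "w' = w1 @ j # Suc j # j # w2"
      using prems by simp_all
    obtain A C ys where L: "L = A @ C" "run xs w1 A ys" "run ys (Suc j # j # Suc j # w2) C zs"
      using assms(2) unfolding 2(1) by (rule run_append_wordE)
    have d: "distinct ys" using run_distinct L(2) assms(3) by blast
    obtain x y z B where C: "C = (y, z) # (x, z) # (x, y) # B"
      using run_braid_down_word_head[OF L(3)] by blast
    from run_braid_down_head[OF L(3)[unfolded C] d]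
    have "run ys (j # Suc j # j # w2) ((x, y) # (x, z) # (y, z) # B) zs" by auto
    then have "run xs w' (A @ (x, y) # (x, z) # (y, z) # B) zs"
      unfolding 2(2) by (rule run_appendI[OF L(2)])
    then show ?thesis
      unfolding L(1) C by (intro exI[of _ "A @ (x, y) # (x, z) # (y, z) # B"] conjI label_braid_down)
  qed
qed

section \<open>Reduced words as runs\<close>

lemma adj_transp_involutory [simp]: "adj_transp r (adj_transp r i) = i"
  by (simp add: adj_transp_def)

lemma inj_adj_transp: "inj (adj_transp r)"
  by (rule inj_on_inverseI[of _ "adj_transp r"]) simp

lemma adj_transp_simps [simp]: "adj_transp r r = Suc r" "adj_transp r (Suc r) = r"
  by (simp_all add: adj_transp_def)

lemma adj_transp_other [simp]: "i \<noteq> r \<Longrightarrow> i \<noteq> Suc r \<Longrightarrow> adj_transp r i = i"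
  by (simp add: adj_transp_def)

lemma adj_transp_less:
  assumes "i < j" "(i, j) \<noteq> (r, Suc r)"
  shows "adj_transp r i < adj_transp r j"
  using assms by (cases "i = r"; cases "i = Suc r"; cases "j = r"; cases "j = Suc r") auto

lemma adj_transp_in:
  assumes "r \<in> {1..<n}"
  shows "1 \<le> i \<and> i \<le> n \<longleftrightarrow> 1 \<le> adj_transp r i \<and> adj_transp r i \<le> n"
  using assms by (cases "i = r"; cases "i = Suc r") auto

lemma finite_inversions [simp]: "finite (inversions n p)"
  by (rule finite_subset[of _ "{1..n} \<times> {1..n}"]) (auto simp: inversions_def)

text \<open>The transposition acts on positions and keeps the order of every two of them except r, r
  + 1. Thus the old inversions are carried along and the ascent at r becomes the one new
  inversion.\<close>

lemma inversions_adj_transp: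
  assumes r: "r \<in> {1..<n}" and p: "p r < p (Suc r)"
  shows "inversions n (p \<circ> adj_transp r) =
    insert (r, Suc r) (map_prod (adj_transp r) (adj_transp r) ` inversions n p)"
proof (intro set_eqI iffI)
  fix c assume c: "c \<in> inversions n (p \<circ> adj_transp r)"
  obtain i j where ij: "c = (i, j)" by (cases c)
  show "c \<in> insert (r, Suc r) (map_prod (adj_transp r) (adj_transp r) ` inversions n p)"
  proof (cases "c = (r, Suc r)")
    case False
    have "(adj_transp r i, adj_transp r j) \<in> inversions n p"
      using c False ij adj_transp_less[of i j r] adj_transp_in[OF r, of i] adj_transp_in[OF r, of j]
      by (auto simp: inversions_def)
    then show ?thesis
      using ij by (intro insertI2 image_eqI[of _ _ "(adj_transp r i, adj_transp r j)"]) auto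
  qed auto
next
  fix c assume "c \<in> insert (r, Suc r) (map_prod (adj_transp r) (adj_transp r) ` inversions n p)"
  then consider "c = (r, Suc r)"
    | i j where "c = (adj_transp r i, adj_transp r j)" "(i, j) \<in> inversions n p" by auto
  then show "c \<in> inversions n (p \<circ> adj_transp r)"
  proof cases
    case 1
    then show ?thesis using r p by (auto simp: inversions_def)
  next
    case 2
    have "(i, j) \<noteq> (r, Suc r)" using 2(2) p by (auto simp: inversions_def)
    then show ?thesis
      using 2 adj_transp_less[of i j r] adj_transp_in[OF r, of i] adj_transp_in[OF r, of j]
      by (auto simp: inversions_def)
  qed
qed

lemma perm_length_adj_transp:
  assumes "r \<in> {1..<n}" "p r < p (Suc r)"
  shows "perm_length n (p \<circ> adj_transp r) = Suc (perm_length n p)"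
proof -
  have inj: "inj_on (map_prod (adj_transp r) (adj_transp r)) (inversions n p)"
    using prod.inj_map[OF inj_adj_transp inj_adj_transp] by (rule inj_on_subset) simp
  have "(r, Suc r) \<noteq> (adj_transp r i, adj_transp r j)" if "i < j" for i j
    using that by (metis adj_transp_involutory adj_transp_simps(1) Pair_inject less_Suc_eq less_asym)
  then have "(r, Suc r) \<notin> map_prod (adj_transp r) (adj_transp r) ` inversions n p"
    by (auto simp: inversions_def)
  then show ?thesis
    unfolding perm_length_def inversions_adj_transp[OF assms] by (simp add: card_image[OF inj])
qed

lemma one_line_adj_transp:
  assumes "r \<in> {1..<n}"
  shows "map p [1..<Suc n] = map p [1..<r] @ p r # p (Suc r) # map p [Suc (Suc r)..<Suc n]"
    and "map (p \<circ> adj_transp r) [1..<Suc n] =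
      map p [1..<r] @ p (Suc r) # p r # map p [Suc (Suc r)..<Suc n]"
proof -
  have "[1..<Suc n] = [1..<r] @ [r..<Suc n]"
    using assms upt_add_eq_append[of 1 r "Suc n - r"] by auto
  also have "[r..<Suc n] = r # Suc r # [Suc (Suc r)..<Suc n]"
    using assms by (simp add: upt_conv_Cons del: upt_Suc)
  finally have *: "[1..<Suc n] = [1..<r] @ r # Suc r # [Suc (Suc r)..<Suc n]" .
  show "map p [1..<Suc n] = map p [1..<r] @ p r # p (Suc r) # map p [Suc (Suc r)..<Suc n]"
    unfolding * by (simp del: upt_Suc)
  show "map (p \<circ> adj_transp r) [1..<Suc n] =
      map p [1..<r] @ p (Suc r) # p r # map p [Suc (Suc r)..<Suc n]"
    unfolding * by (simp del: upt_Suc)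
qed

lemma word_prod_simps [simp]:
  "word_prod [] = id" "word_prod (r # w) = adj_transp r \<circ> word_prod w"
  by (simp_all add: word_prod_def)

text \<open>Exchanging the entries at positions r and r + 1 is composition with the transposition on
  the right. As the exchange is made at an ascent, the length grows by one each time.\<close>

lemma run_imp_reduced:
  assumes "run xs w L zs" "xs = map p [1..<Suc n]"
  shows "set w \<subseteq> {1..<n} \<and> zs = map (p \<circ> word_prod w) [1..<Suc n] \<and>
    perm_length n (p \<circ> word_prod w) = perm_length n p + length w"
  using assms
proof (induction arbitrary: p)
  case (run_Nil xs)
  then show ?case by simp
next
  case (run_Cons x y A B w L zs)
  let ?r = "Suc (length A)"
  have "length (A @ x # y # B) = n" unfolding run_Cons.prems by simp
  then have r: "?r \<in> {1..<n}" by simp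
  have "length A = length (map p [1..<?r])" by (simp del: upt_Suc)
  then have eq: "A = map p [1..<?r]" "x = p ?r" "y = p (Suc ?r)"
      "B = map p [Suc (Suc ?r)..<Suc n]"
    using run_Cons.prems one_line_adj_transp(1)[OF r, of p] by (auto simp del: upt_Suc)
  have "A @ y # x # B = map (p \<circ> adj_transp ?r) [1..<Suc n]"
    unfolding one_line_adj_transp(2)[OF r] using eq by (simp del: upt_Suc)
  note IH = run_Cons.IH[OF this]
  have len: "perm_length n (p \<circ> adj_transp ?r) = Suc (perm_length n p)"
    using run_Cons.hyps(1) eq by (intro perm_length_adj_transp r) auto
  have prod: "p \<circ> word_prod (?r # w) = p \<circ> adj_transp ?r \<circ> word_prod w"
    by (simp only: word_prod_simps o_assoc)
  show ?case
    unfolding prod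
  proof (intro conjI)
    show "set (?r # w) \<subseteq> {1..<n}" using IH r by simp
    show "zs = map (p \<circ> adj_transp ?r \<circ> word_prod w) [1..<Suc n]" using IH by blast
    show "perm_length n (p \<circ> adj_transp ?r \<circ> word_prod w) = perm_length n p + length (?r # w)"
      using IH len by (simp only: list.size)
  qed
qed

lemma perm_length_word_le:
  assumes "set w \<subseteq> {1..<n}" "inj p"
  shows "perm_length n (p \<circ> word_prod w) \<le> perm_length n p + length w"
  using assms
proof (induction w arbitrary: p)
  case Nil
  then show ?case by simp
next
  case (Cons r w)
  have r: "r \<in> {1..<n}" using Cons.prems(1) by simp
  have "p r \<noteq> p (Suc r)" using Cons.prems(2) by (simp add: inj_eq)
  \<comment> \<open>If \<open>p\<close> descends at \<open>r\<close>, then the product ascends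
    there, and multiplying once more returns \<open>p\<close>: the letter has shortened the
    permutation.\<close>
  then consider "p r < p (Suc r)" | "(p \<circ> adj_transp r) r < (p \<circ> adj_transp r) (Suc r)"
    by fastforce
  then have "perm_length n (p \<circ> adj_transp r) \<le> Suc (perm_length n p)"
  proof cases
    case 1
    then show ?thesis using perm_length_adj_transp[OF r, of p] by simp
  next
    case 2
    have "p \<circ> adj_transp r \<circ> adj_transp r = p" by (simp add: fun_eq_iff)
    then have "perm_length n (p \<circ> adj_transp r \<circ> adj_transp r) = perm_length n p"
      by (rule arg_cong)
    with perm_length_adj_transp[OF r 2] show ?thesis by linarith
  qed
  moreover have "perm_length n ((p \<circ> adj_transp r) \<circ> word_prod w)
      \<le> perm_length n (p \<circ> adj_transp r) + length w"
    using Cons.prems(1) by (intro Cons.IH inj_compose[OF Cons.prems(2) inj_adj_transp]) simp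
  ultimately show ?case by (simp only: word_prod_simps o_assoc list.size)
qed

text \<open>A letter raises the length by at most one, so a word as long as the total increase can
  waste no letter: each must act at an ascent, which is the condition in \<open>run\<close>.\<close>

lemma reduced_imp_run:
  assumes "set w \<subseteq> {1..<n}" "inj p"
    "perm_length n (p \<circ> word_prod w) = perm_length n p + length w"
  shows "\<exists>L. run (map p [1..<Suc n]) w L (map (p \<circ> word_prod w) [1..<Suc n])"
  using assms
proof (induction w arbitrary: p)
  case Nil
  then show ?case by simp
next
  case (Cons r w)
  have r: "r \<in> {1..<n}" using Cons.prems(1) by simp
  have inj: "inj (p \<circ> adj_transp r)" using Cons.prems(2) inj_adj_transp by (rule inj_compose)
  have w: "set w \<subseteq> {1..<n}" using Cons.prems(1) by simp
  have le: "perm_length n p + Suc (length w) \<le> perm_length n (p \<circ> adj_transp r) + length w"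
    using perm_length_word_le[OF w inj] Cons.prems(3)
    by (simp only: word_prod_simps o_assoc list.size)
  have less: "p r < p (Suc r)"
  proof (rule ccontr)
    assume "\<not> p r < p (Suc r)"
    moreover have "p r \<noteq> p (Suc r)" using Cons.prems(2) by (simp add: inj_eq)
    ultimately have "(p \<circ> adj_transp r) r < (p \<circ> adj_transp r) (Suc r)" by simp
    note len = perm_length_adj_transp[OF r this]
    have "p \<circ> adj_transp r \<circ> adj_transp r = p" by (simp add: fun_eq_iff)
    then have "perm_length n (p \<circ> adj_transp r \<circ> adj_transp r) = perm_length n p"
      by (rule arg_cong)
    with len le show False by linarith
  qed
  have "perm_length n ((p \<circ> adj_transp r) \<circ> word_prod w) =
      perm_length n (p \<circ> adj_transp r) + length w"
    using Cons.prems(3) unfolding perm_length_adj_transp[OF r less]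
    by (simp only: word_prod_simps o_assoc list.size)
  from Cons.IH[OF w inj this] obtain L where
    "run (map (p \<circ> adj_transp r) [1..<Suc n]) w L
      (map (p \<circ> adj_transp r \<circ> word_prod w) [1..<Suc n])" by blast
  then have "run (map p [1..<Suc n]) (Suc (length (map p [1..<r])) # w) ((p r, p (Suc r)) # L)
      (map (p \<circ> adj_transp r \<circ> word_prod w) [1..<Suc n])"
    unfolding one_line_adj_transp(2)[OF r, of p] one_line_adj_transp(1)[OF r, of p]
    by (rule run_Cons[OF less])
  moreover have "Suc (length (map p [1..<r])) = r" using r by simp
  ultimately show ?case by (simp only: word_prod_simps o_assoc) (rule exI)
qed

lemma word_prod_permutes: "set w \<subseteq> {1..<n} \<Longrightarrow> word_prod w permutes {1..n}"
proof (induction w)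
  case Nil
  show ?case by (simp only: word_prod_simps permutes_id)
next
  case (Cons r w)
  have "adj_transp r permutes {1..n}"
    unfolding adj_transp_def using Cons.prems by (intro permutes_swap_id) auto
  moreover have "word_prod w permutes {1..n}" using Cons by simp
  ultimately show ?case by (simp only: word_prod_simps) (rule permutes_compose)
qed

lemma reduced_words_iff_run:
  assumes "p permutes {1..n}"
  shows "w \<in> reduced_words n p \<longleftrightarrow> (\<exists>L. run [1..<Suc n] w L (map p [1..<Suc n]))"
proof -
  have 0: "perm_length n id = 0" 
  proof -
    have "inversions n id = {}" by (auto simp: inversions_def)
    then show ?thesis by (simp add: perm_length_def)
  qed
  have id: "map id [1..<Suc n] = [1..<Suc n]" by simp
  show ?thesis
  proof
    assume "w \<in> reduced_words n p"
    then have w: "set w \<subseteq> {1..<n}" "length w = perm_length n p" "p = word_prod w"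
      by (auto simp: reduced_words_def)
    have "perm_length n (id \<circ> word_prod w) = perm_length n id + length w" using w 0 by simp
    from reduced_imp_run[OF w(1) inj_on_id this]
    show "\<exists>L. run [1..<Suc n] w L (map p [1..<Suc n])"
      unfolding id id_comp w(3)[symmetric] .
  next
    assume "\<exists>L. run [1..<Suc n] w L (map p [1..<Suc n])"
    then obtain L where "run [1..<Suc n] w L (map p [1..<Suc n])" by blast
    from run_imp_reduced[OF this id[symmetric]]
    have w: "set w \<subseteq> {1..<n}" "map p [1..<Suc n] = map (word_prod w) [1..<Suc n]"
      "perm_length n (word_prod w) = length w" unfolding id_comp 0 by simp_all
    from w(2) have eq: "\<forall>i\<in>set [1..<Suc n]. p i = word_prod w i" unfolding map_eq_conv .
    \<comment> \<open>The lists compare the two functions on 1..n only; elsewhere both are the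
      identity.\<close>
    have "p = word_prod w"
    proof
      fix i
      show "p i = word_prod w i"
      proof (cases "i \<in> {1..n}")
        case True
        then have "i \<in> set [1..<Suc n]" by auto
        with eq show ?thesis by blast
      next
        case False
        then show ?thesis
          using assms word_prod_permutes[OF w(1)] by (metis permutes_not_in)
      qed
    qed
    then show "w \<in> reduced_words n p" using w by (simp add: reduced_words_def)
  qed
qed

section \<open>Transfer of walks between words and label sequences\<close>

definition run_words :: "nat list \<Rightarrow> nat list \<Rightarrow> nat list set" where
  "run_words xs zs = {w. \<exists>L. run xs w L zs}"

text \<open>A label move turns a run into a run with the same ends, so every sequence met on the
  walk is spelled by a word in \<open>R\<close>, although the label relations themselves are
  unrestricted.\<close>

lemma label_walk_word_walk:
  assumes "gwalk label_comm label_braid c t L L'" "run xs u L zs" "distinct xs"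
  defines "R \<equiv> run_words xs zs"
  shows "\<exists>u'. run xs u' L' zs \<and> gwalk (comm_move \<inter> R \<times> R) (braid_move \<inter> R \<times> R) c t u u'"
  using assms(1,2)
proof (induction arbitrary: u)
  case (gwalk_refl L)
  then show ?case by (auto intro: gwalk.gwalk_refl)
next
  case (gwalk_left L M c t N)
  obtain v where v: "(u, v) \<in> comm_move" "run xs v M zs"
    using label_comm_run[OF gwalk_left.hyps(1) gwalk_left.prems assms(3)] by blast
  obtain u' where u': "run xs u' N zs"
      "gwalk (comm_move \<inter> R \<times> R) (braid_move \<inter> R \<times> R) c t v u'"
    using gwalk_left.IH[OF v(2)] by blast
  have "(u, v) \<in> comm_move \<inter> R \<times> R"
    using v gwalk_left.prems by (auto simp: R_def run_words_def)
  from gwalk.gwalk_left[OF this u'(2)] u'(1) show ?case by blast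
next
  case (gwalk_right L M c t N)
  obtain v where v: "(u, v) \<in> braid_move" "run xs v M zs"
    using label_braid_run[OF gwalk_right.hyps(1) gwalk_right.prems assms(3)] by blast
  obtain u' where u': "run xs u' N zs"
      "gwalk (comm_move \<inter> R \<times> R) (braid_move \<inter> R \<times> R) c t v u'"
    using gwalk_right.IH[OF v(2)] by blast
  have "(u, v) \<in> braid_move \<inter> R \<times> R"
    using v gwalk_right.prems by (auto simp: R_def run_words_def)
  from gwalk.gwalk_right[OF this u'(2)] u'(1) show ?case by blast
qed

lemma word_walk_label_walk:
  assumes "gwalk (comm_move \<inter> R \<times> R) (braid_move \<inter> R \<times> R) c t u u'" "run xs u L zs" "distinct xs"
  shows "\<exists>L'. run xs u' L' zs \<and> gwalk label_comm label_braid c t L L'"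
  using assms(1,2)
proof (induction arbitrary: L)
  case (gwalk_refl u)
  then show ?case by (auto intro: gwalk.gwalk_refl)
next
  case (gwalk_left u v c t u')
  obtain M where M: "(L, M) \<in> label_comm" "run xs v M zs"
    using comm_move_label[OF _ gwalk_left.prems assms(3)] gwalk_left.hyps(1) by blast
  with gwalk_left.IH[OF M(2)] show ?case by (meson gwalk.gwalk_left)
next
  case (gwalk_right u v c t u')
  obtain M where M: "(L, M) \<in> label_braid" "run xs v M zs"
    using braid_move_label[OF _ gwalk_right.prems assms(3)] gwalk_right.hyps(1) by blast
  with gwalk_right.IH[OF M(2)] show ?case by (meson gwalk.gwalk_right)
qed

section \<open>One-line notation of the inflation\<close>

lemma inflation21_permutes:
  assumes "\<alpha> permutes {1..a}"
  shows "inflation21 a b \<alpha> id permutes {1..a + b}"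
proof (rule bij_imp_permutes)
  have "bij_betw (inflation21 a b \<alpha> id) {1..a} {b + 1..a + b}"
  proof -
    have "bij_betw ((\<lambda>i. i + b) \<circ> \<alpha>) {1..a} {b + 1..a + b}"
      using permutes_imp_bij[OF assms]
      by (rule bij_betw_trans) (rule bij_betw_byWitness[of _ "\<lambda>i. i - b"], auto)
    then show ?thesis by (rule bij_betw_cong[THEN iffD1, rotated]) (simp add: inflation21_def)
  qed
  moreover have "bij_betw (inflation21 a b \<alpha> id) {a + 1..a + b} {1..b}"
    by (rule bij_betw_byWitness[of _ "\<lambda>i. i + a"]) (auto simp: inflation21_def)
  ultimately have "bij_betw (inflation21 a b \<alpha> id) ({1..a} \<union> {a + 1..a + b})
      ({b + 1..a + b} \<union> {1..b})"
    by (rule bij_betw_combine) auto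
  moreover have "{1..a} \<union> {a + 1..a + b} = {1..a + b}" "{b + 1..a + b} \<union> {1..b} = {1..a + b}"
    by auto
  ultimately show "bij_betw (inflation21 a b \<alpha> id) {1..a + b} {1..a + b}" by simp
  show "\<And>x. x \<notin> {1..a + b} \<Longrightarrow> inflation21 a b \<alpha> id x = x"
    by (auto simp: inflation21_def)
qed

lemma upt_shift: "[m + k..<n + k] = map (\<lambda>i. i + k) [m..<n]"
  by (induction n) auto

lemma inflation21_one_line:
  "map (inflation21 a b \<alpha> id) [1..<Suc (a + b)] =
    map (\<lambda>i. \<alpha> i + b) [1..<Suc a] @ [1..<Suc b]"
proof -
  have "[1..<Suc (a + b)] = [1..<Suc a] @ [Suc a..<Suc a + b]"
    using upt_add_eq_append[of 1 "Suc a" b] by simp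
  also have "[Suc a..<Suc a + b] = map (\<lambda>i. i + a) [1..<Suc b]"
    using upt_shift[of 1 a "Suc b"] by (simp add: add.commute del: upt_Suc)
  finally have *: "[1..<Suc (a + b)] = [1..<Suc a] @ map (\<lambda>i. i + a) [1..<Suc b]" .
  have "map (inflation21 a b \<alpha> id) [1..<Suc a] = map (\<lambda>i. \<alpha> i + b) [1..<Suc a]"
    by (rule map_cong) (auto simp: inflation21_def)
  moreover have "map (inflation21 a b \<alpha> id) (map (\<lambda>i. i + a) [1..<Suc b]) = [1..<Suc b]"
    unfolding map_map by (rule map_idI) (auto simp: inflation21_def)
  ultimately show ?thesis unfolding * map_append by simp
qed

text \<open>Words do not notice the addition of \<open>b\<close> to all values. So the words of
  \<alpha> can be read on b + 1, ..., a + b, the values that survive the projection.\<close>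

lemma reduced_words_shift:
  assumes "\<alpha> permutes {1..a}"
  shows "reduced_words a \<alpha> = run_words [Suc b..<Suc (a + b)] (map (\<lambda>i. \<alpha> i + b) [1..<Suc a])"
proof -
  have up: "[Suc b..<Suc (a + b)] = map (\<lambda>x. x + b) [1..<Suc a]"
    using upt_shift[of 1 b "Suc a"] by (simp del: upt_Suc)
  have zs: "map (\<lambda>i. \<alpha> i + b) [1..<Suc a] = map (\<lambda>x. x + b) (map \<alpha> [1..<Suc a])"
    by simp
  have down: "map (\<lambda>x. x - b) (map (\<lambda>x. x + b) ys) = ys" for ys :: "nat list"
    by (simp add: o_def)
  show ?thesis
  proof (intro set_eqI iffI)
    fix w assume "w \<in> reduced_words a \<alpha>"
    then obtain L where "run [1..<Suc a] w L (map \<alpha> [1..<Suc a])"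
      using reduced_words_iff_run[OF assms] by blast
    from run_map[OF this, of "\<lambda>x. x + b"]
    show "w \<in> run_words [Suc b..<Suc (a + b)] (map (\<lambda>i. \<alpha> i + b) [1..<Suc a])"
      unfolding run_words_def up zs by auto
  next
    fix w assume "w \<in> run_words [Suc b..<Suc (a + b)] (map (\<lambda>i. \<alpha> i + b) [1..<Suc a])"
    then obtain L where L: "run [Suc b..<Suc (a + b)] w L (map (\<lambda>i. \<alpha> i + b) [1..<Suc a])"
      unfolding run_words_def by blast
    have "run (map (\<lambda>x. x - b) [Suc b..<Suc (a + b)]) w
        (map (map_prod (\<lambda>x. x - b) (\<lambda>x. x - b)) L)
        (map (\<lambda>x. x - b) (map (\<lambda>i. \<alpha> i + b) [1..<Suc a]))"
      by (rule run_map[OF L]) auto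
    then show "w \<in> reduced_words a \<alpha>"
      unfolding reduced_words_iff_run[OF assms] up zs down by blast
  qed
qed

section \<open>Label sequences\<close>

text \<open>On distinct lists the labels determine the word, so arguments about orders may forget
  it.\<close>

definition lrun :: "nat list \<Rightarrow> (nat \<times> nat) list \<Rightarrow> nat list \<Rightarrow> bool" where
  "lrun xs L zs \<longleftrightarrow> (\<exists>w. run xs w L zs)"

lemma lrun_Nil [simp]: "lrun xs [] zs \<longleftrightarrow> xs = zs"
  by (simp add: lrun_def)

lemma lrun_ConsI: "x < y \<Longrightarrow> lrun (A @ y # x # B) L zs \<Longrightarrow> lrun (A @ x # y # B) ((x, y) # L) zs"
  unfolding lrun_def using run_Cons by blast

lemma lrun_ConsE:
  assumes "lrun xs ((x, y) # L) zs"
  obtains A B where "x < y" "xs = A @ x # y # B" "lrun (A @ y # x # B) L zs"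
proof -
  obtain w where "run xs w ((x, y) # L) zs" using assms unfolding lrun_def by blast
  then obtain A B w' where "x < y" "xs = A @ x # y # B" "run (A @ y # x # B) w' L zs"
    by (rule run_ConsE)
  then show thesis by (intro that) (auto simp: lrun_def)
qed

lemma lrun_appendI: "lrun xs L1 ys \<Longrightarrow> lrun ys L2 zs \<Longrightarrow> lrun xs (L1 @ L2) zs"
  unfolding lrun_def using run_appendI by blast

lemma lrun_appendE:
  assumes "lrun xs (L1 @ L2) zs"
  obtains ys where "lrun xs L1 ys" "lrun ys L2 zs"
proof -
  obtain w where "run xs w (L1 @ L2) zs" using assms unfolding lrun_def by blast
  then obtain w1 w2 ys where "run xs w1 L1 ys" "run ys w2 L2 zs"
    by (rule run_appendE)
  then show thesis by (intro that) (auto simp: lrun_def)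
qed

lemma lrun_context: "lrun xs L zs \<Longrightarrow> lrun (A @ xs @ B) L (A @ zs @ B)"
  unfolding lrun_def using run_context by blast

lemma lrun_filter:
  "lrun xs L zs \<Longrightarrow> lrun (filter P xs) (filter (\<lambda>p. P (fst p) \<and> P (snd p)) L) (filter P zs)"
  unfolding lrun_def using run_filter by blast

lemma lrun_distinct: "lrun xs L zs \<Longrightarrow> distinct xs \<Longrightarrow> distinct zs"
  unfolding lrun_def using run_distinct by blast

lemma lrun_ascending: "lrun xs L zs \<Longrightarrow> (x, y) \<in> set L \<Longrightarrow> x < y"
  unfolding lrun_def using run_ascending by fastforce

lemma lrun_before:
  assumes "lrun xs L zs" "distinct xs"
  shows "distinct L" "set L \<subseteq> before xs" "before zs = (before xs - set L) \<union> (set L)\<inverse>"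
  using assms unfolding lrun_def using run_labels by blast+

lemma lrun_comm: "(L, L') \<in> label_comm \<Longrightarrow> lrun xs L zs \<Longrightarrow> distinct xs \<Longrightarrow> lrun xs L' zs"
  unfolding lrun_def using label_comm_run by blast

lemma lrun_braid: "(L, L') \<in> label_braid \<Longrightarrow> lrun xs L zs \<Longrightarrow> distinct xs \<Longrightarrow> lrun xs L' zs"
  unfolding lrun_def using label_braid_run by blast

lemma lrun_pass:
  assumes "\<forall>z\<in>set zs. m < z"
  shows "lrun (A @ m # zs @ B) (map (Pair m) zs) (A @ zs @ m # B)"
  using assms
proof (induction zs arbitrary: A)
  case Nil
  then show ?case by simp
next
  case (Cons z zs)
  have "lrun ((A @ [z]) @ m # zs @ B) (map (Pair m) zs) ((A @ [z]) @ zs @ m # B)"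
    using Cons.prems by (intro Cons.IH) simp
  then have "lrun (A @ z # m # zs @ B) (map (Pair m) zs) (A @ z # zs @ m # B)" by simp
  then show ?case using Cons.prems by (simp add: lrun_ConsI)
qed

lemma lrun_pass_left:
  assumes "\<forall>m\<in>set ms. m < z"
  shows "lrun (A @ ms @ z # B) (map (\<lambda>m. (m, z)) (rev ms)) (A @ z # ms @ B)"
  using assms
proof (induction ms arbitrary: B rule: rev_induct)
  case Nil
  then show ?case by simp
next
  case (snoc m ms)
  have "lrun (A @ ms @ z # m # B) (map (\<lambda>m. (m, z)) (rev ms)) (A @ z # ms @ m # B)"
    using snoc.prems by (intro snoc.IH) simp
  then have "lrun ((A @ ms) @ z # m # B) (map (\<lambda>m. (m, z)) (rev ms)) (A @ z # ms @ m # B)"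
    by simp
  then have "lrun ((A @ ms) @ m # z # B) ((m, z) # map (\<lambda>m. (m, z)) (rev ms))
      (A @ z # ms @ m # B)"
    using snoc.prems by (intro lrun_ConsI) simp_all
  then show ?case by simp
qed

text \<open>After passing one strand, \<open>m\<close> exchanges next with its new right neighbour.
  So its successive partners stood immediately to its right, in this order. This adjacency is what
  later exhibits a braid triple.\<close>

lemma lrun_passE:
  assumes "lrun S (map (Pair m) (k # ks) @ V) E" "distinct S"
  obtains A B where "S = A @ m # k # ks @ B" "lrun (A @ k # ks @ m # B) V E"
  using assms
proof (induction ks arbitrary: k S thesis)
  case Nil
  from Nil.prems(2) have "lrun S ((m, k) # V) E" by simp
  then obtain A B where "S = A @ m # k # B" "lrun (A @ k # m # B) V E" by (rule lrun_ConsE)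
  then show ?case using Nil.prems(1)[of A B] by simp
next
  case (Cons k' ks)
  from Cons.prems(2) have "lrun S ((m, k) # map (Pair m) (k' # ks) @ V) E" by simp
  then obtain A B where AB: "S = A @ m # k # B"
    "lrun (A @ k # m # B) (map (Pair m) (k' # ks) @ V) E" by (rule lrun_ConsE)
  have d: "distinct (A @ k # m # B)" using Cons.prems(3) AB(1) by auto
  from Cons.IH[OF _ AB(2) d] obtain A' B' where
    *: "A @ k # m # B = A' @ m # k' # ks @ B'" "lrun (A' @ k' # ks @ m # B') V E" .
  have "m \<notin> set (A @ [k])" "m \<notin> set B" using d by auto
  moreover have "(A @ [k]) @ m # B = A' @ m # k' # ks @ B'" using *(1) by simp
  ultimately have "A @ [k] = A' \<and> B = k' # ks @ B'"
    using append_Cons_eq_iff[of m "A @ [k]" B A' "k' # ks @ B'"] by blast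
  then have A': "A' = A @ [k]" "B = k' # ks @ B'" by simp_all
  show ?case
  proof (rule Cons.prems(1))
    show "S = A @ m # k # (k' # ks) @ B'" using AB(1) A'(2) by simp
    show "lrun (A @ k # (k' # ks) @ m # B') V E" using *(2) A'(1) by simp
  qed
qed

section \<open>Crossing grids\<close>

text \<open>Carries one strand of \<open>ms\<close> at a time through all of \<open>zs\<close>, the
  last one first. For ascending \<open>ms\<close>, no (m, x) precedes an (m', y) with m <
  m'.\<close>

definition grid_cols :: "nat list \<Rightarrow> nat list \<Rightarrow> (nat \<times> nat) list" where
  "grid_cols ms zs = concat (map (\<lambda>m. map (Pair m) zs) (rev ms))"

text \<open>Carries one strand of \<open>zs\<close> at a time through all of \<open>ms\<close>. Here
  (m, x) precedes (m', y) for all m, m' whenever x precedes y in \<open>zs\<close>, which yields the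
  largest possible number of \<open>grid_pairs\<close>.\<close>

definition grid_rows :: "nat list \<Rightarrow> nat list \<Rightarrow> (nat \<times> nat) list" where
  "grid_rows ms zs = concat (map (\<lambda>z. map (\<lambda>m. (m, z)) (rev ms)) zs)"

lemma set_grid_cols [simp]: "set (grid_cols ms zs) = set ms \<times> set zs"
  by (auto simp: grid_cols_def)

lemma set_grid_rows [simp]: "set (grid_rows ms zs) = set ms \<times> set zs"
  by (auto simp: grid_rows_def)

lemma lrun_grid_cols:
  assumes "\<forall>m\<in>set ms. \<forall>z\<in>set zs. m < z"
  shows "lrun (ms @ zs @ B) (grid_cols ms zs) (zs @ ms @ B)"
  using assms
proof (induction ms arbitrary: B rule: rev_induct)
  case Nil
  then show ?case by (simp add: grid_cols_def)
next
  case (snoc m ms)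
  have "lrun (ms @ m # zs @ B) (map (Pair m) zs) (ms @ zs @ m # B)"
    using snoc.prems by (intro lrun_pass) simp
  moreover have "lrun (ms @ zs @ m # B) (grid_cols ms zs) (zs @ ms @ m # B)"
    using snoc.prems by (intro snoc.IH) simp
  ultimately have "lrun (ms @ m # zs @ B) (map (Pair m) zs @ grid_cols ms zs) (zs @ ms @ m # B)"
    by (rule lrun_appendI)
  then show ?case by (simp add: grid_cols_def)
qed

lemma lrun_grid_rows:
  assumes "\<forall>m\<in>set ms. \<forall>z\<in>set zs. m < z"
  shows "lrun (A @ ms @ zs) (grid_rows ms zs) (A @ zs @ ms)"
  using assms
proof (induction zs arbitrary: A)
  case Nil
  then show ?case by (simp add: grid_rows_def)
next
  case (Cons z zs)
  have "lrun (A @ ms @ z # zs) (map (\<lambda>m. (m, z)) (rev ms)) (A @ z # ms @ zs)"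
    using Cons.prems by (intro lrun_pass_left) simp
  moreover have "lrun ((A @ [z]) @ ms @ zs) (grid_rows ms zs) ((A @ [z]) @ zs @ ms)"
    using Cons.prems by (intro Cons.IH) simp
  ultimately have "lrun (A @ ms @ z # zs) (map (\<lambda>m. (m, z)) (rev ms) @ grid_rows ms zs)
      (A @ z # zs @ ms)"
    by (auto intro: lrun_appendI)
  then show ?case by (simp add: grid_rows_def)
qed

lemma before_rev: "before (rev xs) = (before xs)\<inverse>"
  by (induction xs) auto

lemma before_upt: "before [i..<j] = {(k, l). i \<le> k \<and> k < l \<and> l < j}"
proof (induction j)
  case 0
  then show ?case by simp
next
  case (Suc j)
  show ?case
  proof (cases "i \<le> j")
    case True
    have "before [i..<Suc j] = {(k, l). i \<le> k \<and> k < l \<and> l < j} \<union> {i..<j} \<times> {j}"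
      using True Suc by (simp add: upt_Suc_append)
    also have "\<dots> = {(k, l). i \<le> k \<and> k < l \<and> l < Suc j}" using True by auto
    finally show ?thesis .
  qed auto
qed

lemma before_split:
  assumes "(p, q) \<in> before L"
  obtains A B C where "L = A @ p # B @ q # C"
  using assms
proof (induction L arbitrary: thesis)
  case Nil
  from Nil.prems(2) show ?case by simp
next
  case (Cons r L)
  show ?case
  proof (cases "(p, q) \<in> before L")
    case True
    from Cons.IH[OF _ this] obtain A B C where "L = A @ p # B @ q # C" .
    then show ?thesis using Cons.prems(1)[of "r # A" B C] by simp
  next
    case False
    then have "p = r" "q \<in> set L" using Cons.prems(2) by auto
    then show ?thesis using Cons.prems(1)[of "[]"] by (auto simp: in_set_conv_decomp)
  qed
qed

lemma before_concat_map:
  "before (concat (map f xs)) = (\<Union>x\<in>set xs. before (f x)) \<union> (\<Union>(x, y)\<in>before xs. set (f x) \<times> set (f y))"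
proof (induction xs)
  case Nil
  then show ?case by simp
next
  case (Cons x xs)
  have "(\<Union>(x, y)\<in>before (x # xs). set (f x) \<times> set (f y)) =
      set (f x) \<times> set (concat (map f xs)) \<union> (\<Union>(x, y)\<in>before xs. set (f x) \<times> set (f y))"
    by auto
  then show ?case using Cons by auto
qed

lemma before_grid_cols:
  "((m, x), (m', y)) \<in> before (grid_cols ms zs) \<longleftrightarrow> x \<in> set zs \<and> y \<in> set zs \<and>
    ((m', m) \<in> before ms \<or> m = m' \<and> m \<in> set ms \<and> (x, y) \<in> before zs)"
proof -
  have "((m, x), (m', y)) \<in> (\<Union>k\<in>set (rev ms). before (map (Pair k) zs)) \<longleftrightarrow>
      m = m' \<and> m \<in> set ms \<and> (x, y) \<in> before zs"
    unfolding before_map by auto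
  moreover have "((m, x), (m', y)) \<in>
      (\<Union>(k, l)\<in>before (rev ms). set (map (Pair k) zs) \<times> set (map (Pair l) zs)) \<longleftrightarrow>
      (m', m) \<in> before ms \<and> x \<in> set zs \<and> y \<in> set zs"
    unfolding before_rev by (auto intro!: bexI[of _ "(m, m')"])
  ultimately show ?thesis
    unfolding grid_cols_def before_concat_map by (auto dest: before_in_set)
qed

lemma before_grid_rows:
  "((m, x), (m', y)) \<in> before (grid_rows ms zs) \<longleftrightarrow> m \<in> set ms \<and> m' \<in> set ms \<and>
    ((x, y) \<in> before zs \<or> x = y \<and> x \<in> set zs \<and> (m', m) \<in> before ms)"
proof -
  have "((m, x), (m', y)) \<in> (\<Union>z\<in>set zs. before (map (\<lambda>m. (m, z)) (rev ms))) \<longleftrightarrow>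
      x = y \<and> x \<in> set zs \<and> (m', m) \<in> before ms"
    unfolding before_map before_rev by auto
  moreover have "((m, x), (m', y)) \<in>
      (\<Union>(k, l)\<in>before zs. set (map (\<lambda>m. (m, k)) (rev ms)) \<times> set (map (\<lambda>m. (m, l)) (rev ms))) \<longleftrightarrow>
      (x, y) \<in> before zs \<and> m \<in> set ms \<and> m' \<in> set ms"
    by (auto intro!: bexI[of _ "(x, y)"])
  ultimately show ?thesis
    unfolding grid_rows_def before_concat_map by (auto dest: before_in_set)
qed

lemma card_before: "distinct xs \<Longrightarrow> card (before xs) = length xs choose 2"
proof (induction xs)
  case Nil
  then show ?case by simp
next
  case (Cons x xs)
  have "({x} \<times> set xs) \<inter> before xs = {}" using Cons.prems by (auto dest: before_in_set)
  then have "card (before (x # xs)) = card ({x} \<times> set xs) + card (before xs)"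
    by (simp add: card_Un_disjoint)
  also have "card ({x} \<times> set xs) = length xs"
    using Cons.prems by (simp add: card_cartesian_product distinct_card)
  finally show ?case using Cons by (simp add: numeral_2_eq_2)
qed

section \<open>Counting ordered pairs of labels\<close>

definition count_pairs :: "('a \<times> 'a) set \<Rightarrow> 'a list \<Rightarrow> nat" where
  "count_pairs F L = card (before L \<inter> F)"

lemma count_pairs_swap:
  assumes "distinct (A @ p # q # B)" "(p, q) \<in> F" "(q, p) \<notin> F"
  shows "count_pairs F (A @ p # q # B) = Suc (count_pairs F (A @ q # p # B))"
proof -
  define S where "S = before (A @ p # q # B)"
  have pq: "(p, q) \<in> S" by (simp add: S_def)
  have "finite (S \<inter> F)" by (simp add: S_def)
  moreover have "before (A @ q # p # B) \<inter> F = S \<inter> F - {(p, q)}"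
    unfolding before_swap[OF assms(1)] S_def[symmetric] using assms(3) by blast
  ultimately show ?thesis
    unfolding count_pairs_def S_def[symmetric] using pq assms(2)
    by (simp only: card_Suc_Diff1 IntI)
qed

lemma count_pairs_swap_same:
  assumes "distinct (A @ p # q # B)" "(p, q) \<notin> F" "(q, p) \<notin> F"
  shows "count_pairs F (A @ q # p # B) = count_pairs F (A @ p # q # B)"
proof -
  have "before (A @ q # p # B) \<inter> F = before (A @ p # q # B) \<inter> F"
    unfolding before_swap[OF assms(1)] using assms(2,3) by blast
  then show ?thesis by (simp only: count_pairs_def)
qed

lemma count_pairs_swap_le:
  assumes "distinct (A @ p # q # B)"
  shows "count_pairs F (A @ q # p # B) \<le> Suc (count_pairs F (A @ p # q # B))"
proof -
  define S where "S = before (A @ p # q # B) \<inter> F"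
  have fin: "finite S" by (simp add: S_def)
  have "before (A @ q # p # B) \<inter> F \<subseteq> insert (q, p) S"
    unfolding before_swap[OF assms] S_def by blast
  then have "card (before (A @ q # p # B) \<inter> F) \<le> card (insert (q, p) S)"
    using fin by (intro card_mono) simp_all
  also have "\<dots> \<le> Suc (card S)" using fin by (simp add: card_insert_if)
  finally show ?thesis unfolding count_pairs_def S_def .
qed

lemma count_pairs_rev3:
  assumes "distinct (A @ p # q # r # B)" "(p, r) \<in> F"
    "{(p, q), (q, r), (q, p), (r, q), (r, p)} \<inter> F = {}"
  shows "count_pairs F (A @ p # q # r # B) = Suc (count_pairs F (A @ r # q # p # B))"
proof -
  define S where "S = before (A @ p # q # r # B)"
  have pr: "(p, r) \<in> S" by (simp add: S_def)
  have "finite (S \<inter> F)" by (simp add: S_def)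
  moreover have "before (A @ r # q # p # B) \<inter> F = S \<inter> F - {(p, r)}"
    unfolding before_rev3[OF assms(1)] S_def[symmetric] using assms(3) by blast
  ultimately show ?thesis
    unfolding count_pairs_def S_def[symmetric] using pr assms(2)
    by (simp only: card_Suc_Diff1 IntI)
qed

lemma count_pairs_rev3_same:
  assumes "distinct (A @ p # q # r # B)"
    "{(p, q), (q, r), (p, r), (q, p), (r, q), (r, p)} \<inter> F = {}"
  shows "count_pairs F (A @ r # q # p # B) = count_pairs F (A @ p # q # r # B)"
proof -
  have "before (A @ r # q # p # B) \<inter> F = before (A @ p # q # r # B) \<inter> F"
    unfolding before_rev3[OF assms(1)] using assms(2) by blast
  then show ?thesis by (simp only: count_pairs_def)
qed

lemma count_pairs_Un_le: "count_pairs (F \<union> F') L \<le> count_pairs F L + count_pairs F' L"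
  unfolding count_pairs_def Int_Un_distrib by (rule card_Un_le)

text \<open>A distinct list shows a couple in one order only, so the couples of \<open>D\<close>
  found in order and those found reversed are disjoint subsets of \<open>D\<close>.\<close>

lemma count_pairs_converse:
  assumes "distinct L" "finite D" "before L \<inter> F \<subseteq> D" "before L \<inter> F\<inverse> \<subseteq> D\<inverse>"
  shows "count_pairs F L + count_pairs (F\<inverse>) L \<le> card D"
proof -
  have "count_pairs (F\<inverse>) L = card ((before L \<inter> F\<inverse>)\<inverse>)"
    unfolding count_pairs_def by simp
  moreover have "(before L \<inter> F) \<inter> (before L \<inter> F\<inverse>)\<inverse> = {}"
    using before_asym[OF assms(1)] by blast
  moreover have "finite (before L \<inter> F)" "finite ((before L \<inter> F\<inverse>)\<inverse>)" by simp_all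
  ultimately have "count_pairs F L + count_pairs (F\<inverse>) L =
      card ((before L \<inter> F) \<union> (before L \<inter> F\<inverse>)\<inverse>)"
    unfolding count_pairs_def by (simp add: card_Un_disjoint)
  also have "\<dots> \<le> card D" using assms(2-4) by (intro card_mono) auto
  finally show ?thesis .
qed

section \<open>Straightening to normal forms\<close>

lemma not_sorted_wrt_adjacent:
  assumes "\<not> sorted_wrt (\<lambda>p q. f q \<le> (f p :: nat)) X"
  shows "\<exists>A p q B. X = A @ p # q # B \<and> f p < f q"
  using assms
proof (induction X)
  case Nil
  then show ?case by simp
next
  case (Cons p X)
  show ?case
  proof (cases "sorted_wrt (\<lambda>p q. f q \<le> f p) X")
    case False
    then obtain A q r B where "X = A @ q # r # B" "f q < f r" using Cons.IH by blast
    then have "p # X = (p # A) @ q # r # B \<and> f q < f r" by simp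
    then show ?thesis by blast
  next
    case True
    with Cons.prems obtain r where r: "r \<in> set X" "f p < f r" by (auto simp: not_le)
    then obtain q Y where X: "X = q # Y" by (cases X) auto
    have "f r \<le> f q" using True r(1) X by auto
    then have "p # X = [] @ p # q # Y \<and> f p < f q" using r(2) X by simp
    then show ?thesis by blast
  qed
qed

lemma same_fst_eq_map: "\<forall>p\<in>set Y. fst p = m \<Longrightarrow> Y = map (Pair m) (map snd Y)"
  by (induction Y) auto

section \<open>The couples of labels that are counted\<close>

definition high :: "nat \<Rightarrow> nat \<times> nat \<Rightarrow> bool" where
  "high b p \<longleftrightarrow> b < fst p \<and> b < snd p"

text \<open>Of a triple (m,x), (m,y), (x,y) only the outer couple is recorded, so a braid move with
  one small strand changes the count by exactly one.\<close>

definition braid_pairs :: "nat \<Rightarrow> ((nat \<times> nat) \<times> (nat \<times> nat)) set" where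
  "braid_pairs b = {(p, q). fst p \<le> b \<and> high b q \<and> snd p = fst q}"

text \<open>A small value never occurs in a high pair, so the two inequalities say that the labels
  are disjoint; such a couple is reversed only by a commutation.\<close>

definition comm_pairs :: "nat \<Rightarrow> ((nat \<times> nat) \<times> (nat \<times> nat)) set" where
  "comm_pairs b = {(p, q). fst p \<le> b \<and> high b q \<and> snd p \<noteq> fst q \<and> snd p \<noteq> snd q}"

text \<open>The couples that violate the order of \<open>grid_cols\<close>, where larger m come
  first.\<close>

definition grid_pairs :: "nat \<Rightarrow> ((nat \<times> nat) \<times> (nat \<times> nat)) set" where
  "grid_pairs b = {(p, q). fst p < fst q \<and> fst q \<le> b \<and> b < snd p \<and> b < snd q \<and> snd p \<noteq> snd q}"

lemmas pairs_defs = braid_pairs_def comm_pairs_def grid_pairs_def high_def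

section \<open>Label sequences of the inflation and their straightening\<close>

locale inflated_run =
  fixes b :: nat and xs zs :: "nat list"
  assumes distinct_xs: "distinct xs" and distinct_zs: "distinct zs"
    and set_zs: "set zs = set xs" and big: "x \<in> set xs \<Longrightarrow> b < x"
begin

definition ms :: "nat list" where "ms = [1..<Suc b]"

definition valid :: "(nat \<times> nat) list \<Rightarrow> bool" where
  "valid L \<longleftrightarrow> lrun (ms @ xs) L (zs @ ms)"

definition proj :: "(nat \<times> nat) list \<Rightarrow> (nat \<times> nat) list" where
  "proj L = filter (high b) L"

lemma set_ms [simp]: "m \<in> set ms \<longleftrightarrow> 1 \<le> m \<and> m \<le> b"
  by (auto simp: ms_def)

lemma before_ms [simp]: "(m, m') \<in> before ms \<longleftrightarrow> 1 \<le> m \<and> m < m' \<and> m' \<le> b"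
  by (auto simp: ms_def before_upt simp del: upt_Suc)

lemma distinct_ms: "distinct ms"
  by (simp add: ms_def)

lemma ms_Int_xs: "set ms \<inter> set xs = {}"
  by (auto dest: big)

lemma distinct_start: "distinct (ms @ xs)"
  unfolding distinct_append using distinct_xs distinct_ms ms_Int_xs by blast

lemma distinct_end: "distinct (zs @ ms)"
  unfolding distinct_append set_zs using distinct_zs distinct_ms ms_Int_xs by blast

lemma valid_distinct: "valid L \<Longrightarrow> distinct L"
  unfolding valid_def using lrun_before(1) distinct_start by blast

lemma valid_comm: "valid L \<Longrightarrow> (L, L') \<in> label_comm \<Longrightarrow> valid L'"
  unfolding valid_def using lrun_comm distinct_start by blast

lemma valid_braid: "valid L \<Longrightarrow> (L, L') \<in> label_braid \<Longrightarrow> valid L'"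
  unfolding valid_def using lrun_braid distinct_start by blast

lemma valid_proj:
  assumes "valid L"
  shows "lrun xs (proj L) zs"
proof -
  have "filter ((<) b) ms = []" by (auto simp: filter_empty_conv)
  moreover have "filter ((<) b) xs = xs" "filter ((<) b) zs = zs"
    using big set_zs by (auto simp: filter_id_conv)
  ultimately show ?thesis
    using lrun_filter[OF assms[unfolded valid_def], of "(<) b"]
    by (simp add: proj_def high_def[abs_def])
qed

text \<open>The small values stand in the same order at the start and at the end, and the labels are
  exactly the pairs whose order changes.\<close>

lemma small_not_label:
  assumes "valid L" "(m, m') \<in> set L" "m' \<le> b"
  shows False
proof -
  note L = assms(1)[unfolded valid_def]
  have less: "m < m'" using lrun_ascending[OF L assms(2)] .
  have "(m, m') \<in> before (ms @ xs)" using lrun_before(2)[OF L distinct_start] assms(2) by blast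
  then have "m \<in> set ms \<union> set xs" "m' \<in> set ms \<union> set xs"
    using before_in_set by fastforce+
  then have "1 \<le> m" "1 \<le> m'" using big[of m] big[of m'] assms(3) less by auto
  then have "(m, m') \<in> before (zs @ ms)" using less assms(3) by simp
  moreover have "(m', m) \<in> before (zs @ ms)"
    using lrun_before(3)[OF L distinct_start] assms(2) by blast
  ultimately show False using before_asym[OF distinct_end] by blast
qed

lemma label_cases:
  assumes "valid L" "(u, v) \<in> set L"
  obtains (high) "b < u" "u < v" "u \<in> set xs" "v \<in> set xs"
  | (cross) "1 \<le> u" "u \<le> b" "b < v" "v \<in> set xs"
proof -
  note L = assms(1)[unfolded valid_def]
  have less: "u < v" using lrun_ascending[OF L assms(2)] .
  have "(u, v) \<in> before (ms @ xs)" using lrun_before(2)[OF L distinct_start] assms(2) by blast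
  then have uv: "u \<in> set ms \<or> u \<in> set xs" "v \<in> set ms \<or> v \<in> set xs"
    using before_in_set by fastforce+
  have "\<not> v \<le> b" using small_not_label[OF assms] by blast
  then have v: "b < v" "v \<in> set xs" using uv(2) by auto
  show thesis
  proof (cases "u \<in> set xs")
    case True
    then show ?thesis using high less v big by blast
  next
    case False
    then show ?thesis using cross uv(1) v by simp
  qed
qed

lemma cross_label:
  assumes "valid L" "1 \<le> m" "m \<le> b" "x \<in> set xs"
  shows "(m, x) \<in> set L"
proof -
  note L = assms(1)[unfolded valid_def]
  have "(x, m) \<in> before (zs @ ms)" using assms set_zs by simp
  moreover have "(m, x) \<in> before (ms @ xs)" using assms by simp
  then have "(x, m) \<notin> before (ms @ xs)" using before_asym[OF distinct_start] by blast
  ultimately show ?thesis using lrun_before(3)[OF L distinct_start] by blast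
qed

lemma not_high_label:
  assumes "valid L" "p \<in> set L" "\<not> high b p"
  obtains m k where "p = (m, k)" "1 \<le> m" "m \<le> b" "b < k" "k \<in> set xs"
proof -
  obtain u v where p: "p = (u, v)" by (cases p)
  with assms(2) have "(u, v) \<in> set L" by simp
  from assms(1) this show thesis
  proof (cases rule: label_cases)
    case high
    then show ?thesis using assms(3) p by (simp add: high_def)
  next
    case cross
    then show ?thesis using that p by blast
  qed
qed

text \<open>When m passes x, x is its right neighbour. As m' stays to the right of m throughout, it
  is already to the right of x and must have crossed x earlier.\<close>

lemma cross_order:
  assumes "valid L" "1 \<le> m" "m < m'" "m' \<le> b" "x \<in> set xs"
  shows "((m', x), (m, x)) \<in> before L"
proof -
  note L = assms(1)[unfolded valid_def]
  have "(m, x) \<in> set L" using assms by (intro cross_label) auto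
  then obtain A B where AB: "L = A @ (m, x) # B" by (auto simp: in_set_conv_decomp)
  from L[unfolded AB] obtain S where S: "lrun (ms @ xs) A S" "lrun S ((m, x) # B) (zs @ ms)"
    by (rule lrun_appendE)
  from S(2) obtain C D where CD: "S = C @ m # x # D" by (rule lrun_ConsE)
  note bS = lrun_before(3)[OF S(1) distinct_start]
  have dS: "distinct S" using lrun_distinct[OF S(1) distinct_start] .
  have "(m, m') \<in> before (ms @ xs)" using assms by simp
  moreover have "(m, m') \<notin> set A"
    using small_not_label[OF assms(1), of m m'] AB assms(4) by auto
  ultimately have mm: "(m, m') \<in> before S" using bS by blast
  have "m' \<noteq> x" using assms(4,5) big by fastforce
  moreover have "m' \<notin> set (C @ [m])"
  proof
    assume "m' \<in> set (C @ [m])"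
    then have "(m', m) \<in> before S" unfolding CD using assms(3) by auto
    then show False using before_asym[OF dS mm] by blast
  qed
  moreover have "m' \<in> set S" using before_in_set[OF mm] by blast
  ultimately have "m' \<in> set D" unfolding CD by auto
  then have "(x, m') \<in> before S" unfolding CD by simp
  moreover have "(x, m') \<notin> before (ms @ xs)"
  proof -
    have "(m', x) \<in> before (ms @ xs)" using assms by simp
    then show ?thesis using before_asym[OF distinct_start] by blast
  qed
  ultimately have "(m', x) \<in> set A" using bS by blast
  then show ?thesis unfolding AB by simp
qed

text \<open>\<open>T\<close> belongs to the normal form with the high pairs first, \<open>B\<close>
  to that with the high pairs last; \<open>c\<close> counts couples to be reversed by commutations,
  \<open>t\<close> by braids. The mixed couples enter conversely, but \<open>grid_pairs\<close> does
  not: both normal forms sort the other labels as in \<open>grid_cols\<close>.\<close>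

abbreviation "cT L \<equiv> count_pairs (comm_pairs b \<union> grid_pairs b) L"
abbreviation "tT L \<equiv> count_pairs (braid_pairs b) L"
abbreviation "cB L \<equiv> count_pairs ((comm_pairs b)\<inverse> \<union> grid_pairs b) L"
abbreviation "tB L \<equiv> count_pairs ((braid_pairs b)\<inverse>) L"

text \<open>For neighbours (m, x), (m', y) with m < m', \<open>cross_order\<close> excludes x = y,
  so they commute, and the swap lowers the grid count contained in both \<open>cT\<close> and
  \<open>cB\<close>.\<close>

lemma sort_block:
  assumes v: "valid L" and L: "L = A @ X @ B" and X: "\<forall>p\<in>set X. \<not> high b p"
    and ns: "\<not> sorted_wrt (\<lambda>p q. fst q \<le> fst p) X"
  shows "\<exists>L'. (L, L') \<in> label_comm \<and> proj L' = proj L \<and>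
    cT L = Suc (cT L') \<and> tT L' = tT L \<and> cB L = Suc (cB L') \<and> tB L' = tB L"
proof -
  obtain X1 p q X2 where X12: "X = X1 @ p # q # X2" "fst p < fst q"
    using not_sorted_wrt_adjacent[OF ns] by blast
  have inL: "p \<in> set L" "q \<in> set L" using L X12 by auto
  have nh: "\<not> high b p" "\<not> high b q" using X X12 by auto
  obtain m x where p: "p = (m, x)" "1 \<le> m" "m \<le> b" "b < x" "x \<in> set xs"
    using not_high_label[OF v inL(1) nh(1)] .
  obtain m' y where q: "q = (m', y)" "1 \<le> m'" "m' \<le> b" "b < y" "y \<in> set xs"
    using not_high_label[OF v inL(2) nh(2)] .
  have mm: "m < m'" using X12(2) p(1) q(1) by simp
  define L' where "L' = (A @ X1) @ q # p # X2 @ B"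
  have LL: "L = (A @ X1) @ p # q # X2 @ B" using L X12(1) by simp
  have d: "distinct ((A @ X1) @ p # q # X2 @ B)" using valid_distinct[OF v] LL by simp
  have "x \<noteq> y"
  proof
    assume "x = y"
    then have "(q, p) \<in> before L" using cross_order[OF v p(2) mm q(3) q(5)] p(1) q(1) by simp
    moreover have "(p, q) \<in> before L" unfolding LL by simp
    ultimately show False using before_asym[OF valid_distinct[OF v]] by blast
  qed
  then have "disjoint_labels p q" using p q mm by (auto simp: disjoint_labels_def)
  then have "(L, L') \<in> label_comm" unfolding LL L'_def by (rule label_commI)
  moreover have "proj L' = proj L" unfolding LL L'_def proj_def using nh by simp
  moreover have "cT L = Suc (cT L')" "cB L = Suc (cB L')"
    unfolding LL L'_def using p q mm \<open>x \<noteq> y\<close>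
    by (intro count_pairs_swap[OF d]; simp add: pairs_defs)+
  moreover have "tT L' = tT L" "tB L' = tB L"
    unfolding LL L'_def using p q
    by (intro count_pairs_swap_same[OF d]; simp add: pairs_defs)+
  ultimately show ?thesis by blast
qed

lemma block_between:
  fixes m :: nat
  assumes "sorted_wrt (\<lambda>p q. fst q \<le> fst p) (X1 @ (m, x) # X2 @ (m, y) # X3)"
  shows "(m, x) # X2 @ [(m, y)] = map (Pair m) (x # map snd X2 @ [y])"
proof -
  have "\<forall>p\<in>set X2. fst p \<le> m \<and> m \<le> fst p"
    using assms by (auto simp: sorted_wrt_append)
  then have "\<forall>p\<in>set X2. fst p = m" by fastforce
  from same_fst_eq_map[OF this] show ?thesis by simp
qed

lemma sorted_fst_before:
  "sorted_wrt (\<lambda>p q. fst q \<le> fst p) X \<Longrightarrow> (p, q) \<in> before X \<Longrightarrow> fst q \<le> fst p"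
  by (induction X) auto

lemma cross_block_set:
  assumes v: "valid L" and L: "set L = set P \<union> set X" and P: "\<forall>p\<in>set P. high b p"
    and X: "\<forall>p\<in>set X. \<not> high b p"
  shows "set X = set ms \<times> set xs"
proof (intro set_eqI iffI)
  fix p assume p: "p \<in> set X"
  then have "p \<in> set L" "\<not> high b p" using L X by auto
  with v obtain m k where "p = (m, k)" "1 \<le> m" "m \<le> b" "b < k" "k \<in> set xs"
    by (rule not_high_label)
  then show "p \<in> set ms \<times> set xs" by simp
next
  fix p assume "p \<in> set ms \<times> set xs"
  then obtain m k where p: "p = (m, k)" "1 \<le> m" "m \<le> b" "k \<in> set xs" by auto
  then have "p \<in> set L" using cross_label[OF v] by blast
  moreover have "p \<notin> set P" using P p by (auto simp: high_def)
  ultimately show "p \<in> set X" using L by blast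
qed

lemma swap_high_left:
  assumes v: "valid L" and L: "L = A @ p # c # B" and p: "\<not> high b p" and c: "high b c"
    and d: "disjoint_labels p c"
  shows "\<exists>L'. (L, L') \<in> label_comm \<and> proj L' = proj L \<and> cT L = Suc (cT L') \<and> tT L' = tT L"
proof -
  obtain m k where mk: "p = (m, k)" "1 \<le> m" "m \<le> b" "b < k" "k \<in> set xs"
    using v _ p by (rule not_high_label) (simp add: L)
  obtain x y where xy: "c = (x, y)" by (cases c)
  have ne: "k \<noteq> x" "k \<noteq> y" using d mk(1) xy by (auto simp: disjoint_labels_def)
  have dist: "distinct (A @ p # c # B)" using valid_distinct[OF v] L by simp
  have "(L, A @ c # p # B) \<in> label_comm" unfolding L using d by (rule label_commI)
  moreover have "proj (A @ c # p # B) = proj L" unfolding L proj_def using p by simp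
  moreover have "cT L = Suc (cT (A @ c # p # B))" unfolding L using mk ne c xy
    by (intro count_pairs_swap[OF dist]; simp add: pairs_defs)
  moreover have "tT (A @ c # p # B) = tT L" unfolding L using mk ne c xy
    by (intro count_pairs_swap_same[OF dist]; simp add: pairs_defs)
  ultimately show ?thesis by blast
qed

lemma swap_high_right:
  assumes v: "valid L" and L: "L = A @ c # p # B" and p: "\<not> high b p" and c: "high b c"
    and d: "disjoint_labels c p"
  shows "\<exists>L'. (L, L') \<in> label_comm \<and> proj L' = proj L \<and> cB L = Suc (cB L') \<and> tB L' = tB L"
proof -
  obtain m k where mk: "p = (m, k)" "1 \<le> m" "m \<le> b" "b < k" "k \<in> set xs"
    using v _ p by (rule not_high_label) (simp add: L)
  obtain x y where xy: "c = (x, y)" by (cases c)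
  have ne: "k \<noteq> x" "k \<noteq> y" using d mk(1) xy by (auto simp: disjoint_labels_def)
  have dist: "distinct (A @ c # p # B)" using valid_distinct[OF v] L by simp
  have "(L, A @ p # c # B) \<in> label_comm" unfolding L using d by (rule label_commI)
  moreover have "proj (A @ p # c # B) = proj L" unfolding L proj_def using p by simp
  moreover have "cB L = Suc (cB (A @ p # c # B))" unfolding L using mk ne c xy
    by (intro count_pairs_swap[OF dist]; simp add: pairs_defs)
  moreover have "tB (A @ p # c # B) = tB L" unfolding L using mk ne c xy
    by (intro count_pairs_swap_same[OF dist]; simp add: pairs_defs)
  ultimately show ?thesis by blast
qed

lemma braid_high_left:
  assumes v: "valid L" and L: "L = A @ (m, x) # (m, y) # (x, y) # B"
    and m: "m \<le> b" and xy: "b < x" "b < y" "x \<noteq> y"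
  shows "\<exists>L'. (L, L') \<in> label_braid \<and> proj L' = proj L \<and> cT L' = cT L \<and> tT L = Suc (tT L')"
proof -
  let ?L' = "A @ (x, y) # (m, y) # (m, x) # B"
  have dist: "distinct (A @ (m, x) # (m, y) # (x, y) # B)" using valid_distinct[OF v] L by simp
  have "(L, ?L') \<in> label_braid" unfolding L by (rule label_braid_up)
  moreover have "proj ?L' = proj L" unfolding L proj_def using m by (simp add: high_def)
  moreover have "tT L = Suc (tT ?L')" unfolding L using m xy
    by (intro count_pairs_rev3[OF dist]; simp add: pairs_defs)
  moreover have "cT ?L' = cT L" unfolding L using m xy
    by (intro count_pairs_rev3_same[OF dist]; simp add: pairs_defs)
  ultimately show ?thesis by blast
qed

lemma braid_high_right:
  assumes v: "valid L" and L: "L = A @ (x, y) # (m, y) # (m, x) # B"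
    and m: "m \<le> b" and xy: "b < x" "b < y" "x \<noteq> y"
  shows "\<exists>L'. (L, L') \<in> label_braid \<and> proj L' = proj L \<and> cB L' = cB L \<and> tB L = Suc (tB L')"
proof -
  let ?L' = "A @ (m, x) # (m, y) # (x, y) # B"
  have dist: "distinct (A @ (x, y) # (m, y) # (m, x) # B)" using valid_distinct[OF v] L by simp
  have "(L, ?L') \<in> label_braid" unfolding L by (rule label_braid_down)
  moreover have "proj ?L' = proj L" unfolding L proj_def using m by (simp add: high_def)
  moreover have "tB L = Suc (tB ?L')" unfolding L using m xy
    by (intro count_pairs_rev3[OF dist]; simp add: pairs_defs)
  moreover have "cB ?L' = cB L" unfolding L using m xy
    by (intro count_pairs_rev3_same[OF dist]; simp add: pairs_defs)
  ultimately show ?thesis by blast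
qed

text \<open>Only labels with equal first entry m remain to be compared. The strand m meets the
  others in the order in which they stand, and since all high crossings are already done, this is
  their order in \<open>zs\<close>.\<close>

lemma normal_form_left:
  assumes v: "valid L" and L: "L = P @ X" and P: "\<forall>p\<in>set P. high b p"
    and X: "\<forall>p\<in>set X. \<not> high b p" and sorted: "sorted_wrt (\<lambda>p q. fst q \<le> fst p) X"
  shows "X = grid_cols ms zs"
proof (rule distinct_eq_before)
  have setX: "set X = set ms \<times> set xs"
    using v _ P X by (rule cross_block_set) (simp add: L)
  show "distinct X" using valid_distinct[OF v] L by simp
  show "set X = set (grid_cols ms zs)" using setX set_zs by simp
  show "distinct (grid_cols ms zs)"
    using lrun_before(1)[OF lrun_grid_cols[of ms zs "[]"]] distinct_start distinct_zs set_zs big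
      ms_Int_xs distinct_ms
    by force
  show "before X \<subseteq> before (grid_cols ms zs)"
  proof (rule subrelI)
    fix p q assume pq: "(p, q) \<in> before X"
    then have "p \<in> set ms \<times> set xs" "q \<in> set ms \<times> set xs"
      using before_in_set[OF pq] setX by simp_all
    then obtain m x m' y where p: "p = (m, x)" "m \<in> set ms" "x \<in> set xs"
      and q: "q = (m', y)" "m' \<in> set ms" "y \<in> set xs" by auto
    have le: "m' \<le> m" using sorted_fst_before[OF sorted pq] p q by simp
    show "(p, q) \<in> before (grid_cols ms zs)"
    proof (cases "m' = m")
      case False
      then show ?thesis using le p q set_zs by (simp add: before_grid_cols)
    next
      case True
      from pq obtain X1 X2 X3 where X123: "X = X1 @ p # X2 @ q # X3" by (rule before_split)
      from sorted[unfolded X123 p(1) q(1) True]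
      have "(m, x) # X2 @ [(m, y)] = map (Pair m) (x # map snd X2 @ [y])"
        by (rule block_between)
      then have LL: "L = (P @ X1) @ map (Pair m) (x # map snd X2 @ [y]) @ X3"
        using L X123 p(1) q(1) True by simp
      note run = v[unfolded valid_def LL]
      from run obtain S where S: "lrun (ms @ xs) (P @ X1) S"
        "lrun S (map (Pair m) (x # map snd X2 @ [y]) @ X3) (zs @ ms)"
        by (rule lrun_appendE)
      have dS: "distinct S" using lrun_distinct[OF S(1) distinct_start] .
      from S(2) dS obtain A B where AB: "S = A @ m # x # (map snd X2 @ [y]) @ B"
        "lrun (A @ x # (map snd X2 @ [y]) @ m # B) X3 (zs @ ms)"
        by (rule lrun_passE)
      have d: "distinct (A @ x # (map snd X2 @ [y]) @ m # B)" using dS AB(1) by auto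
      have "(x, y) \<in> before (A @ x # (map snd X2 @ [y]) @ m # B)" by simp
      moreover have "high b (x, y)" using big[OF p(3)] big[OF q(3)] by (simp add: high_def)
      then have "(x, y) \<notin> set X3" using X unfolding X123 by auto
      ultimately have "(x, y) \<in> before (zs @ ms)" using lrun_before(3)[OF AB(2) d] by blast
      then have "(x, y) \<in> before zs" using p(3) q(3) big by fastforce
      then show ?thesis using p q True set_zs by (simp add: before_grid_cols)
    qed
  qed
qed

text \<open>Here no high crossing has happened yet, so each m meets the strands in the order of
  \<open>xs\<close>.\<close>

lemma normal_form_right:
  assumes v: "valid L" and L: "L = X @ P" and P: "\<forall>p\<in>set P. high b p"
    and X: "\<forall>p\<in>set X. \<not> high b p" and sorted: "sorted_wrt (\<lambda>p q. fst q \<le> fst p) X"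
  shows "X = grid_cols ms xs"
proof (rule distinct_eq_before)
  have setX: "set X = set ms \<times> set xs"
    using v _ P X by (rule cross_block_set) (auto simp: L)
  show "distinct X" using valid_distinct[OF v] L by simp
  show "set X = set (grid_cols ms xs)" using setX by simp
  show "distinct (grid_cols ms xs)"
    using lrun_before(1)[OF lrun_grid_cols[of ms xs "[]"]] distinct_start big by force
  show "before X \<subseteq> before (grid_cols ms xs)"
  proof (rule subrelI)
    fix p q assume pq: "(p, q) \<in> before X"
    then have "p \<in> set ms \<times> set xs" "q \<in> set ms \<times> set xs"
      using before_in_set[OF pq] setX by simp_all
    then obtain m x m' y where p: "p = (m, x)" "m \<in> set ms" "x \<in> set xs"
      and q: "q = (m', y)" "m' \<in> set ms" "y \<in> set xs" by auto
    have le: "m' \<le> m" using sorted_fst_before[OF sorted pq] p q by simp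
    show "(p, q) \<in> before (grid_cols ms xs)"
    proof (cases "m' = m")
      case False
      then show ?thesis using le p q by (simp add: before_grid_cols)
    next
      case True
      from pq obtain X1 X2 X3 where X123: "X = X1 @ p # X2 @ q # X3" by (rule before_split)
      from sorted[unfolded X123 p(1) q(1) True]
      have "(m, x) # X2 @ [(m, y)] = map (Pair m) (x # map snd X2 @ [y])"
        by (rule block_between)
      then have LL: "L = X1 @ map (Pair m) (x # map snd X2 @ [y]) @ X3 @ P"
        using L X123 p(1) q(1) True by simp
      note run = v[unfolded valid_def LL]
      from run obtain S where S: "lrun (ms @ xs) X1 S"
        "lrun S (map (Pair m) (x # map snd X2 @ [y]) @ X3 @ P) (zs @ ms)"
        by (rule lrun_appendE)
      have dS: "distinct S" using lrun_distinct[OF S(1) distinct_start] .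
      from S(2) dS obtain A B where AB: "S = A @ m # x # (map snd X2 @ [y]) @ B"
        by (rule lrun_passE)
      have "(x, y) \<in> before S" unfolding AB by simp
      moreover have "high b (y, x)" using big[OF p(3)] big[OF q(3)] by (simp add: high_def)
      then have "(y, x) \<notin> set X1" using X unfolding X123 by auto
      ultimately have "(x, y) \<in> before (ms @ xs)"
        using lrun_before(3)[OF S(1) distinct_start] by blast
      then have "(x, y) \<in> before xs" using p(3) q(3) big by fastforce
      then show ?thesis using p q True by (simp add: before_grid_cols)
    qed
  qed
qed

text \<open>\<open>P\<close> is the high prefix, \<open>X\<close> the following block without high
  labels, \<open>W\<close> the rest. Once \<open>X\<close> is sorted, the first label of
  \<open>W\<close> either commutes with the last label of \<open>X\<close> or forms a braid triple
  with the last two.\<close>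

lemma progress_left:
  assumes v: "valid L"
  shows "L = proj L @ grid_cols ms zs \<or>
    (\<exists>L'. (L, L') \<in> label_comm \<and> proj L' = proj L \<and> cT L = Suc (cT L') \<and> tT L' = tT L) \<or>
    (\<exists>L'. (L, L') \<in> label_braid \<and> proj L' = proj L \<and> cT L' = cT L \<and> tT L = Suc (tT L'))"
proof -
  define P where "P = takeWhile (high b) L"
  define X where "X = takeWhile (\<lambda>p. \<not> high b p) (dropWhile (high b) L)"
  define W where "W = dropWhile (\<lambda>p. \<not> high b p) (dropWhile (high b) L)"
  have L: "L = P @ X @ W" unfolding P_def X_def W_def by simp
  have P: "\<forall>p\<in>set P. high b p" unfolding P_def by (auto dest: set_takeWhileD)
  have X: "\<forall>p\<in>set X. \<not> high b p" unfolding X_def by (auto dest: set_takeWhileD)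
  show ?thesis
  proof (cases "sorted_wrt (\<lambda>p q. fst q \<le> fst p) X")
    case False
    with sort_block[OF v L X] show ?thesis by blast
  next
    case sorted: True
    show ?thesis
    proof (cases W)
      case Nil
      have "X = grid_cols ms zs" using v _ P X sorted by (rule normal_form_left) (simp add: L Nil)
      moreover have "proj L = P" unfolding L Nil proj_def using P X by (simp add: filter_id_conv)
      ultimately show ?thesis using L Nil by simp
    next
      case (Cons c R)
      have c: "high b c" using Cons unfolding W_def by (metis hd_dropWhile list.sel(1) list.distinct(1))
      have "X \<noteq> []"
      proof
        assume "X = []"
        then have "dropWhile (high b) L = c # R" using Cons L
          unfolding X_def W_def by (metis append_Nil takeWhile_dropWhile_id)
        then show False using c by (metis hd_dropWhile list.sel(1) list.distinct(1))
      qed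
      then obtain Y p where Y: "X = Y @ [p]" by (cases X rule: rev_cases) auto
      have LL: "L = (P @ Y) @ p # c # R" using L Y Cons by simp
      have p: "\<not> high b p" using X Y by simp
      show ?thesis
      proof (cases "disjoint_labels p c")
        case True
        from swap_high_left[OF v LL p c this] show ?thesis by blast
      next
        case False
        obtain m k where mk: "p = (m, k)" "1 \<le> m" "m \<le> b" "b < k" "k \<in> set xs"
          using v _ p by (rule not_high_label) (simp add: LL)
        obtain x y where xy: "c = (x, y)" by (cases c)
        have b: "b < x" "b < y" using c xy by (simp_all add: high_def)
        have k: "k = x \<or> k = y" using False mk(1,3) xy b by (auto simp: disjoint_labels_def)
        note run = v[unfolded valid_def LL mk(1) xy]
        from run obtain S where S: "lrun (ms @ xs) (P @ Y) S"
          "lrun S ((m, k) # (x, y) # R) (zs @ ms)" by (rule lrun_appendE)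
        have dS: "distinct S" using lrun_distinct[OF S(1) distinct_start] .
        from S(2) obtain A B where AB: "S = A @ m # k # B"
          "lrun (A @ k # m # B) ((x, y) # R) (zs @ ms)" by (rule lrun_ConsE)
        from AB(2) obtain A' B' where AB': "x < y" "A @ k # m # B = A' @ x # y # B'"
          by (rule lrun_ConsE)
        have d: "distinct (A @ k # m # B)" using dS AB(1) by auto
        \<comment> \<open>After (m, k) the right neighbour of k is m. If k were x, its right
          neighbour y would be m, which is too small; so k = y, and x stands left of both.\<close>
        have A: "A = A' @ [x] \<and> y = k"
          using AB'(2) d k mk(3) b by (cases rule: adjacent_pairs_cases) auto
        \<comment> \<open>Initially m is left of x, now x is left of m: they have crossed earlier.
          The label (m, x) is not high, so it lies in the block \<open>X\<close>.\<close>
        then have "(x, m) \<in> before S" unfolding AB(1) by simp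
        moreover have "x \<in> set xs"
        proof -
          have "(x, y) \<in> set L" using LL xy by simp
          with v show ?thesis by (rule label_cases) (use b in auto)
        qed
        then have "(m, x) \<in> before (ms @ xs)" using mk(2,3) by simp
        then have "(x, m) \<notin> before (ms @ xs)" using before_asym[OF distinct_start] by blast
        ultimately have "(m, x) \<in> set (P @ Y)"
          using lrun_before(3)[OF S(1) distinct_start] by blast
        moreover have "(m, x) \<notin> set P" using P mk(3) by (auto simp: high_def)
        ultimately have "(m, x) \<in> set Y" by simp
        then obtain Y1 Y2 where Y12: "Y = Y1 @ (m, x) # Y2" by (auto simp: in_set_conv_decomp)
        have X': "X = Y1 @ (m, x) # Y2 @ (m, y) # []" using Y Y12 mk(1) A by simp
        from sorted[unfolded this] have blk: "(m, x) # Y2 @ [(m, y)] =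
          map (Pair m) (x # map snd Y2 @ [y])" by (rule block_between)
        have "L = (P @ Y1) @ ((m, x) # Y2 @ [(m, y)]) @ (x, y) # R"
          using L X' Cons xy by simp
        note LL' = this[unfolded blk]
        from v[unfolded valid_def LL'] obtain S' where S': "lrun (ms @ xs) (P @ Y1) S'"
          "lrun S' (map (Pair m) (x # map snd Y2 @ [y]) @ (x, y) # R) (zs @ ms)"
          by (rule lrun_appendE)
        have dS': "distinct S'" using lrun_distinct[OF S'(1) distinct_start] .
        from S'(2) dS' obtain C D where CD: "S' = C @ m # x # (map snd Y2 @ [y]) @ D"
          "lrun (C @ x # (map snd Y2 @ [y]) @ m # D) ((x, y) # R) (zs @ ms)"
          by (rule lrun_passE)
        from CD(2) obtain C' D' where CD': "C @ x # (map snd Y2 @ [y]) @ m # D = C' @ x # y # D'"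
          by (rule lrun_ConsE)
        \<comment> \<open>\<open>m\<close> has passed x, the strands of \<open>Y2\<close> and y,
          standing in a row; the next label exchanges x and y as neighbours, so \<open>Y2\<close> is
          empty and a braid triple appears.\<close>
        have "x \<notin> set C" "x \<notin> set ((map snd Y2 @ [y]) @ m # D)" using dS' CD(1) by auto
        then have "(map snd Y2 @ [y]) @ m # D = y # D'"
          using CD' append_Cons_eq_iff by metis
        moreover have "distinct ((map snd Y2 @ [y]) @ m # D)" using dS' CD(1) by auto
        ultimately have "map snd Y2 = []" by (cases "map snd Y2") auto
        then have "Y2 = []" by simp
        then have "L = (P @ Y1) @ (m, x) # (m, y) # (x, y) # R" using L X' Cons xy by simp
        from braid_high_left[OF v this mk(3) b] AB'(1) show ?thesis by blast
      qed
    qed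
  qed
qed

text \<open>Mirror image of \<open>progress_left\<close>, scanned from the end: now m still has to
  pass x after the high label, and the sorted block forces this to happen directly after it passes
  y.\<close>

lemma progress_right:
  assumes v: "valid L"
  shows "L = grid_cols ms xs @ proj L \<or>
    (\<exists>L'. (L, L') \<in> label_comm \<and> proj L' = proj L \<and> cB L = Suc (cB L') \<and> tB L' = tB L) \<or>
    (\<exists>L'. (L, L') \<in> label_braid \<and> proj L' = proj L \<and> cB L' = cB L \<and> tB L = Suc (tB L'))"
proof -
  define P where "P = rev (takeWhile (high b) (rev L))"
  define X where "X = rev (takeWhile (\<lambda>p. \<not> high b p) (dropWhile (high b) (rev L)))"
  define W where "W = rev (dropWhile (\<lambda>p. \<not> high b p) (dropWhile (high b) (rev L)))"
  have "rev L = rev P @ rev X @ rev W" unfolding P_def X_def W_def by simp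
  then have "rev (rev L) = rev (rev P @ rev X @ rev W)" by (rule arg_cong)
  then have L: "L = W @ X @ P" by simp
  have P: "\<forall>p\<in>set P. high b p" unfolding P_def by (auto dest: set_takeWhileD)
  have X: "\<forall>p\<in>set X. \<not> high b p" unfolding X_def by (auto dest: set_takeWhileD)
  show ?thesis
  proof (cases "sorted_wrt (\<lambda>p q. fst q \<le> fst p) X")
    case False
    with sort_block[OF v L X] show ?thesis by blast
  next
    case sorted: True
    show ?thesis
    proof (cases W rule: rev_cases)
      case Nil
      have "X = grid_cols ms xs" using v _ P X sorted by (rule normal_form_right) (simp add: L Nil)
      moreover have "proj L = P" unfolding L Nil proj_def using P X by (simp add: filter_id_conv)
      ultimately show ?thesis using L Nil by simp
    next
      case (snoc R c)
      have rW: "dropWhile (\<lambda>p. \<not> high b p) (dropWhile (high b) (rev L)) = c # rev R"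
        using snoc unfolding W_def by (metis rev_rev_ident rev_append rev.simps append.simps)
      then have c: "high b c" by (metis hd_dropWhile list.sel(1) list.distinct(1))
      have "X \<noteq> []"
      proof
        assume "X = []"
        then have "dropWhile (high b) (rev L) = c # rev R" using rW
          unfolding X_def by (metis append_Nil takeWhile_dropWhile_id rev_is_Nil_conv)
        then show False using c by (metis hd_dropWhile list.sel(1) list.distinct(1))
      qed
      then obtain p Y where Y: "X = p # Y" by (cases X) auto
      have LL: "L = R @ c # p # Y @ P" using L Y snoc by simp
      have p: "\<not> high b p" using X Y by simp
      show ?thesis
      proof (cases "disjoint_labels c p")
        case True
        from swap_high_right[OF v LL p c this] show ?thesis by blast
      next
        case False
        obtain m k where mk: "p = (m, k)" "1 \<le> m" "m \<le> b" "b < k" "k \<in> set xs"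
          using v _ p by (rule not_high_label) (simp add: LL)
        obtain x y where xy: "c = (x, y)" by (cases c)
        have b: "b < x" "b < y" using c xy by (simp_all add: high_def)
        have k: "k = x \<or> k = y" using False mk(1,3) xy b by (auto simp: disjoint_labels_def)
        note run = v[unfolded valid_def LL mk(1) xy]
        from run obtain S where S: "lrun (ms @ xs) R S"
          "lrun S ((x, y) # (m, k) # Y @ P) (zs @ ms)" by (rule lrun_appendE)
        have dS: "distinct S" using lrun_distinct[OF S(1) distinct_start] .
        from S(2) obtain A B where AB: "x < y" "S = A @ x # y # B"
          "lrun (A @ y # x # B) ((m, k) # Y @ P) (zs @ ms)" by (rule lrun_ConsE)
        from AB(3) obtain A' B' where AB': "A @ y # x # B = A' @ m # k # B'"
          "lrun (A' @ k # m # B') (Y @ P) (zs @ ms)"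
          by (rule lrun_ConsE)
        have d: "distinct (A @ y # x # B)" using dS AB(2) by auto
        \<comment> \<open>After the high exchange y x are neighbours. The left neighbour of x is y,
          not m, so m can only exchange with y.\<close>
        have A: "A = A' @ [m] \<and> k = y \<and> B' = x # B"
          using AB'(1) d k mk(3) b by (cases rule: adjacent_pairs_cases) auto
        have d': "distinct (A' @ k # m # B')" using d unfolding AB'(1) by auto
        have x: "x \<in> set xs"
        proof -
          have "(x, y) \<in> set L" using LL xy by simp
          with v show ?thesis by (rule label_cases) (use b in auto)
        qed
        have "(m, x) \<in> before (A' @ k # m # B')" using A by simp
        moreover have "(m, x) \<notin> before (zs @ ms)"
        proof -
          have "(x, m) \<in> before (zs @ ms)" using x mk(2,3) set_zs by simp
          then show ?thesis using before_asym[OF distinct_end] by blast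
        qed
        ultimately have "(m, x) \<in> set (Y @ P)"
          using lrun_before(3)[OF AB'(2) d'] by blast
        moreover have "(m, x) \<notin> set P" using P mk(3) by (auto simp: high_def)
        ultimately have "(m, x) \<in> set Y" by simp
        then obtain Y1 Y2 where Y12: "Y = Y1 @ (m, x) # Y2" by (auto simp: in_set_conv_decomp)
        have X': "X = [] @ (m, y) # Y1 @ (m, x) # Y2" using Y Y12 mk(1) A by simp
        from sorted[unfolded this] have blk: "(m, y) # Y1 @ [(m, x)] =
          map (Pair m) (y # map snd Y1 @ [x])" by (rule block_between)
        have "L = R @ (x, y) # ((m, y) # Y1 @ [(m, x)]) @ Y2 @ P"
          using L X' snoc xy by simp
        note LL' = this[unfolded blk]
        from v[unfolded valid_def LL'] obtain S' where S': "lrun (ms @ xs) R S'"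
          "lrun S' ((x, y) # map (Pair m) (y # map snd Y1 @ [x]) @ Y2 @ P) (zs @ ms)"
          by (rule lrun_appendE)
        have dS': "distinct S'" using lrun_distinct[OF S'(1) distinct_start] .
        from S'(2) obtain C D where CD: "S' = C @ x # y # D"
          "lrun (C @ y # x # D) (map (Pair m) (y # map snd Y1 @ [x]) @ Y2 @ P) (zs @ ms)"
          by (rule lrun_ConsE)
        have dC: "distinct (C @ y # x # D)" using dS' CD(1) by auto
        from CD(2) dC obtain C' D' where CD': "C @ y # x # D = C' @ m # y # (map snd Y1 @ [x]) @ D'"
          by (rule lrun_passE)
        have "C @ y # (x # D) = (C' @ [m]) @ y # ((map snd Y1 @ [x]) @ D')" using CD' by simp
        moreover have "y \<notin> set C" "y \<notin> set (x # D)" using dC by auto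
        ultimately have eq: "x # D = (map snd Y1 @ [x]) @ D'"
          using append_Cons_eq_iff by metis
        have "distinct (x # D)" using dC by auto
        then have "distinct ((map snd Y1 @ [x]) @ D')" unfolding eq .
        then have "map snd Y1 = []" using eq by (cases "map snd Y1") auto
        then have "Y1 = []" by simp
        then have "L = R @ (x, y) # (m, y) # (m, x) # Y2 @ P" using L X' snoc xy by simp
        from braid_high_right[OF v this mk(3) b] AB(1) show ?thesis by blast
      qed
    qed
  qed
qed

text \<open>Every step of \<open>progress_left\<close> lowers the count of its own kind by one and
  keeps the other, so one walk satisfies both bounds.\<close>

lemma reach_left:
  "valid L \<Longrightarrow> \<exists>c t. c \<le> cT L \<and> t \<le> tT L \<and>
    gwalk label_comm label_braid c t L (proj L @ grid_cols ms zs)"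
proof (induction "cT L + tT L" arbitrary: L rule: less_induct)
  case less
  from progress_left[OF less.prems] show ?case
  proof (elim disjE exE conjE)
    assume "L = proj L @ grid_cols ms zs"
    then show ?thesis by (metis gwalk_refl le0)
  next
    fix L' assume *: "(L, L') \<in> label_comm" "proj L' = proj L" "cT L = Suc (cT L')" "tT L' = tT L"
    then obtain c t where "c \<le> cT L'" "t \<le> tT L'"
      "gwalk label_comm label_braid c t L' (proj L @ grid_cols ms zs)"
      using less.hyps[of L'] valid_comm[OF less.prems] by fastforce
    with * show ?thesis by (intro exI[of _ "Suc c"] exI[of _ t]) (auto intro: gwalk_left)
  next
    fix L' assume *: "(L, L') \<in> label_braid" "proj L' = proj L" "cT L' = cT L" "tT L = Suc (tT L')"
    then obtain c t where "c \<le> cT L'" "t \<le> tT L'"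
      "gwalk label_comm label_braid c t L' (proj L @ grid_cols ms zs)"
      using less.hyps[of L'] valid_braid[OF less.prems] by fastforce
    with * show ?thesis by (intro exI[of _ c] exI[of _ "Suc t"]) (auto intro: gwalk_right)
  qed
qed

lemma reach_right:
  "valid L \<Longrightarrow> \<exists>c t. c \<le> cB L \<and> t \<le> tB L \<and>
    gwalk label_comm label_braid c t L (grid_cols ms xs @ proj L)"
proof (induction "cB L + tB L" arbitrary: L rule: less_induct)
  case less
  from progress_right[OF less.prems] show ?case
  proof (elim disjE exE conjE)
    assume "L = grid_cols ms xs @ proj L"
    then show ?thesis by (metis gwalk_refl le0)
  next
    fix L' assume *: "(L, L') \<in> label_comm" "proj L' = proj L" "cB L = Suc (cB L')" "tB L' = tB L"
    then obtain c t where "c \<le> cB L'" "t \<le> tB L'"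
      "gwalk label_comm label_braid c t L' (grid_cols ms xs @ proj L)"
      using less.hyps[of L'] valid_comm[OF less.prems] by fastforce
    with * show ?thesis by (intro exI[of _ "Suc c"] exI[of _ t]) (auto intro: gwalk_left)
  next
    fix L' assume *: "(L, L') \<in> label_braid" "proj L' = proj L" "cB L' = cB L" "tB L = Suc (tB L')"
    then obtain c t where "c \<le> cB L'" "t \<le> tB L'"
      "gwalk label_comm label_braid c t L' (grid_cols ms xs @ proj L)"
      using less.hyps[of L'] valid_braid[OF less.prems] by fastforce
    with * show ?thesis by (intro exI[of _ c] exI[of _ "Suc t"]) (auto intro: gwalk_right)
  qed
qed

end

section \<open>Bounds on the number of moves\<close>

lemma label_comm_context: "(L, M) \<in> label_comm \<Longrightarrow> (A @ L @ B, A @ M @ B) \<in> label_comm"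
proof -
  assume "(L, M) \<in> label_comm"
  then obtain C p q D where *: "L = C @ p # q # D" "M = C @ q # p # D" "disjoint_labels p q"
    by (auto simp: label_comm_def)
  show ?thesis using label_commI[OF *(3), of "A @ C" "D @ B"] * by simp
qed

lemma label_braid_context:
  assumes "(L, M) \<in> label_braid"
  shows "(A @ L @ B, A @ M @ B) \<in> label_braid"
  using assms
proof cases
  case (label_braid_up C x y z D)
  then show ?thesis using label_braid.label_braid_up[of "A @ C" x y z "D @ B"] by simp
next
  case (label_braid_down C y z x D)
  then show ?thesis using label_braid.label_braid_down[of "A @ C" y z x "D @ B"] by simp
qed

text \<open>In a normal form the high labels fill a segment of their own, so a walk between
  projections can be performed there unchanged.\<close>

lemma gwalk_context:
  "gwalk label_comm label_braid c t L M \<Longrightarrow> gwalk label_comm label_braid c t (A @ L @ B) (A @ M @ B)"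
  by (induction rule: gwalk.induct)
    (auto intro: gwalk.intros label_comm_context label_braid_context)

lemma sym_label_comm: "sym label_comm"
proof (rule symI)
  fix L M assume "(L, M) \<in> label_comm"
  then obtain C p q D where *: "L = C @ p # q # D" "M = C @ q # p # D" "disjoint_labels p q"
    by (auto simp: label_comm_def)
  have "disjoint_labels q p" using *(3) disjoint_labels_sym by blast
  from label_commI[OF this] show "(M, L) \<in> label_comm" unfolding *(1,2) .
qed

lemma sym_label_braid: "sym label_braid"
  by (rule symI) (auto elim!: label_braid.cases intro: label_braid.intros)

section \<open>Sizes of the sets of couples, and the bounds from both sides\<close>

context inflated_run
begin

text \<open>A small m and a high label (x, y) determine the couple (m, x), (x, y): this is the
  origin of the term l b.\<close>

definition braid_set :: "(nat \<times> nat) list \<Rightarrow> ((nat \<times> nat) \<times> (nat \<times> nat)) set" where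
  "braid_set Q = (\<lambda>(m, q). ((m, fst q), q)) ` (set ms \<times> set Q)"

text \<open>Each high label leaves a - 2 strands k for a disjoint (m, k): this is the origin of l b
  (a - 2). The high label is chosen first because the range of k depends on it.\<close>

definition comm_set :: "(nat \<times> nat) list \<Rightarrow> ((nat \<times> nat) \<times> (nat \<times> nat)) set" where
  "comm_set Q = (\<lambda>(q, p). (p, q)) ` (SIGMA q:set Q. set ms \<times> (set xs - {fst q, snd q}))"

definition grid_set :: "((nat \<times> nat) \<times> (nat \<times> nat)) set" where
  "grid_set = (\<lambda>((m, m'), (x, y)). ((m, x), (m', y))) ` (before ms \<times> before xs)"

lemma length_ms: "length ms = b"
  by (simp add: ms_def del: upt_Suc)

lemma card_ms: "card (set ms) = b"
  using distinct_card[OF distinct_ms] length_ms by metis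

lemma lrun_xs_labels:
  assumes "lrun xs Q zs"
  shows "distinct Q" "q \<in> set Q \<Longrightarrow> fst q \<in> set xs \<and> snd q \<in> set xs \<and> fst q \<noteq> snd q \<and> high b q"
proof -
  show "distinct Q" using lrun_before(1)[OF assms distinct_xs] .
  assume q: "q \<in> set Q"
  have "(fst q, snd q) \<in> before xs" using lrun_before(2)[OF assms distinct_xs] q by auto
  from before_in_set[OF this] have "fst q \<in> set xs \<and> snd q \<in> set xs" .
  moreover have "fst q < snd q" using lrun_ascending[OF assms, of "fst q" "snd q"] q by simp
  ultimately show "fst q \<in> set xs \<and> snd q \<in> set xs \<and> fst q \<noteq> snd q \<and> high b q"
    using big by (simp add: high_def)
qed

lemma card_braid_set:
  assumes "lrun xs Q zs"
  shows "card (braid_set Q) = length Q * b"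
proof -
  have "inj_on (\<lambda>(m, q). ((m, fst q), q)) (set ms \<times> set Q)" by (auto intro: inj_onI)
  then have "card (braid_set Q) = card (set ms \<times> set Q)"
    unfolding braid_set_def by (rule card_image)
  then show ?thesis
    using lrun_xs_labels(1)[OF assms] by (simp add: card_cartesian_product card_ms distinct_card)
qed

lemma card_comm_set:
  assumes "lrun xs Q zs"
  shows "card (comm_set Q) = length Q * (b * (length xs - 2))"
proof -
  have "inj_on (\<lambda>(q, p). (p, q)) (SIGMA q:set Q. set ms \<times> (set xs - {fst q, snd q}))"
    by (auto intro: inj_onI)
  then have "card (comm_set Q) = card (SIGMA q:set Q. set ms \<times> (set xs - {fst q, snd q}))"
    unfolding comm_set_def by (rule card_image)
  also have "\<dots> = (\<Sum>q\<in>set Q. card (set ms \<times> (set xs - {fst q, snd q})))"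
    by (intro card_SigmaI) auto
  also have "\<dots> = (\<Sum>q\<in>set Q. b * (length xs - 2))"
  proof (rule sum.cong)
    fix q assume "q \<in> set Q"
    from lrun_xs_labels(2)[OF assms this]
    have "card (set xs - {fst q, snd q}) = length xs - 2"
      using distinct_card[OF distinct_xs] by (simp add: card_Diff_subset)
    then show "card (set ms \<times> (set xs - {fst q, snd q})) = b * (length xs - 2)"
      by (simp add: card_cartesian_product card_ms)
  qed simp
  also have "\<dots> = length Q * (b * (length xs - 2))"
    using distinct_card[OF lrun_xs_labels(1)[OF assms]] by simp
  finally show ?thesis .
qed

lemma card_grid_set: "card grid_set = (length xs choose 2) * (b choose 2)"
proof -
  have "inj_on (\<lambda>((m, m'), (x, y)). ((m, x), (m', y))) (before ms \<times> before xs)"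
    by (auto intro: inj_onI)
  then have "card grid_set = card (before ms \<times> before xs)"
    unfolding grid_set_def by (rule card_image)
  then show ?thesis
    by (simp add: card_cartesian_product card_before[OF distinct_ms] card_before[OF distinct_xs]
        length_ms)
qed

lemma valid_cross_snd:
  assumes "valid L" "p \<in> set L" "fst p \<le> b"
  shows "fst p \<in> set ms \<and> snd p \<in> set xs"
proof -
  have "\<not> high b p" using assms(3) by (simp add: high_def)
  with assms(1,2) obtain m k where "p = (m, k)" "1 \<le> m" "m \<le> b" "b < k" "k \<in> set xs"
    by (rule not_high_label)
  then show ?thesis by simp
qed

lemma sum_braid_le:
  assumes "valid L"
  shows "tT L + tB L \<le> length (proj L) * b"
proof -
  have mem: "(p, q) \<in> braid_set (proj L)"
    if "p \<in> set L" "q \<in> set L" "(p, q) \<in> braid_pairs b" for p q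
  proof -
    have "fst p \<in> set ms" using valid_cross_snd[OF assms that(1)] that(3) by (simp add: pairs_defs)
    moreover have "q \<in> set (proj L)" using that(2,3) by (simp add: proj_def braid_pairs_def)
    moreover have "p = (fst p, fst q)" using that(3) by (cases p) (simp add: braid_pairs_def)
    ultimately show ?thesis
      unfolding braid_set_def by (intro image_eqI[of _ _ "(fst p, q)"]) simp_all
  qed
  have "tT L + tB L \<le> card (braid_set (proj L))"
    by (rule count_pairs_converse[OF valid_distinct[OF assms]])
      (use before_in_set mem in \<open>fastforce simp: braid_set_def\<close>)+
  then show ?thesis using card_braid_set[OF valid_proj[OF assms]] by simp
qed

lemma sum_comm_le:
  assumes "valid L"
  shows "count_pairs (comm_pairs b) L + count_pairs ((comm_pairs b)\<inverse>) L
    \<le> length (proj L) * (b * (length xs - 2))"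
proof -
  have mem: "(p, q) \<in> comm_set (proj L)"
    if "p \<in> set L" "q \<in> set L" "(p, q) \<in> comm_pairs b" for p q
  proof -
    have "fst p \<in> set ms \<and> snd p \<in> set xs"
      using valid_cross_snd[OF assms that(1)] that(3) by (simp add: pairs_defs)
    moreover have "q \<in> set (proj L)" using that(2,3) by (simp add: proj_def comm_pairs_def)
    ultimately show ?thesis
      using that(3) unfolding comm_set_def
      by (intro image_eqI[of _ _ "(q, p)"]) (auto simp: comm_pairs_def mem_Times_iff)
  qed
  have fin: "finite (comm_set (proj L))"
    unfolding comm_set_def by (intro finite_imageI finite_SigmaI) auto
  have "count_pairs (comm_pairs b) L + count_pairs ((comm_pairs b)\<inverse>) L \<le> card (comm_set (proj L))"
    by (rule count_pairs_converse[OF valid_distinct[OF assms] fin])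
      (use before_in_set mem in fastforce)+
  then show ?thesis using card_comm_set[OF valid_proj[OF assms]] by simp
qed

text \<open>For \<open>x\<close>, \<open>y\<close> and \<open>m < m'\<close>, at most one of \<open>((m, x), (m', y))\<close> and \<open>((m, y), (m', x))\<close> can occur in
  order, since \<open>m'\<close> crosses each strand before \<open>m\<close> does.\<close>

lemma grid_count_le:
  assumes "valid L"
  shows "count_pairs (grid_pairs b) L \<le> (length xs choose 2) * (b choose 2)"
proof -
  let ?A = "before L \<inter> grid_pairs b"
  \<comment> \<open>Only the unordered pair of x and y is kept, encoded by its order in
    \<open>xs\<close>; by \<open>no_cross\<close> this loses no information.\<close>
  let ?f = "\<lambda>(p, q). ((fst p, fst q),
    if (snd p, snd q) \<in> before xs then (snd p, snd q) else (snd q, snd p))"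
  have A: "1 \<le> m \<and> m < m' \<and> m' \<le> b \<and> x \<in> set xs \<and> y \<in> set xs \<and> x \<noteq> y"
    if "((m, x), (m', y)) \<in> ?A" for m x m' y
  proof -
    have "((m, x), (m', y)) \<in> before L" using that by blast
    from before_in_set[OF this] have "(m, x) \<in> set L" "(m', y) \<in> set L" by blast+
    moreover have "m < m'" "m' \<le> b" "x \<noteq> y" using that by (auto simp: grid_pairs_def)
    ultimately show ?thesis
      using valid_cross_snd[OF assms, of "(m, x)"] valid_cross_snd[OF assms, of "(m', y)"] by simp
  qed
  have no_cross: False if 1: "((m, x), (m', y)) \<in> ?A" and 2: "((m, y), (m', x)) \<in> ?A" for m x m' y
  proof -
    note d = valid_distinct[OF assms]
    have "((m', y), (m, y)) \<in> before L" "((m', x), (m, x)) \<in> before L"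
      using A[OF 1] by (auto intro: cross_order[OF assms])
    then have "((m, x), (m, y)) \<in> before L" "((m, y), (m, x)) \<in> before L"
      using 1 2 before_trans[OF d] by blast+
    then show False using before_asym[OF d] by blast
  qed
  have "inj_on ?f ?A"
  proof (rule inj_onI)
    fix c d assume c: "c \<in> ?A" and d: "d \<in> ?A" and eq: "?f c = ?f d"
    obtain m x m' y where c': "c = ((m, x), (m', y))" by (metis prod.collapse)
    obtain n z n' w where d': "d = ((n, z), (n', w))" by (metis prod.collapse)
    have "n = m" "n' = m'" "(x, y) = (z, w) \<or> (x, y) = (w, z)"
      using eq unfolding c' d' by (auto split: if_splits)
    moreover have "(x, y) = (w, z) \<Longrightarrow> False"
      using no_cross[of m x m' y] c d calculation(1,2) unfolding c' d' by simp
    ultimately show "c = d" unfolding c' d' by blast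
  qed
  moreover have "?f ` ?A \<subseteq> before ms \<times> before xs"
  proof (rule image_subsetI)
    fix c assume c: "c \<in> ?A"
    obtain m x m' y where c': "c = ((m, x), (m', y))" by (metis prod.collapse)
    note * = A[OF c[unfolded c']]
    have "(x, y) \<in> before xs \<or> (y, x) \<in> before xs" using * by (intro before_total) auto
    then show "?f c \<in> before ms \<times> before xs" using * unfolding c' by auto
  qed
  moreover have "finite (before ms \<times> before xs)" by simp
  ultimately have "card ?A \<le> card (before ms \<times> before xs)" by (rule card_inj_on_le)
  also have "\<dots> = (length xs choose 2) * (b choose 2)"
    by (simp add: card_cartesian_product card_before[OF distinct_ms] card_before[OF distinct_xs]
        length_ms)
  finally show ?thesis unfolding count_pairs_def .
qed

lemma sum_comm_grid_le:
  assumes "valid L"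
  shows "cT L + cB L \<le>
    length (proj L) * (b * (length xs - 2)) + 2 * ((length xs choose 2) * (b choose 2))"
  using sum_comm_le[OF assms] grid_count_le[OF assms]
    count_pairs_Un_le[of "comm_pairs b" "grid_pairs b" L]
    count_pairs_Un_le[of "(comm_pairs b)\<inverse>" "grid_pairs b" L]
  by linarith

text \<open>Which route is cheaper depends on the weights, so only the sums over both routes are
  bounded, for each kind of move. For any weights one of the routes then costs at most half of the
  total.\<close>

lemma two_routes:
  assumes L: "valid L" "length (proj L) = l" and M: "valid M" "length (proj M) = l"
    and walk: "gwalk label_comm label_braid c t (proj L) (proj M)"
  obtains c1 t1 c2 t2 where
    "gwalk label_comm label_braid c1 t1 L M" "gwalk label_comm label_braid c2 t2 L M"
    "c1 + c2 \<le> 2 * (c + (l * (b * (length xs - 2)) + 2 * ((length xs choose 2) * (b choose 2))))"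
    "t1 + t2 \<le> 2 * (t + l * b)"
proof -
  let ?G = "grid_cols ms zs" and ?H = "grid_cols ms xs"
  define D where "D = l * (b * (length xs - 2))"
  define E where "E = (length xs choose 2) * (b choose 2)"
  note gsym = gwalk_sym[OF _ sym_label_comm sym_label_braid]
  obtain cl tl where l: "cl \<le> cT L" "tl \<le> tT L" "gwalk label_comm label_braid cl tl L (proj L @ ?G)"
    using reach_left[OF L(1)] by blast
  obtain cm tm where m: "cm \<le> cT M" "tm \<le> tT M" "gwalk label_comm label_braid cm tm M (proj M @ ?G)"
    using reach_left[OF M(1)] by blast
  obtain cl' tl' where l': "cl' \<le> cB L" "tl' \<le> tB L"
      "gwalk label_comm label_braid cl' tl' L (?H @ proj L)"
    using reach_right[OF L(1)] by blast
  obtain cm' tm' where m': "cm' \<le> cB M" "tm' \<le> tB M"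
      "gwalk label_comm label_braid cm' tm' M (?H @ proj M)"
    using reach_right[OF M(1)] by blast
  have "gwalk label_comm label_braid c t (proj L @ ?G) (proj M @ ?G)"
    using gwalk_context[OF walk, of "[]" ?G] by simp
  from gwalk_trans[OF gwalk_trans[OF l(3) this] gsym[OF m(3)]]
  have 1: "gwalk label_comm label_braid (cl + c + cm) (tl + t + tm) L M" .
  have "gwalk label_comm label_braid c t (?H @ proj L) (?H @ proj M)"
    using gwalk_context[OF walk, of ?H "[]"] by simp
  from gwalk_trans[OF gwalk_trans[OF l'(3) this] gsym[OF m'(3)]]
  have 2: "gwalk label_comm label_braid (cl' + c + cm') (tl' + t + tm') L M" .
  show thesis
  proof (rule that[OF 1 2])
    have "cl + cl' \<le> D + 2 * E" "cm + cm' \<le> D + 2 * E"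
      using sum_comm_grid_le[OF L(1)] sum_comm_grid_le[OF M(1)] l(1) m(1) l'(1) m'(1)
      unfolding L(2) M(2) D_def[symmetric] E_def[symmetric] by linarith+
    then show "cl + c + cm + (cl' + c + cm') \<le>
        2 * (c + (l * (b * (length xs - 2)) + 2 * ((length xs choose 2) * (b choose 2))))"
      unfolding D_def[symmetric] E_def[symmetric] by simp
    have "tl + tl' \<le> l * b" "tm + tm' \<le> l * b"
      using sum_braid_le[OF L(1)] sum_braid_le[OF M(1)] l(2) m(2) l'(2) m'(2)
      unfolding L(2) M(2) by linarith+
    then show "tl + t + tm + (tl' + t + tm') \<le> 2 * (t + l * b)" by simp
  qed
qed

text \<open>The labels of a couple in \<open>braid_pairs\<close> share a value, so no commutation
  reverses it. A swap of two high labels is seen by the projection and reverses no counted couple;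
  every other swap is unseen.\<close>

lemma step_comm:
  assumes v: "valid L" and step: "(L, M) \<in> label_comm"
  shows "((proj L, proj M) \<in> label_comm \<and> cT M = cT L \<and> tT M = tT L) \<or>
    (proj M = proj L \<and> cT M \<le> Suc (cT L) \<and> tT M = tT L)"
proof -
  obtain A p q B where L: "L = A @ p # q # B" and M: "M = A @ q # p # B" and d: "disjoint_labels p q"
    using step by (auto simp: label_comm_def)
  have dist: "distinct (A @ p # q # B)" using valid_distinct[OF v] L by simp
  have t: "tT M = tT L" unfolding L M using d
    by (intro count_pairs_swap_same[OF dist]; auto simp: pairs_defs disjoint_labels_def)
  show ?thesis
  proof (cases "high b p \<and> high b q")
    case True
    have "(proj L, proj M) \<in> label_comm"
      unfolding L M proj_def using True label_commI[OF d] by simp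
    moreover have "cT M = cT L" unfolding L M using True
      by (intro count_pairs_swap_same[OF dist]; auto simp: pairs_defs)
    ultimately show ?thesis using t by blast
  next
    case False
    then have "proj M = proj L" unfolding L M proj_def by auto
    moreover have "cT M \<le> Suc (cT L)" unfolding L M by (rule count_pairs_swap_le[OF dist])
    ultimately show ?thesis using t by blast
  qed
qed

text \<open>On strands x < y < z with x small, y is large because small values never cross. The move
  is then unseen and reverses the single counted couple (x, y), (y, z). With x large all three
  labels are high.\<close>

lemma step_braid:
  assumes v: "valid L" and step: "(L, M) \<in> label_braid"
  shows "((proj L, proj M) \<in> label_braid \<and> cT M = cT L \<and> tT M = tT L) \<or>
    (proj M = proj L \<and> cT M = cT L \<and> tT M \<le> Suc (tT L))"
proof -
  have vM: "valid M" using valid_braid[OF v step] .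
  \<comment> \<open>Stated for arbitrary \<open>K\<close> and \<open>N\<close>, so that the two
    directions of the move are both instances.\<close>
  have main: "(b < x \<longrightarrow> proj K = proj A @ (x, y) # (x, z) # (y, z) # proj B \<and>
      proj N = proj A @ (y, z) # (x, z) # (x, y) # proj B \<and> cT N = cT K \<and> tT N = tT K) \<and>
    (\<not> b < x \<longrightarrow> proj N = proj K \<and> cT N = cT K \<and> tT K = Suc (tT N))"
    if K: "K = A @ (x, y) # (x, z) # (y, z) # B" and N: "N = A @ (y, z) # (x, z) # (x, y) # B"
      and vK: "valid K" for K N A B x y z
  proof -
    have dist: "distinct (A @ (x, y) # (x, z) # (y, z) # B)" using valid_distinct[OF vK] K by simp
    have "lrun (ms @ xs) K (zs @ ms)" using vK by (simp add: valid_def)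
    note asc = lrun_ascending[OF this]
    have less: "x < y" "y < z" using asc[of x y] asc[of y z] K by simp_all
    have b_y: "b < y" using small_not_label[OF vK, of x y] K by fastforce
    show ?thesis
    proof (intro conjI impI)
      assume "b < x"
      then show "proj K = proj A @ (x, y) # (x, z) # (y, z) # proj B"
        "proj N = proj A @ (y, z) # (x, z) # (x, y) # proj B"
        unfolding K N proj_def using less by (simp_all add: high_def)
      show "cT N = cT K" unfolding K N using \<open>b < x\<close> less
        by (intro count_pairs_rev3_same[OF dist]; auto simp: pairs_defs)
      show "tT N = tT K" unfolding K N using \<open>b < x\<close> less
        by (intro count_pairs_rev3_same[OF dist]; auto simp: pairs_defs)
    next
      assume x: "\<not> b < x"
      show "proj N = proj K" unfolding K N proj_def using x by (simp add: high_def)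
      show "cT N = cT K" unfolding K N using x less b_y
        by (intro count_pairs_rev3_same[OF dist]; auto simp: pairs_defs)
      show "tT K = Suc (tT N)" unfolding K N using x less b_y
        by (intro count_pairs_rev3[OF dist]; auto simp: pairs_defs)
    qed
  qed
  from step show ?thesis
  proof cases
    case (label_braid_up A x y z B)
    from main[OF this v] show ?thesis
      using label_braid.label_braid_up[of "proj A" x y z "proj B"] by (cases "b < x") auto
  next
    case (label_braid_down A y z x B)
    from main[OF label_braid_down(2,1) vM] show ?thesis
      using label_braid.label_braid_down[of "proj A" y z x "proj B"] by (cases "b < x") auto
  qed
qed

text \<open>Each move either is a move of the projection or raises only the count of its own kind,
  by at most one. Summing this along the walk bounds the number of moves of each kind; the additive
  form avoids truncated subtraction.\<close>

lemma walk_proj: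
  "gwalk label_comm label_braid c t L M \<Longrightarrow> valid L \<Longrightarrow>
    \<exists>c0 t0. gwalk label_comm label_braid c0 t0 (proj L) (proj M) \<and>
      cT M + c0 \<le> cT L + c \<and> tT M + t0 \<le> tT L + t"
proof (induction rule: gwalk.induct)
  case (gwalk_refl L)
  show ?case by (intro exI[of _ 0]) (simp add: gwalk.gwalk_refl)
next
  case (gwalk_left L K c t M)
  then obtain c0 t0 where IH: "gwalk label_comm label_braid c0 t0 (proj K) (proj M)"
      "cT M + c0 \<le> cT K + c" "tT M + t0 \<le> tT K + t"
    using valid_comm by blast
  from step_comm[OF gwalk_left.prems gwalk_left.hyps(1)] show ?case
  proof (elim disjE conjE)
    assume *: "(proj L, proj K) \<in> label_comm" "cT K = cT L" "tT K = tT L"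
    from gwalk.gwalk_left[OF *(1) IH(1)] show ?thesis
      using IH(2,3) *(2,3) by (intro exI[of _ "Suc c0"] exI[of _ t0]) simp
  next
    assume "proj K = proj L" "cT K \<le> Suc (cT L)" "tT K = tT L"
    then show ?thesis using IH by (intro exI[of _ c0] exI[of _ t0]) simp
  qed
next
  case (gwalk_right L K c t M)
  then obtain c0 t0 where IH: "gwalk label_comm label_braid c0 t0 (proj K) (proj M)"
      "cT M + c0 \<le> cT K + c" "tT M + t0 \<le> tT K + t"
    using valid_braid by blast
  from step_braid[OF gwalk_right.prems gwalk_right.hyps(1)] show ?case
  proof (elim disjE conjE)
    assume *: "(proj L, proj K) \<in> label_braid" "cT K = cT L" "tT K = tT L"
    from gwalk.gwalk_right[OF *(1) IH(1)] show ?thesis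
      using IH(2,3) *(2,3) by (intro exI[of _ c0] exI[of _ "Suc t0"]) simp
  next
    assume "proj K = proj L" "cT K = cT L" "tT K \<le> Suc (tT L)"
    then show ?thesis using IH by (intro exI[of _ c0] exI[of _ t0]) simp
  qed
qed

lemma ms_less_xs: "\<forall>m\<in>set ms. \<forall>x\<in>set xs. m < x"
  using big by fastforce

text \<open>One end for the lower bound: all high labels come first and the rest is sorted, so
  nothing is counted.\<close>

lemma left_end:
  assumes "lrun xs P zs"
  defines "L \<equiv> P @ grid_cols ms zs"
  shows "valid L" "proj L = P" "cT L = 0" "tT L = 0"
proof -
  have high: "high b p" if "p \<in> set P" for p using lrun_xs_labels(2)[OF assms(1) that] by blast
  have low: "\<not> high b p" if "p \<in> set (grid_cols ms zs)" for p
    using that by (auto simp: high_def)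
  have "lrun (ms @ xs) P (ms @ zs)" using lrun_context[OF assms(1), of ms "[]"] by simp
  moreover have "lrun (ms @ zs) (grid_cols ms zs) (zs @ ms)"
    using lrun_grid_cols[of ms zs "[]"] ms_less_xs set_zs by simp
  ultimately show "valid L" unfolding valid_def L_def by (rule lrun_appendI)
  show "proj L = P" unfolding L_def proj_def
    using high low by (simp add: filter_id_conv filter_empty_conv del: set_grid_cols)
  have cases: "high b p \<or> \<not> high b q \<and> fst q \<le> fst p" if "(p, q) \<in> before L" for p q
  proof -
    from that consider "p \<in> set P" | "(p, q) \<in> before (grid_cols ms zs)"
      unfolding L_def before_append using before_in_set[of p q P] by blast
    then show ?thesis
    proof cases
      case 1
      then show ?thesis using high by blast
    next
      case 2
      from before_in_set[OF this] have "\<not> high b q" using low by blast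
      moreover have "((fst p, snd p), (fst q, snd q)) \<in> before (grid_cols ms zs)" using 2 by simp
      then have "fst q \<le> fst p" unfolding before_grid_cols before_ms by linarith
      ultimately show ?thesis by blast
    qed
  qed
  have "(p, q) \<notin> comm_pairs b \<and> (p, q) \<notin> grid_pairs b \<and> (p, q) \<notin> braid_pairs b"
    if "(p, q) \<in> before L" for p q
    using cases[OF that] by (auto simp: pairs_defs)
  then have "before L \<inter> (comm_pairs b \<union> grid_pairs b) = {}" "before L \<inter> braid_pairs b = {}"
    by fast+
  then show "cT L = 0" "tT L = 0" by (simp_all add: count_pairs_def)
qed

text \<open>The opposite end. Taking \<open>grid_rows\<close> instead of \<open>grid_cols\<close>
  makes every element of \<open>grid_set\<close> occur, which adds the product of binomials to the
  lower bound.\<close>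

lemma right_end:
  assumes "lrun xs Q zs"
  defines "M \<equiv> grid_rows ms xs @ Q"
  shows "valid M" "proj M = Q"
    "cT M \<ge> length Q * (b * (length xs - 2)) + (length xs choose 2) * (b choose 2)"
    "tT M \<ge> length Q * b"
proof -
  have high: "high b p" if "p \<in> set Q" for p using lrun_xs_labels(2)[OF assms(1) that] by blast
  have low: "\<not> high b p" if "p \<in> set (grid_rows ms xs)" for p
    using that by (auto simp: high_def)
  have "lrun (xs @ ms) Q (zs @ ms)" using lrun_context[OF assms(1), of "[]" ms] by simp
  moreover have "lrun (ms @ xs) (grid_rows ms xs) (xs @ ms)"
    using lrun_grid_rows[of ms xs "[]"] ms_less_xs by simp
  ultimately show "valid M" unfolding valid_def M_def by (blast intro: lrun_appendI)
  show "proj M = Q" unfolding M_def proj_def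
    using high low by (simp add: filter_id_conv filter_empty_conv del: set_grid_rows)
  have "braid_set Q \<subseteq> before M \<inter> braid_pairs b"
  proof
    fix c assume "c \<in> braid_set Q"
    then obtain m q where c: "c = ((m, fst q), q)" "m \<in> set ms" "q \<in> set Q"
      unfolding braid_set_def by auto
    note q = lrun_xs_labels(2)[OF assms(1) c(3)]
    have "(m, fst q) \<in> set (grid_rows ms xs)" using c(2) q by simp
    then have "c \<in> before M" unfolding M_def before_append c(1) using c(3) by blast
    moreover have "c \<in> braid_pairs b" using c q by (simp add: braid_pairs_def)
    ultimately show "c \<in> before M \<inter> braid_pairs b" by blast
  qed
  then have "card (braid_set Q) \<le> tT M" unfolding count_pairs_def by (intro card_mono) simp_all
  then show "tT M \<ge> length Q * b" using card_braid_set[OF assms(1)] by simp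
  have comm: "comm_set Q \<subseteq> before M \<inter> comm_pairs b"
  proof
    fix c assume "c \<in> comm_set Q"
    then obtain s where s: "c = (case s of (q, p) \<Rightarrow> (p, q))"
        "s \<in> (SIGMA q:set Q. set ms \<times> (set xs - {fst q, snd q}))"
      unfolding comm_set_def by (rule imageE)
    obtain q p where qp: "s = (q, p)" by (cases s)
    have pq: "c = (p, q)" "q \<in> set Q" "p \<in> set ms \<times> (set xs - {fst q, snd q})"
      using s unfolding qp mem_Sigma_iff by simp_all
    from pq(3) obtain m k where "p = (m, k)" "m \<in> set ms" "k \<in> set xs" "k \<noteq> fst q" "k \<noteq> snd q"
      by blast
    with pq have c: "c = ((m, k), q)" "m \<in> set ms" "q \<in> set Q" "k \<in> set xs"
        "k \<noteq> fst q" "k \<noteq> snd q" by blast+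
    note q = lrun_xs_labels(2)[OF assms(1) c(3)]
    have "(m, k) \<in> set (grid_rows ms xs)" using c(2,4) by simp
    then have "c \<in> before M" unfolding M_def before_append c(1) using c(3) by blast
    moreover have "c \<in> comm_pairs b" using c q by (simp add: comm_pairs_def)
    ultimately show "c \<in> before M \<inter> comm_pairs b" by blast
  qed
  have grid: "grid_set \<subseteq> before M \<inter> grid_pairs b"
  proof
    fix c assume "c \<in> grid_set"
    then obtain m m' x y where c: "c = ((m, x), (m', y))" "(m, m') \<in> before ms" "(x, y) \<in> before xs"
      unfolding grid_set_def by auto
    have xy: "x \<in> set xs" "y \<in> set xs" "x \<noteq> y"
      using before_in_set[OF c(3)] before_irrefl[OF distinct_xs] c(3) by auto
    have "c \<in> before (grid_rows ms xs)"
      unfolding c(1) before_grid_rows using c(2,3) by simp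
    then have "c \<in> before M" unfolding M_def by simp
    moreover have "c \<in> grid_pairs b" using c(1,2) xy big by (simp add: grid_pairs_def)
    ultimately show "c \<in> before M \<inter> grid_pairs b" by blast
  qed
  have "comm_set Q \<inter> grid_set = {}"
    using comm grid by (fastforce simp: comm_pairs_def grid_pairs_def high_def)
  moreover have fin: "finite (comm_set Q)" "finite grid_set"
    using comm grid finite_subset[OF _ finite_Int] finite_before by blast+
  ultimately have "card (comm_set Q) + card grid_set = card (comm_set Q \<union> grid_set)"
    by (simp add: card_Un_disjoint)
  also have "\<dots> \<le> cT M"
    unfolding count_pairs_def using comm grid by (intro card_mono) auto
  finally show "cT M \<ge> length Q * (b * (length xs - 2)) + (length xs choose 2) * (b choose 2)"
    using card_comm_set[OF assms(1)] card_grid_set by simp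
qed

end

section \<open>Distances in the inflated graph\<close>

definition word_dist :: "nat \<Rightarrow> nat \<Rightarrow> nat list set \<Rightarrow> nat list \<Rightarrow> nat list \<Rightarrow> ereal" where
  "word_dist i j R = walk_dist i j (comm_move \<inter> R \<times> R) (braid_move \<inter> R \<times> R)"

context inflated_run
begin

lemma valid_iff_run: "valid L \<longleftrightarrow> (\<exists>w. run (ms @ xs) w L (zs @ ms))"
  by (simp add: valid_def lrun_def)

lemma proj_word:
  assumes "run (ms @ xs) u L (zs @ ms)"
  obtains w where "run xs w (proj L) zs" "w \<in> run_words xs zs"
  using assms valid_iff_run valid_proj unfolding lrun_def run_words_def by blast

lemma word_dist_le:
  assumes len: "\<And>w. w \<in> run_words xs zs \<Longrightarrow> length w = l"
    and u: "u \<in> run_words (ms @ xs) (zs @ ms)" and v: "v \<in> run_words (ms @ xs) (zs @ ms)"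
  shows "\<exists>u'\<in>run_words xs zs. \<exists>v'\<in>run_words xs zs.
    word_dist i j (run_words (ms @ xs) (zs @ ms)) u v \<le> word_dist i j (run_words xs zs) u' v' +
      ereal (real (i * (l * (b * (length xs - 2)) + 2 * ((length xs choose 2) * (b choose 2)))
        + j * (l * b)))"
proof -
  let ?R = "run_words xs zs" and ?R' = "run_words (ms @ xs) (zs @ ms)"
  define D where "D = l * (b * (length xs - 2)) + 2 * ((length xs choose 2) * (b choose 2))"
  obtain L where L: "run (ms @ xs) u L (zs @ ms)" using u by (auto simp: run_words_def)
  obtain M where M: "run (ms @ xs) v M (zs @ ms)" using v by (auto simp: run_words_def)
  have vL: "valid L" "valid M" using L M valid_iff_run by blast+
  obtain u' where u': "run xs u' (proj L) zs" "u' \<in> ?R" using L by (rule proj_word)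
  obtain v' where v': "run xs v' (proj M) zs" "v' \<in> ?R" using M by (rule proj_word)
  have lens: "length (proj L) = l" "length (proj M) = l"
    using run_length[OF u'(1)] run_length[OF v'(1)] len u'(2) v'(2) by simp_all
  have lift: "word_dist i j ?R' u v \<le> ereal (real (i * c + j * t))"
    if walk: "gwalk label_comm label_braid c t L M" for c t
  proof -
    obtain w where w: "run (ms @ xs) w M (zs @ ms)"
        "gwalk (comm_move \<inter> ?R' \<times> ?R') (braid_move \<inter> ?R' \<times> ?R') c t u w"
      using label_walk_word_walk[OF walk L distinct_start] by blast
    have "w = v" using run_word_unique[OF w(1) M distinct_start] by simp
    with w(2) have "gwalk (comm_move \<inter> ?R' \<times> ?R') (braid_move \<inter> ?R' \<times> ?R') c t u v" by simp
    then show ?thesis unfolding word_dist_def by (rule walk_dist_le)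
  qed
  have "word_dist i j ?R' u v \<le> word_dist i j ?R u' v' + ereal (real (i * D + j * (l * b)))"
  \<comment> \<open>An infinite distance of the projections makes the bound trivial; otherwise a
    shortest walk exists and is lifted.\<close>
  proof (cases "word_dist i j ?R u' v' = \<infinity>")
    case True
    then show ?thesis by simp
  next
    case False
    then obtain c t where ct:
        "gwalk (comm_move \<inter> ?R \<times> ?R) (braid_move \<inter> ?R \<times> ?R) c t u' v'"
        "word_dist i j ?R u' v' = ereal (real (i * c + j * t))"
      unfolding word_dist_def by (rule walk_dist_attained)
    obtain N where N: "run xs v' N zs" "gwalk label_comm label_braid c t (proj L) N"
      using word_walk_label_walk[OF ct(1) u'(1) distinct_xs] by blast
    have "N = proj M" using run_label_unique[OF N(1) v'(1)] by simp
    with N(2) have "gwalk label_comm label_braid c t (proj L) (proj M)" by simp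
    with vL(1) lens(1) vL(2) lens(2) obtain c1 t1 c2 t2 where
      r: "gwalk label_comm label_braid c1 t1 L M" "gwalk label_comm label_braid c2 t2 L M"
        "c1 + c2 \<le> 2 * (c + D)" "t1 + t2 \<le> 2 * (t + l * b)"
      unfolding D_def by (rule two_routes)
    \<comment> \<open>Half of the weighted bound on the sum of the two routes, so the cheaper route
      costs at most \<open>B\<close>.\<close>
    define B where "B = i * (c + D) + j * (t + l * b)"
    have "(i * c1 + j * t1) + (i * c2 + j * t2) \<le> 2 * B"
    proof -
      have "i * (c1 + c2) + j * (t1 + t2) \<le> i * (2 * (c + D)) + j * (2 * (t + l * b))"
        using r(3,4) by (intro add_mono mult_le_mono2)
      then show ?thesis by (simp add: B_def algebra_simps)
    qed
    then have "i * c1 + j * t1 \<le> B \<or> i * c2 + j * t2 \<le> B" by linarith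
    then have "word_dist i j ?R' u v \<le> ereal (real B)"
      using lift[OF r(1)] lift[OF r(2)] by (metis ereal_less_eq(3) of_nat_le_iff order_trans)
    also have "ereal (real B) = word_dist i j ?R u' v' + ereal (real (i * D + j * (l * b)))"
      unfolding ct(2) B_def by (simp add: algebra_simps)
    finally show ?thesis .
  qed
  then show ?thesis using u'(2) v'(2) unfolding D_def by blast
qed

text \<open>The given words prescribe only the projections. The witnesses place the high labels
  before the grid at one end and after it at the other, so a walk between them must reverse all
  counted couples in addition to projecting to a walk between the given words.\<close>

lemma word_dist_ge:
  assumes len: "\<And>w. w \<in> run_words xs zs \<Longrightarrow> length w = l"
    and u: "u \<in> run_words xs zs" and v: "v \<in> run_words xs zs"
  shows "\<exists>u'\<in>run_words (ms @ xs) (zs @ ms). \<exists>v'\<in>run_words (ms @ xs) (zs @ ms).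
    word_dist i j (run_words xs zs) u v +
      ereal (real (i * (l * (b * (length xs - 2)) + (length xs choose 2) * (b choose 2))
        + j * (l * b))) \<le> word_dist i j (run_words (ms @ xs) (zs @ ms)) u' v'"
proof -
  let ?R = "run_words xs zs" and ?R' = "run_words (ms @ xs) (zs @ ms)"
  define D where "D = l * (b * (length xs - 2)) + (length xs choose 2) * (b choose 2)"
  obtain P where P: "run xs u P zs" using u by (auto simp: run_words_def)
  obtain Q where Q: "run xs v Q zs" using v by (auto simp: run_words_def)
  have lP: "lrun xs P zs" "lrun xs Q zs" using P Q by (auto simp: lrun_def)
  have lenQ: "length Q = l" using run_length[OF Q] len[OF v] by simp
  let ?L = "P @ grid_cols ms zs" and ?M = "grid_rows ms xs @ Q"
  note L = left_end[OF lP(1)] and M = right_end[OF lP(2)]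
  obtain u' where u': "run (ms @ xs) u' ?L (zs @ ms)" using L(1) valid_iff_run by blast
  obtain v' where v': "run (ms @ xs) v' ?M (zs @ ms)" using M(1) valid_iff_run by blast
  have "word_dist i j ?R u v + ereal (real (i * D + j * (l * b))) \<le> word_dist i j ?R' u' v'"
    unfolding word_dist_def[of i j ?R']
  proof (rule le_walk_dist)
    fix c t assume "gwalk (comm_move \<inter> ?R' \<times> ?R') (braid_move \<inter> ?R' \<times> ?R') c t u' v'"
    from word_walk_label_walk[OF this u' distinct_start] obtain N where
      N: "run (ms @ xs) v' N (zs @ ms)" "gwalk label_comm label_braid c t ?L N" by blast
    have "N = ?M" using run_label_unique[OF N(1) v'] by simp
    with N(2) have "gwalk label_comm label_braid c t ?L ?M" by simp
    from walk_proj[OF this L(1)] obtain c0 t0 where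
      ct: "gwalk label_comm label_braid c0 t0 P Q" "cT ?M + c0 \<le> c" "tT ?M + t0 \<le> t"
      unfolding L(2) M(2) L(3,4) by auto
    have c: "c0 + D \<le> c" and t: "t0 + l * b \<le> t"
      using ct(2,3) M(3,4) unfolding lenQ D_def by linarith+
    obtain w where w: "run xs w Q zs"
        "gwalk (comm_move \<inter> ?R \<times> ?R) (braid_move \<inter> ?R \<times> ?R) c0 t0 u w"
      using label_walk_word_walk[OF ct(1) P distinct_xs] by blast
    have "w = v" using run_word_unique[OF w(1) Q distinct_xs] by simp
    with w(2) have "gwalk (comm_move \<inter> ?R \<times> ?R) (braid_move \<inter> ?R \<times> ?R) c0 t0 u v" by simp
    then have "word_dist i j ?R u v \<le> ereal (real (i * c0 + j * t0))"
      unfolding word_dist_def by (rule walk_dist_le)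
    then have "word_dist i j ?R u v + ereal (real (i * D + j * (l * b)))
        \<le> ereal (real (i * c0 + j * t0)) + ereal (real (i * D + j * (l * b)))"
      by (rule add_right_mono)
    also have "\<dots> = ereal (real (i * (c0 + D) + j * (t0 + l * b)))"
      by (simp add: algebra_simps)
    also have "\<dots> \<le> ereal (real (i * c + j * t))"
    proof -
      have "i * (c0 + D) + j * (t0 + l * b) \<le> i * c + j * t"
        using c t by (intro add_mono mult_le_mono2)
      then show ?thesis by (simp only: ereal_less_eq of_nat_le_iff)
    qed
    finally show "word_dist i j ?R u v + ereal (real (i * D + j * (l * b)))
      \<le> ereal (real (i * c + j * t))" .
  qed
  moreover have "u' \<in> ?R'" "v' \<in> ?R'" using u' v' by (auto simp: run_words_def)
  ultimately show ?thesis unfolding D_def by blast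
qed

end

section \<open>From distances to diameters, and the three weightings\<close>

lemma move_diam_word_dist:
  "move_diam i j n p = (SUP (u, v) \<in> reduced_words n p \<times> reduced_words n p.
     word_dist i j (reduced_words n p) u v)"
  unfolding move_diam_def word_dist_def comm_edges_def braid_edges_def ..

lemma move_diam_inflation:
  fixes \<alpha> :: "nat \<Rightarrow> nat" and a b i j :: nat
  assumes \<alpha>: "\<alpha> permutes {1..a}"
  defines "l \<equiv> perm_length a \<alpha>" and "\<pi> \<equiv> inflation21 a b \<alpha> id"
  shows "move_diam i j a \<alpha> + ereal (real (i * (l * (b * (a - 2)) + (a choose 2) * (b choose 2))
      + j * (l * b))) \<le> move_diam i j (a + b) \<pi>"
    and "move_diam i j (a + b) \<pi> \<le> move_diam i j a \<alpha> +
      ereal (real (i * (l * (b * (a - 2)) + 2 * ((a choose 2) * (b choose 2))) + j * (l * b)))"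
proof -
  let ?xs = "[Suc b..<Suc (a + b)]" and ?zs = "map (\<lambda>i. \<alpha> i + b) [1..<Suc a]"
  have set_zs: "set ?zs = set ?xs"
  proof -
    have "set ?zs = (\<lambda>x. x + b) ` \<alpha> ` {1..a}"
      by (simp add: image_image atLeastLessThanSuc_atLeastAtMost del: upt_Suc)
    also have "\<dots> = (\<lambda>x. x + b) ` {1..a}" unfolding permutes_image[OF \<alpha>] ..
    also have "\<dots> = {Suc b..a + b}" by (simp add: image_add_atLeastAtMost' add.commute)
    finally show ?thesis by (simp add: atLeastLessThanSuc_atLeastAtMost del: upt_Suc)
  qed
  have "inj_on (\<lambda>i. \<alpha> i + b) (set [1..<Suc a])"
  proof (rule inj_onI)
    fix i j assume "\<alpha> i + b = \<alpha> j + b"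
    then have "\<alpha> i = \<alpha> j" by simp
    then show "i = j" by (rule injD[OF permutes_inj[OF \<alpha>]])
  qed
  then have distinct_zs: "distinct ?zs"
    unfolding distinct_map using distinct_upt by blast
  have big: "b < x" if "x \<in> set ?xs" for x
    using that unfolding set_upt by simp
  \<comment> \<open>With these lists the start is 1, ..., a + b and the end is the one-line notation
    of \<pi>.\<close>
  interpret inflated_run b ?xs ?zs
    by (rule inflated_run.intro[OF distinct_upt distinct_zs set_zs big])
  let ?R = "reduced_words a \<alpha>" and ?R' = "reduced_words (a + b) \<pi>"
  have R: "run_words ?xs ?zs = ?R" using reduced_words_shift[OF \<alpha>] by simp
  have start: "ms @ ?xs = [1..<Suc (a + b)]"
    using upt_add_eq_append[of 1 "Suc b" a] unfolding ms_def by (simp add: add.commute del: upt_Suc)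
  have fin: "?zs @ ms = map \<pi> [1..<Suc (a + b)]"
    unfolding \<pi>_def inflation21_one_line ms_def ..
  have R': "run_words (ms @ ?xs) (?zs @ ms) = ?R'"
    unfolding start fin run_words_def
    using reduced_words_iff_run[OF inflation21_permutes[OF \<alpha>]] unfolding \<pi>_def by blast
  have len: "length w = l" if "w \<in> run_words ?xs ?zs" for w
    using that unfolding R l_def reduced_words_def by simp
  have n: "length ?xs = a" by (simp del: upt_Suc)
  let ?U = "ereal (real (i * (l * (b * (a - 2)) + 2 * ((a choose 2) * (b choose 2))) + j * (l * b)))"
  have le: "\<exists>u'\<in>?R. \<exists>v'\<in>?R. word_dist i j ?R' u v \<le> word_dist i j ?R u' v' + ?U"
    if "u \<in> ?R'" "v \<in> ?R'" for u v
    by (rule word_dist_le[of l u v i j, unfolded R R' n]) (use len[unfolded R] that in simp_all)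
  show "move_diam i j (a + b) \<pi> \<le> move_diam i j a \<alpha> + ?U"
    unfolding move_diam_word_dist
  proof (rule SUP_least)
    fix c assume "c \<in> ?R' \<times> ?R'"
    then obtain u v where c: "c = (u, v)" "u \<in> ?R'" "v \<in> ?R'" by blast
    from le[OF c(2,3)] obtain u' v' where *: "u' \<in> ?R" "v' \<in> ?R"
      "word_dist i j ?R' u v \<le> word_dist i j ?R u' v' + ?U" by blast
    have "word_dist i j ?R u' v' \<le> (SUP (u, v) \<in> ?R \<times> ?R. word_dist i j ?R u v)"
      using *(1,2) by (intro SUP_upper2[of "(u', v')"]) auto
    then have "word_dist i j ?R u' v' + ?U \<le>
        (SUP (u, v) \<in> ?R \<times> ?R. word_dist i j ?R u v) + ?U"
      by (rule add_right_mono)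
    with *(3) show "(case c of (u, v) \<Rightarrow> word_dist i j ?R' u v) \<le>
        (SUP (u, v) \<in> ?R \<times> ?R. word_dist i j ?R u v) + ?U"
      unfolding c(1) prod.case by (rule order_trans)
  qed
  let ?V = "ereal (real (i * (l * (b * (a - 2)) + (a choose 2) * (b choose 2)) + j * (l * b)))"
  have ge: "\<exists>u'\<in>?R'. \<exists>v'\<in>?R'. word_dist i j ?R u v + ?V \<le> word_dist i j ?R' u' v'"
    if "u \<in> ?R" "v \<in> ?R" for u v
    by (rule word_dist_ge[of l u v i j, unfolded R R' n]) (use len[unfolded R] that in simp_all)
  show "move_diam i j a \<alpha> + ?V \<le> move_diam i j (a + b) \<pi>"
  \<comment> \<open>Moving the constant inside the supremum takes a nonempty index set; over the
    empty set the supremum is minus infinity.\<close>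
  proof (cases "?R = {}")
    case True
    then show ?thesis by (simp add: move_diam_word_dist bot_ereal_def)
  next
    case False
    then have "move_diam i j a \<alpha> + ?V =
        (SUP c \<in> ?R \<times> ?R. (case c of (u, v) \<Rightarrow> word_dist i j ?R u v) + ?V)"
      unfolding move_diam_word_dist by (intro SUP_ereal_add_left[symmetric]) auto
    also have "\<dots> \<le> move_diam i j (a + b) \<pi>"
    proof (rule SUP_least)
      fix c assume "c \<in> ?R \<times> ?R"
      then obtain u v where c: "c = (u, v)" "u \<in> ?R" "v \<in> ?R" by blast
      from ge[OF c(2,3)] obtain u' v' where *: "u' \<in> ?R'" "v' \<in> ?R'"
        "word_dist i j ?R u v + ?V \<le> word_dist i j ?R' u' v'" by blast
      have "word_dist i j ?R' u' v' \<le> move_diam i j (a + b) \<pi>"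
        unfolding move_diam_word_dist using *(1,2) by (intro SUP_upper2[of "(u', v')"]) auto
      with *(3) show "(case c of (u, v) \<Rightarrow> word_dist i j ?R u v) + ?V \<le> move_diam i j (a + b) \<pi>"
        unfolding c(1) by simp
    qed
    finally show ?thesis .
  qed
qed

lemma perm_length_eq_0:
  assumes "a < 2"
  shows "perm_length a p = 0"
proof -
  have "inversions a p = {}" using assms by (auto simp: inversions_def)
  then show ?thesis by (simp add: perm_length_def)
qed

theorem theorem4p10:
  fixes a b :: nat and \<alpha> \<pi> :: "nat \<Rightarrow> nat"
  assumes "\<alpha> permutes {1..a}"
    and "b \<ge> 1"
    and "\<pi> = inflation21 a b \<alpha> id"
  shows
    "(diam (G_graph a \<alpha>)
        + ereal (real (perm_length a \<alpha>) * real b * (real a - 1)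
                 + real (a choose 2) * real (b choose 2))
      \<le> diam (G_graph (a + b) \<pi>) \<and>
      diam (G_graph (a + b) \<pi>)
      \<le> diam (G_graph a \<alpha>)
        + ereal (real (perm_length a \<alpha>) * real b * (real a - 1)
                 + 2 * real (a choose 2) * real (b choose 2))) \<and>
     diam (C_graph (a + b) \<pi>)
      = diam (C_graph a \<alpha>) + ereal (real (perm_length a \<alpha>) * real b) \<and>
     (diam (B_graph a \<alpha>)
        + ereal (real (perm_length a \<alpha>) * real b * (real a - 2)
                 + real (a choose 2) * real (b choose 2))
      \<le> diam (B_graph (a + b) \<pi>) \<and>
      diam (B_graph (a + b) \<pi>)
      \<le> diam (B_graph a \<alpha>)
        + ereal (real (perm_length a \<alpha>) * real b * (real a - 2)
                 + 2 * real (a choose 2) * real (b choose 2)))"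
proof -
  let ?l = "perm_length a \<alpha>"
  \<comment> \<open>Natural subtraction agrees with real subtraction only for a >= 2; for smaller a
    both sides vanish because the length is 0.\<close>
  have l2: "real (?l * (b * (a - 2))) = real ?l * real b * (real a - 2)"
  proof (cases "a < 2")
    case True
    then show ?thesis using perm_length_eq_0[OF True, of \<alpha>] by simp
  next
    case False
    then show ?thesis by (simp add: of_nat_diff)
  qed
  \<comment> \<open>For G the l b (a - 2) commutations and the l b braids add up to l b (a -
    1).\<close>
  have l1: "real (?l * (b * (a - 2))) + real (?l * b) = real ?l * real b * (real a - 1)"
    unfolding l2 by (simp add: algebra_simps)
  note lower = move_diam_inflation(1)[OF assms(1), where b = b, folded assms(3)]
    and upper = move_diam_inflation(2)[OF assms(1), where b = b, folded assms(3)]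
  have G: "real (1 * (?l * (b * (a - 2)) + k) + 1 * (?l * b)) =
      real ?l * real b * (real a - 1) + real k" for k
    using l1 by simp
  have B: "real (1 * (?l * (b * (a - 2)) + k) + 0 * (?l * b)) =
      real ?l * real b * (real a - 2) + real k" for k
    using l2 by simp
  have C: "real (0 * k + 1 * (?l * b)) = real ?l * real b" for k by simp
  have k: "real ((a choose 2) * (b choose 2)) = real (a choose 2) * real (b choose 2)"
    "real (2 * ((a choose 2) * (b choose 2))) = 2 * real (a choose 2) * real (b choose 2)"
    by simp_all
  show ?thesis
    unfolding diam_G_graph diam_C_graph diam_B_graph
    by (intro conjI lower[of 1 1, unfolded G k] upper[of 1 1, unfolded G k]
        antisym[OF upper[of 0 1, unfolded C] lower[of 0 1, unfolded C]]
        lower[of 1 0, unfolded B k] upper[of 1 0, unfolded B k])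
qed

end
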